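(* Let $K$ be a commutative ring with unit that is both a $\mathbb{Q}$-ring (contains $\mathbb{Q}$ as a subring) and an integral domain, let $\chi=(\chi_d\colon W_d\to U(K))_{d\ge1}$ be an $\omega$-invariant sequence of characters, and let $E$ be a $K$-module with finite basis. Let $h$ and $p\ge0$ be integers with non-negative sum $n=p+h$. Then for any decomposable $n$-$\chi$-vector $a=a_1\chi\ldots\chi a_n\in[\chi]^n(E)$ and any decomposable $p$-$\chi$-form $a^*=a_1^*\chi\ldots\chi a_p^*\in[\chi]^p(E^* )$, the right inner product $a\lfloor a^*$ is the $h$-$\chi$-vector $$\sum_{\rho\in M(\chi;n;p,h)}\chi(\rho)\,\langle a_{\rho(1)}\chi\ldots\chi a_{\rho(p)},\ a_1^*\chi\ldots\chi a_p^*\rangle\ a_{\rho(p+1)}\chi\ldots\chi a_{\rho(n)}$$ in case $n\ge p$, and $0$ in case $n<p$.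
   Context: $S_\infty$ is the group of permutations of the positive integers fixing all but finitely many elements, $S_d\le S_\infty$ the subgroup fixing all $t>d$, and $\omega\colon S_\infty\to S_\infty$ the injective endomorphism $(\omega(\sigma))(1)=1$, $(\omega(\sigma))(t)=\sigma(t-1)+1$ for $t\ge2$. A sequence of group homomorphisms $\chi=(\chi_d\colon W_d\to U(K))_{d\ge1}$ ($U(K)$ the group of units of $K$) is $\omega$-invariant if $W_d\le S_d$, $W_d\le W_{d+1}$, $\omega(W_d)\le W_{d+1}$, and $\chi_{d+1}|_{W_d}=\chi_d=\chi_{d+1}\circ\omega|_{W_d}$ for all $d\ge1$. We write $\chi(\sigma)=\chi_d(\sigma)$ for $\sigma\in W_d$, and $W_0$ is trivial. It is known that then $\chi_d=\chi_d^{-1}$ for all $d$. $S_d$ acts on $T^d(E)$ by $\sigma(x_1\otimes\cdots\otimes x_d)=x_{\sigma^{-1}(1)}\otimes\cdots\otimes x_{\sigma^{-1}(d)}$. $[\chi]^d(E)$ is the quotient of $T^d(E)$ by the submodule generated by all $\chi_d(\sigma)^{-1}z-\sigma z$, $\sigma\in W_d$, $z\in T^d(E)$; $[\chi]^0(E)=K$, and $[\chi]^d(E)=0$ for $d<0$; the image of $x_1\otimes\cdots\otimes x_d$ is $x_1\chi\ldots\chi x_d$ (a decomposable $d$-$\chi$-vector; for $E^*$ in place of $E$, a decomposable $d$-$\chi$-form). $[\chi](E)=\coprod_{d}[\chi]^d(E)$ is an associative graded $K$-algebra with product (also denoted by $\chi$) $(x_1\chi\ldots\chi x_d)\chi(y_1\chi\ldots\chi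 y_e)=x_1\chi\ldots\chi x_d\chi y_1\chi\ldots\chi y_e$; likewise for $[\chi](E^* )$. $\langle\ ,\ \rangle\colon[\chi](E)\times[\chi](E^* )\to K$ is the bilinear form for which components of different degrees are orthogonal, $\langle x_1\chi\ldots\chi x_d,x_1^*\chi\ldots\chi x_d^*\rangle=\sum_{\sigma\in W_d}\chi(\sigma)\prod_{t=1}^d x_t^*(x_{\sigma^{-1}(t)})$ for $d\ge1$, and $\langle k,k^*\rangle=kk^*$ in degree $0$; it is non-singular in each degree (the $K$-modules $[\chi]^d(E)$, $[\chi]^d(E^* )$ being free of finite rank), so each of $[\chi](E)$, $[\chi](E^* )$ is identified with the graded dual of the other. $M(\chi;n;p,h)$, for $p,h\ge0$, $p+h=n$, is the set of lexicographically minimal representatives (comparing the words $(\rho(1),\ldots,\rho(n))$) of the left classes $\rho X$ of $W_n$ modulo its subgroup $X=W_p\times\omega^p(W_h)$. Right inner product: for $a\in[\chi](E)$ and $a^*\in[\chi](E^* )$, $a\lfloor a^*\in[\chi](E)$ is the image of $a$ under the transpose of the left multiplication $x^*\mapsto a^*\chi x^*$ of $[\chi](E^* )$; i.e. it is the unique element with $\langle a\lfloor a^*,x^*\rangle=\langle a,a^*\chi x^*\rangle$ for all $x^*\in[\chi](E^* )$. *)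

theory Defs
  imports Complex_Main "HOL-Algebra.AbelCoset" "HOL-Algebra.Module" "HOL-Algebra.Sym_Groups"
begin

section \<open>Modules over a commutative ring\<close>

text \<open>Records below that are used only as modules leave the ring fields
  \<open>mult\<close> and \<open>one\<close> unspecified.\<close>

definition rat_ring :: "rat ring" where
  "rat_ring = \<lparr>carrier = UNIV, monoid.mult = (*), one = 1, ring.zero = 0, add = (+)\<rparr>"

definition contains_rationals :: "('k, 'r) ring_scheme \<Rightarrow> bool" where
  "contains_rationals K \<longleftrightarrow> (\<exists>f \<in> ring_hom rat_ring K. inj f)"

definition ring_module :: "('k, 'r) ring_scheme \<Rightarrow> ('k, 'k) module" where
  "ring_module K = \<lparr>carrier = carrier K, monoid.mult = monoid.mult K, one = one K,
     ring.zero = ring.zero K, add = add K, smult = monoid.mult K\<rparr>"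

definition has_finite_basis ::
  "('k, 'r) ring_scheme \<Rightarrow> ('k, 'e, 'm) module_scheme \<Rightarrow> bool" where
  "has_finite_basis K E \<longleftrightarrow>
    (\<exists>B. finite B \<and> B \<subseteq> carrier E \<and>
      (\<forall>x\<in>carrier E. \<exists>!c. c \<in> B \<rightarrow>\<^sub>E carrier K \<and> x = (\<Oplus>\<^bsub>E\<^esub>b\<in>B. c b \<odot>\<^bsub>E\<^esub> b)))"

definition lin_maps ::
  "('k, 'r) ring_scheme \<Rightarrow> ('k, 'a, 'm) module_scheme \<Rightarrow> ('k, 'b, 'n) module_scheme \<Rightarrow>
   ('a \<Rightarrow> 'b) set" where
  "lin_maps K M N = {f \<in> carrier M \<rightarrow> carrier N.
     (\<forall>x\<in>carrier M. \<forall>y\<in>carrier M. f (x \<oplus>\<^bsub>M\<^esub> y) = f x \<oplus>\<^bsub>N\<^esub> f y) \<and>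
     (\<forall>k\<in>carrier K. \<forall>x\<in>carrier M. f (k \<odot>\<^bsub>M\<^esub> x) = k \<odot>\<^bsub>N\<^esub> f x)}"

definition bilinear_map ::
  "('k, 'r) ring_scheme \<Rightarrow> ('k, 'a, 'm) module_scheme \<Rightarrow> ('k, 'b, 'n) module_scheme \<Rightarrow>
   ('k, 'c, 'o) module_scheme \<Rightarrow> ('a \<Rightarrow> 'b \<Rightarrow> 'c) \<Rightarrow> bool" where
  "bilinear_map K M N P f \<longleftrightarrow>
     (\<forall>y\<in>carrier N. (\<lambda>x. f x y) \<in> lin_maps K M P) \<and>
     (\<forall>x\<in>carrier M. f x \<in> lin_maps K N P)"

definition dual :: "('k, 'r) ring_scheme \<Rightarrow> ('k, 'e, 'm) module_scheme \<Rightarrow> ('k, 'e \<Rightarrow> 'k) module" where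
  "dual K E =
    \<lparr>carrier = lin_maps K E (ring_module K) \<inter> extensional (carrier E),
     monoid.mult = undefined, one = undefined,
     ring.zero = (\<lambda>x\<in>carrier E. \<zero>\<^bsub>K\<^esub>),
     add = (\<lambda>f g. \<lambda>x\<in>carrier E. f x \<oplus>\<^bsub>K\<^esub> g x),
     smult = (\<lambda>k f. \<lambda>x\<in>carrier E. k \<otimes>\<^bsub>K\<^esub> f x)\<rparr>"

definition gen_submodule ::
  "('k, 'r) ring_scheme \<Rightarrow> ('k, 'a, 'm) module_scheme \<Rightarrow> 'a set \<Rightarrow> 'a set" where
  "gen_submodule K M S = \<Inter>{H. submodule H K M \<and> S \<subseteq> H}"

definition quot_module ::
  "('k, 'a, 'm) module_scheme \<Rightarrow> 'a set \<Rightarrow> ('k, 'a set) module" where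
  "quot_module M N =
    \<lparr>carrier = a_rcosets\<^bsub>M\<^esub> N, monoid.mult = undefined, one = undefined,
     ring.zero = N, add = set_add M,
     smult = (\<lambda>k A. \<Union>x\<in>A. N +>\<^bsub>M\<^esub> (k \<odot>\<^bsub>M\<^esub> x))\<rparr>"

definition free_module :: "('k, 'r) ring_scheme \<Rightarrow> 'x set \<Rightarrow> ('k, 'x \<Rightarrow> 'k) module" where
  "free_module K S =
    \<lparr>carrier = {f. (\<forall>x. f x \<in> carrier K) \<and> finite {x. f x \<noteq> \<zero>\<^bsub>K\<^esub>} \<and> {x. f x \<noteq> \<zero>\<^bsub>K\<^esub>} \<subseteq> S},
     monoid.mult = undefined, one = undefined,
     ring.zero = (\<lambda>x. \<zero>\<^bsub>K\<^esub>),
     add = (\<lambda>f g x. f x \<oplus>\<^bsub>K\<^esub> g x),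
     smult = (\<lambda>k f x. k \<otimes>\<^bsub>K\<^esub> f x)\<rparr>"

definition free_gen :: "('k, 'r) ring_scheme \<Rightarrow> 'x \<Rightarrow> 'x \<Rightarrow> 'k" where
  "free_gen K x = (\<lambda>y. if y = x then \<one>\<^bsub>K\<^esub> else \<zero>\<^bsub>K\<^esub>)"


section \<open>Tensor powers\<close>

text \<open>\<open>d\<close>-tuples are functions on \<open>{1..d}\<close>. The tensor power is the free module on the
  \<open>d\<close>-tuples modulo the relations of multilinearity. There are no relations for \<open>d = 0\<close>,
  so the tensor power of degree 0 is free on the empty tensor, i.e. a copy of \<open>K\<close>.\<close>

definition tuples :: "('k, 'e, 'm) module_scheme \<Rightarrow> nat \<Rightarrow> (nat \<Rightarrow> 'e) set" where
  "tuples M d = {1..d} \<rightarrow>\<^sub>E carrier M"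

definition tensor_rels ::
  "('k, 'r) ring_scheme \<Rightarrow> ('k, 'e, 'm) module_scheme \<Rightarrow> nat \<Rightarrow> ((nat \<Rightarrow> 'e) \<Rightarrow> 'k) set" where
  "tensor_rels K M d = (let F = free_module K (tuples M d); g = free_gen K in
     {g (x(i := u \<oplus>\<^bsub>M\<^esub> v)) \<ominus>\<^bsub>F\<^esub> (g (x(i := u)) \<oplus>\<^bsub>F\<^esub> g (x(i := v))) | x i u v.
        x \<in> tuples M d \<and> i \<in> {1..d} \<and> u \<in> carrier M \<and> v \<in> carrier M} \<union>
     {g (x(i := k \<odot>\<^bsub>M\<^esub> u)) \<ominus>\<^bsub>F\<^esub> k \<odot>\<^bsub>F\<^esub> g (x(i := u)) | x i k u.
        x \<in> tuples M d \<and> i \<in> {1..d} \<and> k \<in> carrier K \<and> u \<in> carrier M})"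

definition tensor_null ::
  "('k, 'r) ring_scheme \<Rightarrow> ('k, 'e, 'm) module_scheme \<Rightarrow> nat \<Rightarrow> ((nat \<Rightarrow> 'e) \<Rightarrow> 'k) set" where
  "tensor_null K M d = gen_submodule K (free_module K (tuples M d)) (tensor_rels K M d)"

definition tensor_power ::
  "('k, 'r) ring_scheme \<Rightarrow> ('k, 'e, 'm) module_scheme \<Rightarrow> nat \<Rightarrow>
   ('k, ((nat \<Rightarrow> 'e) \<Rightarrow> 'k) set) module" where
  "tensor_power K M d = quot_module (free_module K (tuples M d)) (tensor_null K M d)"

definition tensor ::
  "('k, 'r) ring_scheme \<Rightarrow> ('k, 'e, 'm) module_scheme \<Rightarrow> nat \<Rightarrow> (nat \<Rightarrow> 'e) \<Rightarrow>
   ((nat \<Rightarrow> 'e) \<Rightarrow> 'k) set" where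
  "tensor K M d x =
     tensor_null K M d +>\<^bsub>free_module K (tuples M d)\<^esub> free_gen K (restrict x {1..d})"

text \<open>Here and below, \<open>SOME\<close> picks a (bi)linear map which is determined on the carriers by its
  values on decomposable elements, since these generate.\<close>

definition perm_act ::
  "('k, 'r) ring_scheme \<Rightarrow> ('k, 'e, 'm) module_scheme \<Rightarrow> nat \<Rightarrow> (nat \<Rightarrow> nat) \<Rightarrow>
   ((nat \<Rightarrow> 'e) \<Rightarrow> 'k) set \<Rightarrow> ((nat \<Rightarrow> 'e) \<Rightarrow> 'k) set" where
  "perm_act K M d \<sigma> = (SOME f. f \<in> lin_maps K (tensor_power K M d) (tensor_power K M d) \<and>
     (\<forall>x \<in> {1..d} \<rightarrow> carrier M. f (tensor K M d x) = tensor K M d (\<lambda>t. x (inv' \<sigma> t))))"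


section \<open>Invariant sequences of characters\<close>

text \<open>Permutations of the positive integers are functions on \<open>nat\<close> fixing \<open>0\<close>.\<close>

definition omega :: "(nat \<Rightarrow> nat) \<Rightarrow> nat \<Rightarrow> nat" where
  "omega \<sigma> t = (if t \<le> 1 then t else \<sigma> (t - 1) + 1)"

text \<open>The index \<open>d = 0\<close> is included: there the conditions just say that \<open>W 0\<close> and its
  character are trivial.\<close>

definition omega_invariant ::
  "('k, 'r) ring_scheme \<Rightarrow> (nat \<Rightarrow> (nat \<Rightarrow> nat) set) \<Rightarrow> (nat \<Rightarrow> (nat \<Rightarrow> nat) \<Rightarrow> 'k) \<Rightarrow> bool" where
  "omega_invariant K W \<chi> \<longleftrightarrow> (\<forall>d.
     subgroup (W d) (sym_group d) \<and>
     \<chi> d \<in> hom ((sym_group d)\<lparr>carrier := W d\<rparr>) (units_of K) \<and>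
     W d \<subseteq> W (Suc d) \<and> omega ` W d \<subseteq> W (Suc d) \<and>
     (\<forall>\<sigma>\<in>W d. \<chi> (Suc d) \<sigma> = \<chi> d \<sigma> \<and> \<chi> (Suc d) (omega \<sigma>) = \<chi> d \<sigma>))"

definition young_subgroup ::
  "(nat \<Rightarrow> (nat \<Rightarrow> nat) set) \<Rightarrow> nat \<Rightarrow> nat \<Rightarrow> (nat \<Rightarrow> nat) set" where
  "young_subgroup W p h = {\<sigma> \<circ> (omega ^^ p) \<tau> | \<sigma> \<tau>. \<sigma> \<in> W p \<and> \<tau> \<in> W h}"

definition word :: "nat \<Rightarrow> (nat \<Rightarrow> nat) \<Rightarrow> nat list" where
  "word n \<rho> = map \<rho> [1..<Suc n]"

definition min_reps ::
  "(nat \<Rightarrow> (nat \<Rightarrow> nat) set) \<Rightarrow> nat \<Rightarrow> nat \<Rightarrow> nat \<Rightarrow> (nat \<Rightarrow> nat) set" where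
  "min_reps W n p h = {\<rho> \<in> W n.
     \<forall>\<sigma> \<in> \<rho> <#\<^bsub>sym_group n\<^esub> young_subgroup W p h. ord_class.lexordp_eq (word n \<rho>) (word n \<sigma>)}"


section \<open>The algebra of chi-vectors\<close>

definition chi_rels ::
  "('k, 'r) ring_scheme \<Rightarrow> (nat \<Rightarrow> (nat \<Rightarrow> nat) set) \<Rightarrow> (nat \<Rightarrow> (nat \<Rightarrow> nat) \<Rightarrow> 'k) \<Rightarrow>
   ('k, 'e, 'm) module_scheme \<Rightarrow> nat \<Rightarrow> ((nat \<Rightarrow> 'e) \<Rightarrow> 'k) set set" where
  "chi_rels K W \<chi> M d = (let T = tensor_power K M d in
     {(inv\<^bsub>K\<^esub> (\<chi> d \<sigma>) \<odot>\<^bsub>T\<^esub> z) \<ominus>\<^bsub>T\<^esub> perm_act K M d \<sigma> z | \<sigma> z. \<sigma> \<in> W d \<and> z \<in> carrier T})"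

definition chi_null ::
  "('k, 'r) ring_scheme \<Rightarrow> (nat \<Rightarrow> (nat \<Rightarrow> nat) set) \<Rightarrow> (nat \<Rightarrow> (nat \<Rightarrow> nat) \<Rightarrow> 'k) \<Rightarrow>
   ('k, 'e, 'm) module_scheme \<Rightarrow> nat \<Rightarrow> ((nat \<Rightarrow> 'e) \<Rightarrow> 'k) set set" where
  "chi_null K W \<chi> M d = gen_submodule K (tensor_power K M d) (chi_rels K W \<chi> M d)"

definition chi_power ::
  "('k, 'r) ring_scheme \<Rightarrow> (nat \<Rightarrow> (nat \<Rightarrow> nat) set) \<Rightarrow> (nat \<Rightarrow> (nat \<Rightarrow> nat) \<Rightarrow> 'k) \<Rightarrow>
   ('k, 'e, 'm) module_scheme \<Rightarrow> nat \<Rightarrow> ('k, ((nat \<Rightarrow> 'e) \<Rightarrow> 'k) set set) module" where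
  "chi_power K W \<chi> M d = quot_module (tensor_power K M d) (chi_null K W \<chi> M d)"

definition chi_vec ::
  "('k, 'r) ring_scheme \<Rightarrow> (nat \<Rightarrow> (nat \<Rightarrow> nat) set) \<Rightarrow> (nat \<Rightarrow> (nat \<Rightarrow> nat) \<Rightarrow> 'k) \<Rightarrow>
   ('k, 'e, 'm) module_scheme \<Rightarrow> nat \<Rightarrow> (nat \<Rightarrow> 'e) \<Rightarrow> ((nat \<Rightarrow> 'e) \<Rightarrow> 'k) set set" where
  "chi_vec K W \<chi> M d x = chi_null K W \<chi> M d +>\<^bsub>tensor_power K M d\<^esub> tensor K M d x"

definition chi_mult ::
  "('k, 'r) ring_scheme \<Rightarrow> (nat \<Rightarrow> (nat \<Rightarrow> nat) set) \<Rightarrow> (nat \<Rightarrow> (nat \<Rightarrow> nat) \<Rightarrow> 'k) \<Rightarrow>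
   ('k, 'e, 'm) module_scheme \<Rightarrow> nat \<Rightarrow> nat \<Rightarrow>
   ((nat \<Rightarrow> 'e) \<Rightarrow> 'k) set set \<Rightarrow> ((nat \<Rightarrow> 'e) \<Rightarrow> 'k) set set \<Rightarrow> ((nat \<Rightarrow> 'e) \<Rightarrow> 'k) set set" where
  "chi_mult K W \<chi> M d e = (SOME f.
     bilinear_map K (chi_power K W \<chi> M d) (chi_power K W \<chi> M e) (chi_power K W \<chi> M (d + e)) f \<and>
     (\<forall>x \<in> {1..d} \<rightarrow> carrier M. \<forall>y \<in> {1..e} \<rightarrow> carrier M.
        f (chi_vec K W \<chi> M d x) (chi_vec K W \<chi> M e y) =
        chi_vec K W \<chi> M (d + e) (\<lambda>t. if t \<le> d then x t else y (t - d))))"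

definition in_degree :: "(nat \<Rightarrow> ('k, 'a, 'm) module_scheme) \<Rightarrow> nat \<Rightarrow> 'a \<Rightarrow> nat \<Rightarrow> 'a" where
  "in_degree M d x = (\<lambda>i. if i = d then x else \<zero>\<^bsub>M i\<^esub>)"

text \<open>Elements of the direct sum are finitely supported families of homogeneous components.\<close>

definition chi_algebra ::
  "('k, 'r) ring_scheme \<Rightarrow> (nat \<Rightarrow> (nat \<Rightarrow> nat) set) \<Rightarrow> (nat \<Rightarrow> (nat \<Rightarrow> nat) \<Rightarrow> 'k) \<Rightarrow>
   ('k, 'e, 'm) module_scheme \<Rightarrow> ('k, nat \<Rightarrow> ((nat \<Rightarrow> 'e) \<Rightarrow> 'k) set set) module" where
  "chi_algebra K W \<chi> M = (let P = chi_power K W \<chi> M in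
    \<lparr>carrier = {a. (\<forall>d. a d \<in> carrier (P d)) \<and> finite {d. a d \<noteq> \<zero>\<^bsub>P d\<^esub>}},
     monoid.mult = (\<lambda>a b n. \<Oplus>\<^bsub>P n\<^esub>d\<in>{0..n}. chi_mult K W \<chi> M d (n - d) (a d) (b (n - d))),
     one = in_degree P 0 (chi_vec K W \<chi> M 0 (\<lambda>_. undefined)),
     ring.zero = (\<lambda>d. \<zero>\<^bsub>P d\<^esub>),
     add = (\<lambda>a b d. a d \<oplus>\<^bsub>P d\<^esub> b d),
     smult = (\<lambda>k a d. k \<odot>\<^bsub>P d\<^esub> a d)\<rparr>)"

definition decomposable ::
  "('k, 'r) ring_scheme \<Rightarrow> (nat \<Rightarrow> (nat \<Rightarrow> nat) set) \<Rightarrow> (nat \<Rightarrow> (nat \<Rightarrow> nat) \<Rightarrow> 'k) \<Rightarrow>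
   ('k, 'e, 'm) module_scheme \<Rightarrow> nat \<Rightarrow> (nat \<Rightarrow> 'e) \<Rightarrow> nat \<Rightarrow> ((nat \<Rightarrow> 'e) \<Rightarrow> 'k) set set" where
  "decomposable K W \<chi> M d x = in_degree (chi_power K W \<chi> M) d (chi_vec K W \<chi> M d x)"


section \<open>The pairing and the right inner product\<close>

text \<open>For \<open>d = 0\<close> the formula gives \<open>1\<close> on the pair of empty products, hence the
  multiplication of \<open>K\<close> under the identification of degree 0 with \<open>K\<close>.\<close>

definition chi_form_deg ::
  "('k, 'r) ring_scheme \<Rightarrow> (nat \<Rightarrow> (nat \<Rightarrow> nat) set) \<Rightarrow> (nat \<Rightarrow> (nat \<Rightarrow> nat) \<Rightarrow> 'k) \<Rightarrow>
   ('k, 'e, 'm) module_scheme \<Rightarrow> nat \<Rightarrow>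
   ((nat \<Rightarrow> 'e) \<Rightarrow> 'k) set set \<Rightarrow> ((nat \<Rightarrow> 'e \<Rightarrow> 'k) \<Rightarrow> 'k) set set \<Rightarrow> 'k" where
  "chi_form_deg K W \<chi> E d = (SOME f.
     bilinear_map K (chi_power K W \<chi> E d) (chi_power K W \<chi> (dual K E) d) (ring_module K) f \<and>
     (\<forall>x \<in> {1..d} \<rightarrow> carrier E. \<forall>y \<in> {1..d} \<rightarrow> carrier (dual K E).
        f (chi_vec K W \<chi> E d x) (chi_vec K W \<chi> (dual K E) d y) =
        (\<Oplus>\<^bsub>K\<^esub>\<sigma>\<in>W d. \<chi> d \<sigma> \<otimes>\<^bsub>K\<^esub> (\<Otimes>\<^bsub>K\<^esub>t\<in>{1..d}. y t (x (inv' \<sigma> t))))))"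

definition chi_form ::
  "('k, 'r) ring_scheme \<Rightarrow> (nat \<Rightarrow> (nat \<Rightarrow> nat) set) \<Rightarrow> (nat \<Rightarrow> (nat \<Rightarrow> nat) \<Rightarrow> 'k) \<Rightarrow>
   ('k, 'e, 'm) module_scheme \<Rightarrow>
   (nat \<Rightarrow> ((nat \<Rightarrow> 'e) \<Rightarrow> 'k) set set) \<Rightarrow> (nat \<Rightarrow> ((nat \<Rightarrow> 'e \<Rightarrow> 'k) \<Rightarrow> 'k) set set) \<Rightarrow> 'k" where
  "chi_form K W \<chi> E a b =
     (\<Oplus>\<^bsub>K\<^esub>d\<in>{d. a d \<noteq> \<zero>\<^bsub>chi_power K W \<chi> E d\<^esub>}. chi_form_deg K W \<chi> E d (a d) (b d))"

definition right_inner ::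
  "('k, 'r) ring_scheme \<Rightarrow> (nat \<Rightarrow> (nat \<Rightarrow> nat) set) \<Rightarrow> (nat \<Rightarrow> (nat \<Rightarrow> nat) \<Rightarrow> 'k) \<Rightarrow>
   ('k, 'e, 'm) module_scheme \<Rightarrow>
   (nat \<Rightarrow> ((nat \<Rightarrow> 'e) \<Rightarrow> 'k) set set) \<Rightarrow> (nat \<Rightarrow> ((nat \<Rightarrow> 'e \<Rightarrow> 'k) \<Rightarrow> 'k) set set) \<Rightarrow>
   (nat \<Rightarrow> ((nat \<Rightarrow> 'e) \<Rightarrow> 'k) set set)" where
  "right_inner K W \<chi> E a a' = (THE b. b \<in> carrier (chi_algebra K W \<chi> E) \<and>
     (\<forall>x \<in> carrier (chi_algebra K W \<chi> (dual K E)).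
        chi_form K W \<chi> E b x =
        chi_form K W \<chi> E a (a' \<otimes>\<^bsub>chi_algebra K W \<chi> (dual K E)\<^esub> x)))"

end

theory Submission
  imports Defs
begin

text \<open>
  The product formula comes from splitting \<open>W\<^sub>n\<close> into the cosets \<open>\<rho> X\<close> of
  \<open>X = W\<^sub>p \<times> \<omega>\<^sup>p(W\<^sub>h)\<close>: on \<open>\<rho> \<circ> \<sigma> \<circ> \<omega>\<^sup>p(\<tau>)\<close> both \<open>\<chi>\<close> and the product of the values of the forms
  factor, so that the sum over \<open>W\<^sub>n\<close> defining \<open>\<langle>a, a\<^sup>* \<chi> x\<^sup>*\<rangle>\<close> becomes a sum over \<open>\<rho>\<close> of products of a
  pairing in degree \<open>p\<close> and one in degree \<open>h\<close>.

  That the pairing descends to the quotients needs \<open>\<chi>\<^sup>2 = 1\<close>. The commutator of \<open>\<sigma>\<close> with a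
  shift of \<open>\<sigma>\<close> whose support meets that of \<open>\<sigma>\<close> in a single point is a three-cycle in the kernel of \<open>\<chi>\<close>.
  Its shifts generate, far to the right, alternating groups on infinite sets, which are
  preserved by \<open>\<omega>\<^sup>a(\<sigma>)\<close> for large \<open>a\<close>; hence the square of \<open>\<omega>\<^sup>a(\<sigma>)\<close> lies in the kernel.

  The inner product is unique because the pairing is non-degenerate on the left: if \<open>e\<^sub>I\<close> runs
  through the products of basis vectors and \<open>e\<^sub>I\<^sup>*\<close> through the dual products, then
  \<open>\<Sum>\<^sub>I \<langle>u, e\<^sub>I\<^sup>*\<rangle> e\<^sub>I = \<bar>W\<^sub>d\<bar> u\<close>, and \<open>\<bar>W\<^sub>d\<bar>\<close> is invertible in a \<open>\<rat>\<close>-ring.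
\<close>

section \<open>Linear maps\<close>

text \<open>The permutation action, the product and the pairing are defined by \<open>SOME\<close>
  and the inner product by \<open>THE\<close>, so nothing is known about them until a map with the
  required values has been constructed. This makes two universal properties the working tools:
  linear maps out of \<open>tensor_power\<close> and out of \<open>chi_power\<close> exist for
  suitable multilinear maps and are determined by their values on decomposable elements. Bilinear
  maps are reduced to them by currying into a module of linear maps. The representatives \<rho>
  belong to left cosets, whereas the pairing composes tuples with inverse permutations. Passing from
  one to the other inverts the summation index, which is a second place where \<chi> has to agree
  with its inverse. The proof of that identity needs unboundedly many degrees: a character of one
  group \<open>W d\<close> may well have larger order, and it is the presence of all shifts of a
  permutation that excludes this.\<close>

lemma lin_mapsI:
  assumes "\<And>x. x \<in> carrier M \<Longrightarrow> f x \<in> carrier N"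
    and "\<And>x y. x \<in> carrier M \<Longrightarrow> y \<in> carrier M \<Longrightarrow> f (x \<oplus>\<^bsub>M\<^esub> y) = f x \<oplus>\<^bsub>N\<^esub> f y"
    and "\<And>k x. k \<in> carrier K \<Longrightarrow> x \<in> carrier M \<Longrightarrow> f (k \<odot>\<^bsub>M\<^esub> x) = k \<odot>\<^bsub>N\<^esub> f x"
  shows "f \<in> lin_maps K M N"
  using assms by (auto simp: lin_maps_def)

lemma lin_mapsD:
  assumes "f \<in> lin_maps K M N"
  shows "x \<in> carrier M \<Longrightarrow> f x \<in> carrier N"
    and "x \<in> carrier M \<Longrightarrow> y \<in> carrier M \<Longrightarrow> f (x \<oplus>\<^bsub>M\<^esub> y) = f x \<oplus>\<^bsub>N\<^esub> f y"
    and "k \<in> carrier K \<Longrightarrow> x \<in> carrier M \<Longrightarrow> f (k \<odot>\<^bsub>M\<^esub> x) = k \<odot>\<^bsub>N\<^esub> f x"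
  using assms by (auto simp: lin_maps_def)

lemma lin_maps_cong:
  assumes "f \<in> lin_maps K M N" "abelian_group M" "module K M"
    and "\<And>x. x \<in> carrier M \<Longrightarrow> g x = f x"
  shows "g \<in> lin_maps K M N"
proof -
  interpret M: module K M by fact
  show ?thesis
    using assms(4) by (intro lin_mapsI) (simp_all add: lin_mapsD[OF assms(1)])
qed

lemma lin_maps_comp:
  assumes "f \<in> lin_maps K M N" "g \<in> lin_maps K N P"
  shows "(\<lambda>x. g (f x)) \<in> lin_maps K M P"
  by (intro lin_mapsI) (simp_all add: lin_mapsD[OF assms(1)] lin_mapsD[OF assms(2)])

lemma lin_zero:
  assumes "module K M" "module K N" "f \<in> lin_maps K M N"
  shows "f \<zero>\<^bsub>M\<^esub> = \<zero>\<^bsub>N\<^esub>"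
proof -
  interpret M: module K M by fact
  interpret N: module K N by fact
  have "f (\<zero>\<^bsub>K\<^esub> \<odot>\<^bsub>M\<^esub> \<zero>\<^bsub>M\<^esub>) = \<zero>\<^bsub>K\<^esub> \<odot>\<^bsub>N\<^esub> f \<zero>\<^bsub>M\<^esub>"
    by (rule lin_mapsD(3)[OF assms(3)]) auto
  then show ?thesis
    using lin_mapsD(1)[OF assms(3)] by simp
qed

lemma lin_minus:
  assumes "module K M" "module K N" "f \<in> lin_maps K M N" "x \<in> carrier M" "y \<in> carrier M"
  shows "f (x \<ominus>\<^bsub>M\<^esub> y) = f x \<ominus>\<^bsub>N\<^esub> f y"
proof -
  interpret M: module K M by fact
  interpret N: module K N by fact
  have "f (\<ominus>\<^bsub>M\<^esub> y) = f ((\<ominus>\<^bsub>K\<^esub> \<one>\<^bsub>K\<^esub>) \<odot>\<^bsub>M\<^esub> y)"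
    using assms by (simp add: M.smult_l_minus)
  also have "\<dots> = \<ominus>\<^bsub>N\<^esub> f y"
    using assms(5) by (simp add: N.smult_l_minus lin_mapsD[OF assms(3)])
  finally show ?thesis
    using assms(4,5) by (simp add: a_minus_def lin_mapsD[OF assms(3)])
qed

lemma lin_finsum:
  assumes "module K M" "module K N" "f \<in> lin_maps K M N" "finite A" "g \<in> A \<rightarrow> carrier M"
  shows "f (\<Oplus>\<^bsub>M\<^esub>i\<in>A. g i) = (\<Oplus>\<^bsub>N\<^esub>i\<in>A. f (g i))"
proof -
  interpret M: module K M by fact
  interpret N: module K N by fact
  show ?thesis
    using assms(4,5)
    by (induction A rule: finite_induct)
       (simp_all add: lin_zero[OF assms(1-3)] lin_mapsD[OF assms(3)] Pi_def)
qed

lemma lin_maps_zero: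
  assumes "module K M" "module K N"
  shows "(\<lambda>x. \<zero>\<^bsub>N\<^esub>) \<in> lin_maps K M N"
proof -
  interpret M: module K M by fact
  interpret N: module K N by fact
  show ?thesis by (intro lin_mapsI) auto
qed

lemma lin_maps_add:
  assumes "module K M" "module K N" "f \<in> lin_maps K M N" "g \<in> lin_maps K M N"
  shows "(\<lambda>x. f x \<oplus>\<^bsub>N\<^esub> g x) \<in> lin_maps K M N"
proof -
  interpret M: module K M by fact
  interpret N: module K N by fact
  show ?thesis
    by (intro lin_mapsI)
      (simp_all add: lin_mapsD[OF assms(3)] lin_mapsD[OF assms(4)] N.a_ac N.smult_r_distr)
qed

lemma lin_maps_smult:
  assumes "module K M" "module K N" "f \<in> lin_maps K M N" "k \<in> carrier K"
  shows "(\<lambda>x. k \<odot>\<^bsub>N\<^esub> f x) \<in> lin_maps K M N"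
proof -
  interpret M: module K M by fact
  interpret N: module K N by fact
  show ?thesis
  proof (rule lin_mapsI)
    fix c x assume c: "c \<in> carrier K" and x: "x \<in> carrier M"
    have "k \<odot>\<^bsub>N\<^esub> f (c \<odot>\<^bsub>M\<^esub> x) = (k \<otimes>\<^bsub>K\<^esub> c) \<odot>\<^bsub>N\<^esub> f x"
      using c x assms(4) by (simp add: lin_mapsD[OF assms(3)] N.smult_assoc1)
    also have "k \<otimes>\<^bsub>K\<^esub> c = c \<otimes>\<^bsub>K\<^esub> k"
      by (rule M.m_comm) fact+
    finally show "k \<odot>\<^bsub>N\<^esub> f (c \<odot>\<^bsub>M\<^esub> x) = c \<odot>\<^bsub>N\<^esub> (k \<odot>\<^bsub>N\<^esub> f x)"
      using c x assms(4) by (simp add: lin_mapsD[OF assms(3)] N.smult_assoc1)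
  qed (use assms(4) in \<open>simp_all add: lin_mapsD[OF assms(3)] N.smult_r_distr\<close>)
qed

lemma lin_maps_finsum:
  assumes "module K M" "module K N" "finite A" "\<And>i. i \<in> A \<Longrightarrow> f i \<in> lin_maps K M N"
  shows "(\<lambda>x. \<Oplus>\<^bsub>N\<^esub>i\<in>A. f i x) \<in> lin_maps K M N"
proof -
  interpret M: module K M by fact
  interpret N: module K N by fact
  show ?thesis
    using assms(3,4)
  proof (induction A rule: finite_induct)
    case empty
    show ?case using lin_maps_zero[OF assms(1,2)] by simp
  next
    case (insert i A)
    then have "(\<lambda>x. f i x \<oplus>\<^bsub>N\<^esub> (\<Oplus>\<^bsub>N\<^esub>i\<in>A. f i x)) \<in> lin_maps K M N"
      by (intro lin_maps_add[OF assms(1,2)]) auto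
    then show ?case
      by (rule lin_maps_cong[OF _ M.abelian_group_axioms assms(1)])
        (use insert in \<open>simp add: Pi_def lin_mapsD(1)[of _ K M N]\<close>)
  qed
qed

lemma ring_module_simps [simp]:
  "carrier (ring_module K) = carrier K" "add (ring_module K) = add K"
  "ring.zero (ring_module K) = \<zero>\<^bsub>K\<^esub>" "smult (ring_module K) = monoid.mult K"
  "finsum (ring_module K) = finsum K"
  by (simp_all add: ring_module_def finsum_def finprod_def fun_eq_iff)

lemma ring_module_module:
  assumes "cring K"
  shows "module K (ring_module K)"
proof -
  interpret cring K by fact
  show ?thesis
  proof (rule moduleI)
    show "abelian_group (ring_module K)"
      by (rule abelian_groupI) (auto simp: a_ac intro: bexI[where x = "\<ominus>\<^bsub>K\<^esub> _"] l_neg)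
  qed (auto simp: assms l_distr r_distr m_assoc)
qed

text \<open>Makes a sum of scalars acting on one fixed vector an instance of
  \<open>lin_finsum\<close>, with \<open>ring_module K\<close> as the source.\<close>

lemma lin_maps_scale:
  assumes "module K M" "c \<in> carrier M"
  shows "(\<lambda>k. k \<odot>\<^bsub>M\<^esub> c) \<in> lin_maps K (ring_module K) M"
proof -
  interpret M: module K M by fact
  show ?thesis
    using assms by (intro lin_mapsI) (simp_all add: M.smult_l_distr M.smult_assoc1)
qed

text \<open>The \<open>extensional\<close> part makes maps that agree on \<open>carrier M\<close>
  equal as functions, so that the module axioms can hold as equations. The dual is the case
  \<open>N = ring_module K\<close>; the general case is the target of curried bilinear maps.\<close>

definition hom_module ::
  "('k, 'r) ring_scheme \<Rightarrow> ('k, 'a, 'm) module_scheme \<Rightarrow> ('k, 'b, 'n) module_scheme \<Rightarrow>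
   ('k, 'a \<Rightarrow> 'b) module" where
  "hom_module K M N =
    \<lparr>carrier = lin_maps K M N \<inter> extensional (carrier M),
     monoid.mult = undefined, one = undefined,
     ring.zero = (\<lambda>x\<in>carrier M. \<zero>\<^bsub>N\<^esub>),
     add = (\<lambda>f g. \<lambda>x\<in>carrier M. f x \<oplus>\<^bsub>N\<^esub> g x),
     smult = (\<lambda>k f. \<lambda>x\<in>carrier M. k \<odot>\<^bsub>N\<^esub> f x)\<rparr>"

lemma hom_module_simps:
  "carrier (hom_module K M N) = lin_maps K M N \<inter> extensional (carrier M)"
  "ring.zero (hom_module K M N) = (\<lambda>x\<in>carrier M. \<zero>\<^bsub>N\<^esub>)"
  "add (hom_module K M N) = (\<lambda>f g. \<lambda>x\<in>carrier M. f x \<oplus>\<^bsub>N\<^esub> g x)"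
  "smult (hom_module K M N) = (\<lambda>k f. \<lambda>x\<in>carrier M. k \<odot>\<^bsub>N\<^esub> f x)"
  by (simp_all add: hom_module_def)

lemma restrict_lin_maps:
  assumes "module K M" "f \<in> lin_maps K M N"
  shows "restrict f (carrier M) \<in> carrier (hom_module K M N)"
proof -
  interpret M: module K M by fact
  show ?thesis
    by (auto simp: hom_module_simps lin_mapsD[OF assms(2)] intro!: lin_mapsI)
qed

lemma hom_module_module:
  assumes "module K M" "module K N"
  shows "module K (hom_module K M N)"
proof -
  interpret M: module K M by fact
  interpret N: module K N by fact
  let ?H = "hom_module K M N"
  have H: "f x \<in> carrier N" if "f \<in> carrier ?H" "x \<in> carrier M" for f x
    using that lin_mapsD(1)[of f K M N x] by (auto simp: hom_module_simps)
  have L: "f \<in> lin_maps K M N" if "f \<in> carrier ?H" for f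
    using that by (auto simp: hom_module_simps)
  have eqI: "f = g" if "f \<in> carrier ?H" "g \<in> carrier ?H" "\<And>x. x \<in> carrier M \<Longrightarrow> f x = g x" for f g
    using that by (auto simp: hom_module_simps intro: extensionalityI)
  have add: "f \<oplus>\<^bsub>?H\<^esub> g \<in> carrier ?H" if "f \<in> carrier ?H" "g \<in> carrier ?H" for f g
    using restrict_lin_maps[OF assms(1) lin_maps_add[OF assms L L, OF that]]
    by (simp add: hom_module_simps(3))
  have smult: "k \<odot>\<^bsub>?H\<^esub> g \<in> carrier ?H" if "k \<in> carrier K" "g \<in> carrier ?H" for k g
    using restrict_lin_maps[OF assms(1) lin_maps_smult[OF assms L, OF that(2,1)]]
    by (simp add: hom_module_simps(4))
  have zero: "\<zero>\<^bsub>?H\<^esub> \<in> carrier ?H"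
    using restrict_lin_maps[OF assms(1) lin_maps_zero[OF assms]]
    by (simp add: hom_module_simps(2))
  have app: "x \<in> carrier M \<Longrightarrow> (f \<oplus>\<^bsub>?H\<^esub> g) x = f x \<oplus>\<^bsub>N\<^esub> g x"
       "x \<in> carrier M \<Longrightarrow> (k \<odot>\<^bsub>?H\<^esub> g) x = k \<odot>\<^bsub>N\<^esub> g x"
       "x \<in> carrier M \<Longrightarrow> \<zero>\<^bsub>?H\<^esub> x = \<zero>\<^bsub>N\<^esub>" for f g k x
    by (simp_all add: hom_module_simps)
  show ?thesis
  proof (rule moduleI)
    show "abelian_group ?H"
    proof (rule abelian_groupI)
      fix f assume f: "f \<in> carrier ?H"
      \<comment> \<open>The additive inverse is taken as the multiple by minus one, so that its
        closure follows from \<open>smult\<close>.\<close>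
      show "\<exists>g\<in>carrier ?H. g \<oplus>\<^bsub>?H\<^esub> f = \<zero>\<^bsub>?H\<^esub>"
        using f H[OF f]
        by (intro bexI[of _ "(\<ominus>\<^bsub>K\<^esub> \<one>\<^bsub>K\<^esub>) \<odot>\<^bsub>?H\<^esub> f"] eqI)
          (auto simp: app zero add smult N.smult_l_minus N.l_neg)
    qed (auto intro!: eqI simp: add smult zero app H N.a_ac)
  qed (auto intro!: eqI simp: add smult app H N.smult_l_distr N.smult_r_distr N.smult_assoc1
        M.cring_axioms)
qed

lemma dual_eq_hom_module: "dual K E = hom_module K E (ring_module K)"
  by (simp add: dual_def hom_module_def)

lemma (in abelian_group) minus_eq_zeroD:
  assumes "x \<ominus> y = \<zero>" "x \<in> carrier G" "y \<in> carrier G"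
  shows "x = y"
proof -
  have "x = (x \<ominus> y) \<oplus> y"
    using assms(2,3) by (simp add: a_minus_def a_assoc l_neg)
  then show ?thesis using assms by simp
qed

section \<open>Quotients and generated submodules\<close>

context
  fixes K :: "('k, 'r) ring_scheme" and M :: "('k, 'a, 'm) module_scheme" and N
  assumes M: "module K M" and N: "submodule N K M"
begin

interpretation module K M by (fact M)

interpretation N: abelian_subgroup N M
  using N by (intro abelian_subgroupI3 additive_subgroupI submodule.axioms(1) abelian_group_axioms)

lemma quot_carrier: "carrier (quot_module M N) = (\<lambda>x. N +>\<^bsub>M\<^esub> x) ` carrier M"
  by (auto simp: quot_module_def A_RCOSETS_def')

lemma quot_zero: "\<zero>\<^bsub>quot_module M N\<^esub> = N +>\<^bsub>M\<^esub> \<zero>\<^bsub>M\<^esub>"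
  by (simp add: quot_module_def N.a_subset)

lemma quot_add:
  "x \<in> carrier M \<Longrightarrow> y \<in> carrier M \<Longrightarrow>
    (N +>\<^bsub>M\<^esub> x) \<oplus>\<^bsub>quot_module M N\<^esub> (N +>\<^bsub>M\<^esub> y) = N +>\<^bsub>M\<^esub> (x \<oplus>\<^bsub>M\<^esub> y)"
  by (simp add: quot_module_def N.a_rcos_sum)

lemma quot_eq_iff:
  assumes "x \<in> carrier M" "y \<in> carrier M"
  shows "N +>\<^bsub>M\<^esub> x = N +>\<^bsub>M\<^esub> y \<longleftrightarrow> x \<ominus>\<^bsub>M\<^esub> y \<in> N"
proof -
  have "N +>\<^bsub>M\<^esub> x = N +>\<^bsub>M\<^esub> y \<longleftrightarrow> x \<in> N +>\<^bsub>M\<^esub> y"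
    using assms a_repr_independence N.a_subgroup N.a_rcos_self by metis
  then show ?thesis
    using assms N.a_rcos_module_imp N.a_rcos_module_rev by (metis a_minus_def)
qed

text \<open>\<open>quot_module\<close> scales a coset by a union over all its elements.
  Representatives differ by elements of \<open>N\<close>, which is closed under scaling, so every
  member of the union is the same coset.\<close>

lemma quot_smult:
  assumes k: "k \<in> carrier K" and x: "x \<in> carrier M"
  shows "k \<odot>\<^bsub>quot_module M N\<^esub> (N +>\<^bsub>M\<^esub> x) = N +>\<^bsub>M\<^esub> (k \<odot>\<^bsub>M\<^esub> x)"
proof -
  have "N +>\<^bsub>M\<^esub> (k \<odot>\<^bsub>M\<^esub> z) = N +>\<^bsub>M\<^esub> (k \<odot>\<^bsub>M\<^esub> x)" if z: "z \<in> N +>\<^bsub>M\<^esub> x" for z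
  proof -
    have zc: "z \<in> carrier M" using z x by (metis N.a_elemrcos_carrier)
    have "N +>\<^bsub>M\<^esub> x = N +>\<^bsub>M\<^esub> z"
      using z x N.a_subgroup by (intro a_repr_independence)
    then have "z \<ominus>\<^bsub>M\<^esub> x \<in> N" using quot_eq_iff[OF zc x] by simp
    then have "k \<odot>\<^bsub>M\<^esub> (z \<ominus>\<^bsub>M\<^esub> x) \<in> N"
      using k submodule.smult_closed[OF N] by simp
    also have "k \<odot>\<^bsub>M\<^esub> (z \<ominus>\<^bsub>M\<^esub> x) = k \<odot>\<^bsub>M\<^esub> z \<ominus>\<^bsub>M\<^esub> k \<odot>\<^bsub>M\<^esub> x"
      using k zc x by (simp add: a_minus_def smult_r_distr smult_r_minus)
    finally show ?thesis using k zc x quot_eq_iff by simp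
  qed
  moreover have "x \<in> N +>\<^bsub>M\<^esub> x" using x by (rule N.a_rcos_self)
  ultimately have "(\<Union>z\<in>N +>\<^bsub>M\<^esub> x. N +>\<^bsub>M\<^esub> (k \<odot>\<^bsub>M\<^esub> z)) = N +>\<^bsub>M\<^esub> (k \<odot>\<^bsub>M\<^esub> x)"
    by blast
  then show ?thesis by (simp add: quot_module_def)
qed

lemmas quot_simps = quot_zero quot_add quot_smult

lemma quot_module_module: "module K (quot_module M N)"
proof (rule moduleI)
  show "cring K" by (rule cring_axioms)
  show "abelian_group (quot_module M N)"
  proof (rule abelian_groupI)
    fix A assume "A \<in> carrier (quot_module M N)"
    then obtain x where "x \<in> carrier M" "A = N +>\<^bsub>M\<^esub> x" by (auto simp: quot_carrier)
    then show "\<exists>B\<in>carrier (quot_module M N). B \<oplus>\<^bsub>quot_module M N\<^esub> A = \<zero>\<^bsub>quot_module M N\<^esub>"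
      by (intro bexI[of _ "N +>\<^bsub>M\<^esub> (\<ominus>\<^bsub>M\<^esub> x)"]) (auto simp: quot_carrier quot_simps l_neg)
  qed (auto simp: quot_carrier quot_simps a_ac)
qed (auto simp: quot_carrier quot_simps smult_l_distr smult_r_distr smult_assoc1)

lemma quot_proj_lin: "(\<lambda>x. N +>\<^bsub>M\<^esub> x) \<in> lin_maps K M (quot_module M N)"
  by (intro lin_mapsI) (auto simp: quot_carrier quot_simps)

text \<open>Applying \<open>f\<close> to a chosen representative is unambiguous because two
  representatives differ by an element of \<open>N\<close>, on which \<open>f\<close>
  vanishes.\<close>

lemma quot_lift:
  assumes P: "module K P" and f: "f \<in> lin_maps K M P" and 0: "\<And>x. x \<in> N \<Longrightarrow> f x = \<zero>\<^bsub>P\<^esub>"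
  shows "\<exists>g\<in>lin_maps K (quot_module M N) P. \<forall>x\<in>carrier M. g (N +>\<^bsub>M\<^esub> x) = f x"
proof -
  interpret P: module K P by (fact P)
  define g where "g A = f (SOME x. x \<in> carrier M \<and> A = N +>\<^bsub>M\<^esub> x)" for A
  have g: "g (N +>\<^bsub>M\<^esub> x) = f x" if x: "x \<in> carrier M" for x
  proof -
    define y where "y = (SOME y. y \<in> carrier M \<and> N +>\<^bsub>M\<^esub> x = N +>\<^bsub>M\<^esub> y)"
    have y: "y \<in> carrier M" "N +>\<^bsub>M\<^esub> x = N +>\<^bsub>M\<^esub> y"
      using someI[of "\<lambda>y. y \<in> carrier M \<and> N +>\<^bsub>M\<^esub> x = N +>\<^bsub>M\<^esub> y" x] x by (auto simp: y_def)
    then have "f (x \<ominus>\<^bsub>M\<^esub> y) = \<zero>\<^bsub>P\<^esub>" using quot_eq_iff x 0 by auto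
    then have "f x \<ominus>\<^bsub>P\<^esub> f y = \<zero>\<^bsub>P\<^esub>"
      by (simp only: lin_minus[OF M P f x y(1)])
    then have "f x = f y"
      by (rule P.minus_eq_zeroD) (rule lin_mapsD(1)[OF f] x y(1))+
    then show ?thesis by (simp add: g_def flip: y_def)
  qed
  have "g \<in> lin_maps K (quot_module M N) P"
    by (intro lin_mapsI) (auto simp: quot_carrier quot_simps g lin_mapsD[OF f])
  with g show ?thesis by blast
qed

end

lemma gen_submodule_submodule:
  assumes "module K M" "S \<subseteq> carrier M"
  shows "submodule (gen_submodule K M S) K M"
proof -
  interpret module K M by fact
  have *: "H \<subseteq> carrier M" "\<zero>\<^bsub>M\<^esub> \<in> H" if "submodule H K M" for H
  proof -
    interpret H: additive_subgroup H M
      using that by (intro additive_subgroupI submodule.axioms(1))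
    show "H \<subseteq> carrier M" "\<zero>\<^bsub>M\<^esub> \<in> H" using H.a_subset by auto
  qed
  show ?thesis
  proof (rule submoduleI)
    show "gen_submodule K M S \<subseteq> carrier M"
      using carrier_is_submodule assms(2) by (auto simp: gen_submodule_def)
    show "\<zero>\<^bsub>M\<^esub> \<in> gen_submodule K M S"
      using * by (auto simp: gen_submodule_def)
  qed (auto simp: gen_submodule_def dest: submoduleE(3-5))
qed

lemma gen_submodule_incl: "S \<subseteq> gen_submodule K M S"
  by (auto simp: gen_submodule_def)

lemma kernel_submodule:
  assumes "module K M" "module K P" "f \<in> lin_maps K M P"
  shows "submodule {x \<in> carrier M. f x = \<zero>\<^bsub>P\<^esub>} K M"
proof -
  interpret M: module K M by fact
  interpret P: module K P by fact
  have "f (\<ominus>\<^bsub>M\<^esub> x) = \<ominus>\<^bsub>P\<^esub> f x" if "x \<in> carrier M" for x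
    using lin_minus[OF assms M.zero_closed that] that lin_mapsD(1)[OF assms(3) that]
    by (simp add: a_minus_def lin_zero[OF assms])
  then show ?thesis
    by (intro M.submoduleI) (auto simp: lin_zero[OF assms] lin_mapsD[OF assms(3)])
qed

text \<open>The kernel of \<open>f\<close> is one of the submodules in the intersection. The lemma
  reduces well-definedness on both quotients, the tensor power and the module of chi-vectors, to a
  check on the generating relations.\<close>

lemma gen_submodule_kernel:
  assumes "module K M" "module K P" "f \<in> lin_maps K M P" "S \<subseteq> carrier M"
    and "\<And>x. x \<in> S \<Longrightarrow> f x = \<zero>\<^bsub>P\<^esub>" "x \<in> gen_submodule K M S"
  shows "f x = \<zero>\<^bsub>P\<^esub>"
  using kernel_submodule[OF assms(1-3)] assms(4-6) by (auto simp: gen_submodule_def)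

section \<open>Free modules\<close>

lemma free_module_simps:
  "f \<in> carrier (free_module K S) \<longleftrightarrow>
    (\<forall>x. f x \<in> carrier K) \<and> finite {x. f x \<noteq> \<zero>\<^bsub>K\<^esub>} \<and> {x. f x \<noteq> \<zero>\<^bsub>K\<^esub>} \<subseteq> S"
  "ring.zero (free_module K S) = (\<lambda>x. \<zero>\<^bsub>K\<^esub>)"
  "add (free_module K S) = (\<lambda>f g x. f x \<oplus>\<^bsub>K\<^esub> g x)"
  "smult (free_module K S) = (\<lambda>k f x. k \<otimes>\<^bsub>K\<^esub> f x)"
  by (simp_all add: free_module_def)

lemma free_module_module:
  assumes "cring K"
  shows "module K (free_module K S)"
proof -
  interpret cring K by fact
  let ?F = "free_module K S"
  have add: "f \<oplus>\<^bsub>?F\<^esub> g \<in> carrier ?F" if "f \<in> carrier ?F" "g \<in> carrier ?F" for f g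
  proof -
    have "{x. f x \<oplus>\<^bsub>K\<^esub> g x \<noteq> \<zero>\<^bsub>K\<^esub>} \<subseteq> {x. f x \<noteq> \<zero>\<^bsub>K\<^esub>} \<union> {x. g x \<noteq> \<zero>\<^bsub>K\<^esub>}" by auto
    with that show ?thesis unfolding free_module_simps by (auto intro: finite_subset)
  qed
  have smult: "k \<odot>\<^bsub>?F\<^esub> f \<in> carrier ?F" if "f \<in> carrier ?F" "k \<in> carrier K" for f k
  proof -
    have "{x. k \<otimes>\<^bsub>K\<^esub> f x \<noteq> \<zero>\<^bsub>K\<^esub>} \<subseteq> {x. f x \<noteq> \<zero>\<^bsub>K\<^esub>}" using that by auto
    with that show ?thesis unfolding free_module_simps by (auto intro: finite_subset)
  qed
  show ?thesis
  proof (rule moduleI)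
    show "abelian_group ?F"
    proof (rule abelian_groupI)
      fix f assume f: "f \<in> carrier ?F"
      show "\<exists>g\<in>carrier ?F. g \<oplus>\<^bsub>?F\<^esub> f = \<zero>\<^bsub>?F\<^esub>"
        using f smult[OF f, of "\<ominus>\<^bsub>K\<^esub> \<one>\<^bsub>K\<^esub>"]
        by (intro bexI[of _ "(\<ominus>\<^bsub>K\<^esub> \<one>\<^bsub>K\<^esub>) \<odot>\<^bsub>?F\<^esub> f"])
          (auto simp: free_module_simps l_minus l_neg)
    qed (auto simp: add, auto simp: free_module_simps fun_eq_iff a_ac)
  qed (auto simp: assms add smult,
       auto simp: free_module_simps fun_eq_iff l_distr r_distr m_assoc)
qed

lemma free_gen_closed:
  assumes "cring K" "x \<in> S"
  shows "free_gen K x \<in> carrier (free_module K S)"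
proof -
  interpret cring K by fact
  have "{y. free_gen K x y \<noteq> \<zero>\<^bsub>K\<^esub>} \<subseteq> {x}" by (auto simp: free_gen_def)
  with assms show ?thesis
    unfolding free_module_simps by (auto simp: free_gen_def intro: finite_subset)
qed

lemma free_finsum_apply:
  assumes "cring K" "finite A" "g \<in> A \<rightarrow> carrier (free_module K S)"
  shows "(\<Oplus>\<^bsub>free_module K S\<^esub>i\<in>A. g i) x = (\<Oplus>\<^bsub>K\<^esub>i\<in>A. g i x)"
proof -
  interpret cring K by fact
  interpret F: module K "free_module K S" by (rule free_module_module) fact
  show ?thesis
    using assms(2,3)
  proof (induction A rule: finite_induct)
    case (insert a A)
    then have "g a x \<in> carrier K" "\<forall>i\<in>A. g i x \<in> carrier K"
      by (auto simp: free_module_simps(1) Pi_def)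
    with insert show ?case by (auto simp: free_module_simps(3) Pi_def)
  qed (simp add: free_module_simps)
qed

lemma free_module_expand:
  assumes "cring K" "f \<in> carrier (free_module K S)"
  shows "f = (\<Oplus>\<^bsub>free_module K S\<^esub>x\<in>{x. f x \<noteq> \<zero>\<^bsub>K\<^esub>}. f x \<odot>\<^bsub>free_module K S\<^esub> free_gen K x)"
proof
  fix y
  interpret cring K by fact
  interpret F: module K "free_module K S" by (rule free_module_module) fact
  let ?A = "{x. f x \<noteq> \<zero>\<^bsub>K\<^esub>}"
  have f: "f x \<in> carrier K" "finite ?A" "f x \<noteq> \<zero>\<^bsub>K\<^esub> \<Longrightarrow> x \<in> S" for x
    using assms(2) by (auto simp: free_module_simps(1))
  have "(\<Oplus>\<^bsub>free_module K S\<^esub>x\<in>?A. f x \<odot>\<^bsub>free_module K S\<^esub> free_gen K x) y =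
      (\<Oplus>\<^bsub>K\<^esub>x\<in>?A. (f x \<odot>\<^bsub>free_module K S\<^esub> free_gen K x) y)"
    using f by (intro free_finsum_apply[OF assms(1)] Pi_I F.smult_closed
        free_gen_closed[OF assms(1)]) auto
  also have "\<dots> = (\<Oplus>\<^bsub>K\<^esub>x\<in>?A. if y = x then f x else \<zero>\<^bsub>K\<^esub>)"
    using f by (intro finsum_cong') (auto simp: free_module_simps free_gen_def)
  also have "\<dots> = f y"
  proof (cases "y \<in> ?A")
    case True
    then show ?thesis using f by (subst finsum_singleton) auto
  next
    case False
    then have "(\<Oplus>\<^bsub>K\<^esub>x\<in>?A. if y = x then f x else \<zero>\<^bsub>K\<^esub>) = (\<Oplus>\<^bsub>K\<^esub>x\<in>?A. \<zero>\<^bsub>K\<^esub>)"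
      by (intro finsum_cong') auto
    with False show ?thesis by simp
  qed
  finally show "f y = (\<Oplus>\<^bsub>free_module K S\<^esub>x\<in>?A. f x \<odot>\<^bsub>free_module K S\<^esub> free_gen K x) y" ..
qed

lemma free_module_lin_eqI:
  assumes "cring K" "module K P" "f \<in> lin_maps K (free_module K S) P"
    "g \<in> lin_maps K (free_module K S) P"
    and "\<And>x. x \<in> S \<Longrightarrow> f (free_gen K x) = g (free_gen K x)"
    and r: "r \<in> carrier (free_module K S)"
  shows "f r = g r"
proof -
  interpret F: module K "free_module K S" by (rule free_module_module) fact
  interpret P: module K P by fact
  let ?A = "{x. r x \<noteq> \<zero>\<^bsub>K\<^esub>}"
  have A: "r x \<in> carrier K" "finite ?A" "r x \<noteq> \<zero>\<^bsub>K\<^esub> \<Longrightarrow> x \<in> S" for x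
    using r by (auto simp: free_module_simps(1))
  note gen = free_gen_closed[OF assms(1)]
  have *: "h r = (\<Oplus>\<^bsub>P\<^esub>x\<in>?A. r x \<odot>\<^bsub>P\<^esub> h (free_gen K x))"
    if h: "h \<in> lin_maps K (free_module K S) P" for h
  proof -
    have "h r = h (\<Oplus>\<^bsub>free_module K S\<^esub>x\<in>?A. r x \<odot>\<^bsub>free_module K S\<^esub> free_gen K x)"
      using free_module_expand[OF assms(1) r] by simp
    also have "\<dots> = (\<Oplus>\<^bsub>P\<^esub>x\<in>?A. h (r x \<odot>\<^bsub>free_module K S\<^esub> free_gen K x))"
      using A by (intro lin_finsum[OF F.module_axioms assms(2) h] Pi_I F.smult_closed gen) auto
    also have "\<dots> = (\<Oplus>\<^bsub>P\<^esub>x\<in>?A. r x \<odot>\<^bsub>P\<^esub> h (free_gen K x))"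
      using A gen[OF A(3)] by (intro P.finsum_cong') (auto simp: lin_mapsD[OF h])
    finally show ?thesis .
  qed
  have "(\<Oplus>\<^bsub>P\<^esub>x\<in>?A. r x \<odot>\<^bsub>P\<^esub> f (free_gen K x)) = (\<Oplus>\<^bsub>P\<^esub>x\<in>?A. r x \<odot>\<^bsub>P\<^esub> g (free_gen K x))"
    using A gen[OF A(3)] assms(5) by (intro P.finsum_cong') (auto simp: lin_mapsD[OF assms(4)])
  with *[OF assms(3)] *[OF assms(4)] show ?thesis by simp
qed

lemma free_module_lift:
  assumes "cring K" "module K P" "\<phi> \<in> S \<rightarrow> carrier P"
  shows "\<exists>f\<in>lin_maps K (free_module K S) P. \<forall>x\<in>S. f (free_gen K x) = \<phi> x"
proof -
  interpret F: module K "free_module K S" by (rule free_module_module) fact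
  interpret P: module K P by fact
  define f where "f r = (\<Oplus>\<^bsub>P\<^esub>x\<in>{x. r x \<noteq> \<zero>\<^bsub>K\<^esub>}. r x \<odot>\<^bsub>P\<^esub> \<phi> x)" for r
  \<comment> \<open>The support depends on \<open>r\<close>. Summing over any finite set between the
    support and \<open>S\<close> allows \<open>r\<close>, \<open>s\<close> and their sum to be
    compared over a common index set.\<close>
  have f: "f r = (\<Oplus>\<^bsub>P\<^esub>x\<in>A. r x \<odot>\<^bsub>P\<^esub> \<phi> x)"
    if "r \<in> carrier (free_module K S)" "finite A" "{x. r x \<noteq> \<zero>\<^bsub>K\<^esub>} \<subseteq> A" "A \<subseteq> S" for r A
    unfolding f_def
    using that assms(3) by (intro P.add.finprod_mono_neutral_cong_left)
      (auto simp: free_module_simps(1) Pi_def)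
  have fin: "finite {x. r x \<noteq> \<zero>\<^bsub>K\<^esub>}" "\<And>x. r x \<noteq> \<zero>\<^bsub>K\<^esub> \<Longrightarrow> x \<in> S" "\<And>x. r x \<in> carrier K"
    if "r \<in> carrier (free_module K S)" for r
    using that by (auto simp: free_module_simps(1))
  have "f \<in> lin_maps K (free_module K S) P"
  proof (rule lin_mapsI)
    fix r assume r: "r \<in> carrier (free_module K S)"
    show "f r \<in> carrier P"
      unfolding f_def using fin[OF r] assms(3) by (auto intro!: P.finsum_closed)
    fix s assume s: "s \<in> carrier (free_module K S)"
    let ?A = "{x. r x \<noteq> \<zero>\<^bsub>K\<^esub>} \<union> {x. s x \<noteq> \<zero>\<^bsub>K\<^esub>}"
    have "f (r \<oplus>\<^bsub>free_module K S\<^esub> s) =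
      (\<Oplus>\<^bsub>P\<^esub>x\<in>?A. (r \<oplus>\<^bsub>free_module K S\<^esub> s) x \<odot>\<^bsub>P\<^esub> \<phi> x)"
      using fin[OF r] fin[OF s] by (intro f F.a_closed r s) (auto simp: free_module_simps(3))
    also have "\<dots> = (\<Oplus>\<^bsub>P\<^esub>x\<in>?A. r x \<odot>\<^bsub>P\<^esub> \<phi> x \<oplus>\<^bsub>P\<^esub> s x \<odot>\<^bsub>P\<^esub> \<phi> x)"
      using fin[OF r] fin[OF s] funcset_mem[OF assms(3)]
      by (intro P.finsum_cong') (auto simp: free_module_simps(3) P.smult_l_distr)
    also have "\<dots> = (\<Oplus>\<^bsub>P\<^esub>x\<in>?A. r x \<odot>\<^bsub>P\<^esub> \<phi> x) \<oplus>\<^bsub>P\<^esub> (\<Oplus>\<^bsub>P\<^esub>x\<in>?A. s x \<odot>\<^bsub>P\<^esub> \<phi> x)"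
      using fin[OF r] fin[OF s] funcset_mem[OF assms(3)] by (intro P.finsum_addf) auto
    also have "\<dots> = f r \<oplus>\<^bsub>P\<^esub> f s"
      using fin[OF r] fin[OF s] by (subst f[OF r, of ?A] f[OF s, of ?A]; auto)+
    finally show "f (r \<oplus>\<^bsub>free_module K S\<^esub> s) = f r \<oplus>\<^bsub>P\<^esub> f s" .
  next
    fix k r assume k: "k \<in> carrier K" and r: "r \<in> carrier (free_module K S)"
    let ?A = "{x. r x \<noteq> \<zero>\<^bsub>K\<^esub>}"
    have "f (k \<odot>\<^bsub>free_module K S\<^esub> r) =
      (\<Oplus>\<^bsub>P\<^esub>x\<in>?A. (k \<odot>\<^bsub>free_module K S\<^esub> r) x \<odot>\<^bsub>P\<^esub> \<phi> x)"
      using fin[OF r] k by (intro f F.smult_closed r k) (auto simp: free_module_simps(4))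
    also have "\<dots> = (\<Oplus>\<^bsub>P\<^esub>x\<in>?A. k \<odot>\<^bsub>P\<^esub> (r x \<odot>\<^bsub>P\<^esub> \<phi> x))"
      using fin[OF r] funcset_mem[OF assms(3)] k
      by (intro P.finsum_cong') (auto simp: free_module_simps(4) P.smult_assoc1)
    also have "\<dots> = k \<odot>\<^bsub>P\<^esub> f r"
      unfolding f_def using fin[OF r] funcset_mem[OF assms(3)] k
      by (intro P.finsum_smult_ldistr[symmetric]) auto
    finally show "f (k \<odot>\<^bsub>free_module K S\<^esub> r) = k \<odot>\<^bsub>P\<^esub> f r" .
  qed
  moreover have "f (free_gen K x) = \<phi> x" if "x \<in> S" for x
  proof -
    have "f (free_gen K x) = (\<Oplus>\<^bsub>P\<^esub>y\<in>{x}. free_gen K x y \<odot>\<^bsub>P\<^esub> \<phi> y)"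
      using that by (intro f free_gen_closed assms) (auto simp: free_gen_def)
    also have "\<dots> = \<phi> x" using that funcset_mem[OF assms(3)] by (auto simp: free_gen_def)
    finally show ?thesis .
  qed
  ultimately show ?thesis by blast
qed

\<comment> \<open>Keeps the index sets \<open>{1..d}\<close> from being rewritten to \<open>{Suc 0..d}\<close>.\<close>
declare One_nat_def [simp del]

section \<open>Multilinear maps and tensor powers\<close>

text \<open>A multilinear map is only evaluated on tuples indexed by \<open>{1..d}\<close>, so it has to ignore the
  values of its argument elsewhere.\<close>

definition multilinear ::
  "('k, 'r) ring_scheme \<Rightarrow> ('k, 'e, 'm) module_scheme \<Rightarrow> nat \<Rightarrow> ('k, 'p, 'n) module_scheme \<Rightarrow>
   ((nat \<Rightarrow> 'e) \<Rightarrow> 'p) \<Rightarrow> bool" where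
  "multilinear K M d P \<phi> \<longleftrightarrow>
     (\<forall>x\<in>{1..d} \<rightarrow> carrier M. \<phi> x \<in> carrier P \<and> \<phi> (restrict x {1..d}) = \<phi> x) \<and>
     (\<forall>x\<in>{1..d} \<rightarrow> carrier M. \<forall>i\<in>{1..d}. (\<lambda>u. \<phi> (x(i := u))) \<in> lin_maps K M P)"

lemma multilinearI:
  assumes "\<And>x. x \<in> {1..d} \<rightarrow> carrier M \<Longrightarrow> \<phi> x \<in> carrier P"
    and "\<And>x. x \<in> {1..d} \<rightarrow> carrier M \<Longrightarrow> \<phi> (restrict x {1..d}) = \<phi> x"
    and "\<And>x i. x \<in> {1..d} \<rightarrow> carrier M \<Longrightarrow> i \<in> {1..d} \<Longrightarrow>
      (\<lambda>u. \<phi> (x(i := u))) \<in> lin_maps K M P"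
  shows "multilinear K M d P \<phi>"
  using assms by (simp add: multilinear_def)

lemma multilinearD:
  assumes "multilinear K M d P \<phi>" "x \<in> {1..d} \<rightarrow> carrier M"
  shows "\<phi> x \<in> carrier P"
    and "\<phi> (restrict x {1..d}) = \<phi> x"
    and "i \<in> {1..d} \<Longrightarrow> (\<lambda>u. \<phi> (x(i := u))) \<in> lin_maps K M P"
  using assms by (simp_all add: multilinear_def)

lemma multilinear_cong:
  assumes "multilinear K M d P \<phi>" "x \<in> {1..d} \<rightarrow> carrier M" "\<And>t. t \<in> {1..d} \<Longrightarrow> y t = x t"
  shows "\<phi> y = \<phi> x"
proof -
  have "restrict y {1..d} = restrict x {1..d}" using assms(3) by (auto simp: restrict_def)
  moreover have "y \<in> {1..d} \<rightarrow> carrier M" using assms(2,3) by (auto simp: Pi_def)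
  ultimately show ?thesis using multilinearD(2)[OF assms(1)] assms(2) by metis
qed

lemma lin_multilinear:
  assumes "multilinear K M d P \<phi>" "f \<in> lin_maps K P Q"
  shows "multilinear K M d Q (\<lambda>x. f (\<phi> x))"
proof (rule multilinearI)
  fix x i assume x: "x \<in> {1..d} \<rightarrow> carrier M" and i: "i \<in> {1..d}"
  show "(\<lambda>u. f (\<phi> (x(i := u)))) \<in> lin_maps K M Q"
    by (rule lin_maps_comp[OF multilinearD(3)[OF assms(1) x i] assms(2)])
qed (auto simp: multilinearD[OF assms(1)] lin_mapsD(1)[OF assms(2)])

text \<open>The entry of \<open>x\<close> at \<open>i\<close> stands at place
  \<open>\<sigma> i\<close> of the permuted tuple, so linearity at \<open>i\<close> is inherited
  from linearity of \<open>\<phi>\<close> at \<open>\<sigma> i\<close>.\<close>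

lemma multilinear_perm:
  assumes "multilinear K M d P \<phi>" "\<sigma> permutes {1..d}"
  shows "multilinear K M d P (\<lambda>x. \<phi> (\<lambda>t. x (inv' \<sigma> t)))"
proof (rule multilinearI)
  have inv: "inv' \<sigma> t \<in> {1..d}" if "t \<in> {1..d}" for t
    using permutes_in_image[OF permutes_inv[OF assms(2)]] that by blast
  fix x assume x: "x \<in> {1..d} \<rightarrow> carrier M"
  have x': "(\<lambda>t. x (inv' \<sigma> t)) \<in> {1..d} \<rightarrow> carrier M"
    using x inv by (auto simp: Pi_def)
  show "\<phi> (\<lambda>t. x (inv' \<sigma> t)) \<in> carrier P" by (rule multilinearD(1)[OF assms(1) x'])
  show "\<phi> (\<lambda>t. restrict x {1..d} (inv' \<sigma> t)) = \<phi> (\<lambda>t. x (inv' \<sigma> t))"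
    by (rule multilinear_cong[OF assms(1) x']) (use inv in simp)
  fix i assume i: "i \<in> {1..d}"
  have "(\<lambda>t. (x(i := u)) (inv' \<sigma> t)) = (\<lambda>t. x (inv' \<sigma> t))(\<sigma> i := u)" for u
    using permutes_inverses[OF assms(2)] by fastforce
  moreover have "\<sigma> i \<in> {1..d}" using i permutes_in_image[OF assms(2)] by blast
  ultimately show "(\<lambda>u. \<phi> (\<lambda>t. (x(i := u)) (inv' \<sigma> t))) \<in> lin_maps K M P"
    using multilinearD(3)[OF assms(1) x'] by simp
qed

lemma multilinear_smult:
  assumes "module K M" "module K P" "multilinear K M d P \<phi>" "k \<in> carrier K"
  shows "multilinear K M d P (\<lambda>x. k \<odot>\<^bsub>P\<^esub> \<phi> x)"
proof (rule lin_multilinear[OF assms(3)])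
  have "(\<lambda>x. x) \<in> lin_maps K P P" by (rule lin_mapsI) simp_all
  from lin_maps_smult[OF assms(2,2) this assms(4)] show "(\<odot>\<^bsub>P\<^esub>) k \<in> lin_maps K P P" .
qed

lemma multilinear_finsum:
  assumes "module K M" "module K P" "finite A" "\<And>i. i \<in> A \<Longrightarrow> multilinear K M d P (\<phi> i)"
  shows "multilinear K M d P (\<lambda>x. \<Oplus>\<^bsub>P\<^esub>i\<in>A. \<phi> i x)"
proof (rule multilinearI)
  interpret P: module K P by fact
  fix x assume x: "x \<in> {1..d} \<rightarrow> carrier M"
  show "(\<Oplus>\<^bsub>P\<^esub>i\<in>A. \<phi> i x) \<in> carrier P"
    by (intro P.finsum_closed Pi_I multilinearD(1)[OF assms(4) x])
  show "(\<Oplus>\<^bsub>P\<^esub>i\<in>A. \<phi> i (restrict x {1..d})) = (\<Oplus>\<^bsub>P\<^esub>i\<in>A. \<phi> i x)"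
    using multilinearD(1,2)[OF assms(4) x] by (intro P.finsum_cong') auto
  fix i assume "i \<in> {1..d}"
  then show "(\<lambda>u. \<Oplus>\<^bsub>P\<^esub>j\<in>A. \<phi> j (x(i := u))) \<in> lin_maps K M P"
    using multilinearD(3)[OF assms(4) x] by (intro lin_maps_finsum[OF assms(1,2,3)])
qed

section \<open>The universal property of tensor powers\<close>

context
  fixes K :: "('k, 'r) ring_scheme" and M :: "('k, 'e, 'm) module_scheme"
  assumes M: "module K M"
begin

interpretation M: module K M by (fact M)

lemma upd_tuples:
  "x \<in> tuples M d \<Longrightarrow> i \<in> {1..d} \<Longrightarrow> u \<in> carrier M \<Longrightarrow> x(i := u) \<in> tuples M d"
  by (auto simp: tuples_def PiE_def Pi_def extensional_def)

lemma tensor_rels_closed: "tensor_rels K M d \<subseteq> carrier (free_module K (tuples M d))"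
proof -
  interpret F: module K "free_module K (tuples M d)"
    by (rule free_module_module[OF M.cring_axioms])
  show ?thesis
    unfolding tensor_rels_def Let_def
    by (intro Un_least subsetI)
      (auto intro!: F.minus_closed F.a_closed F.smult_closed
        free_gen_closed[OF M.cring_axioms] upd_tuples)
qed

lemma tensor_null_submodule:
  "submodule (tensor_null K M d) K (free_module K (tuples M d))"
  unfolding tensor_null_def
  by (rule gen_submodule_submodule[OF free_module_module[OF M.cring_axioms] tensor_rels_closed])

lemmas tensor_quot = free_module_module[OF M.cring_axioms] tensor_null_submodule

lemma tensor_power_module: "module K (tensor_power K M d)"
  unfolding tensor_power_def by (rule quot_module_module[OF tensor_quot])

lemma tensor_multilinear: "multilinear K M d (tensor_power K M d) (tensor K M d)"
proof (rule multilinearI)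
  let ?F = "free_module K (tuples M d)" and ?N = "tensor_null K M d"
  interpret F: module K ?F by (rule free_module_module[OF M.cring_axioms])
  fix x assume x: "x \<in> {1..d} \<rightarrow> carrier M"
  define y where "y = restrict x {1..d}"
  have y: "y \<in> tuples M d" using x by (auto simp: y_def tuples_def)
  show "tensor K M d x \<in> carrier (tensor_power K M d)"
    unfolding tensor_power_def tensor_def quot_carrier[OF tensor_quot]
    using y by (intro imageI free_gen_closed[OF M.cring_axioms]) (simp add: y_def)
  show "tensor K M d (restrict x {1..d}) = tensor K M d x"
    by (simp add: tensor_def)
  fix i assume i: "i \<in> {1..d}"
  have upd: "tensor K M d (x(i := u)) = ?N +>\<^bsub>?F\<^esub> free_gen K (y(i := u))" for u
  proof -
    have "restrict (x(i := u)) {1..d} = y(i := u)" using i by (auto simp: y_def)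
    then show ?thesis by (simp add: tensor_def)
  qed
  have g: "free_gen K (y(i := u)) \<in> carrier ?F" if "u \<in> carrier M" for u
    by (rule free_gen_closed[OF M.cring_axioms upd_tuples[OF y i that]])
  have rels: "r \<in> ?N" if "r \<in> tensor_rels K M d" for r
    unfolding tensor_null_def by (rule subsetD[OF gen_submodule_incl that])
  show "(\<lambda>u. tensor K M d (x(i := u))) \<in> lin_maps K M (tensor_power K M d)"
    unfolding upd tensor_power_def
  proof (rule lin_mapsI)
    fix u v assume u: "u \<in> carrier M" and v: "v \<in> carrier M"
    have "free_gen K (y(i := u \<oplus>\<^bsub>M\<^esub> v)) \<ominus>\<^bsub>?F\<^esub>
        (free_gen K (y(i := u)) \<oplus>\<^bsub>?F\<^esub> free_gen K (y(i := v))) \<in> ?N"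
      using y i u v by (intro rels) (auto simp: tensor_rels_def Let_def)
    then show "?N +>\<^bsub>?F\<^esub> free_gen K (y(i := u \<oplus>\<^bsub>M\<^esub> v)) =
        (?N +>\<^bsub>?F\<^esub> free_gen K (y(i := u))) \<oplus>\<^bsub>quot_module ?F ?N\<^esub>
        (?N +>\<^bsub>?F\<^esub> free_gen K (y(i := v)))"
      using u v by (simp add: quot_add[OF tensor_quot] g quot_eq_iff[OF tensor_quot])
  next
    fix k u assume k: "k \<in> carrier K" and u: "u \<in> carrier M"
    have "free_gen K (y(i := k \<odot>\<^bsub>M\<^esub> u)) \<ominus>\<^bsub>?F\<^esub> k \<odot>\<^bsub>?F\<^esub> free_gen K (y(i := u)) \<in> ?N"
      using y i k u by (intro rels) (auto simp: tensor_rels_def Let_def)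
    then show "?N +>\<^bsub>?F\<^esub> free_gen K (y(i := k \<odot>\<^bsub>M\<^esub> u)) =
        k \<odot>\<^bsub>quot_module ?F ?N\<^esub> (?N +>\<^bsub>?F\<^esub> free_gen K (y(i := u)))"
      using k u by (simp add: quot_smult[OF tensor_quot] g quot_eq_iff[OF tensor_quot])
  qed (auto simp: quot_carrier[OF tensor_quot] g)
qed

text \<open>Multilinearity of \<open>\<phi>\<close> is the vanishing of its free extension on
  \<open>tensor_rels\<close>. The generators are tuples restricted to \<open>{1..d}\<close>, which
  is where the indifference of \<open>\<phi>\<close> to other values enters.\<close>

lemma tensor_lift:
  assumes P: "module K P" and \<phi>: "multilinear K M d P \<phi>"
  shows "\<exists>f\<in>lin_maps K (tensor_power K M d) P. \<forall>x\<in>{1..d} \<rightarrow> carrier M. f (tensor K M d x) = \<phi> x"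
proof -
  let ?F = "free_module K (tuples M d)" and ?N = "tensor_null K M d"
  interpret F: module K ?F by (rule free_module_module[OF M.cring_axioms])
  interpret P: module K P by fact
  have tup: "x \<in> {1..d} \<rightarrow> carrier M" if "x \<in> tuples M d" for x
    using that by (auto simp: tuples_def)
  obtain f where f: "f \<in> lin_maps K ?F P" "\<And>x. x \<in> tuples M d \<Longrightarrow> f (free_gen K x) = \<phi> x"
    using free_module_lift[OF M.cring_axioms P, of \<phi> "tuples M d"] multilinearD(1)[OF \<phi>] tup
    by (auto simp: Pi_def)
  note g = free_gen_closed[OF M.cring_axioms, of _ "tuples M d"]
  note lm = lin_minus[OF F.module_axioms P f(1)]
  have "f r = \<zero>\<^bsub>P\<^esub>" if "r \<in> tensor_rels K M d" for r
    using that unfolding tensor_rels_def Let_def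
  proof (elim UnE CollectE exE conjE)
    fix x i u v
    assume r: "r = free_gen K (x(i := u \<oplus>\<^bsub>M\<^esub> v)) \<ominus>\<^bsub>?F\<^esub>
        (free_gen K (x(i := u)) \<oplus>\<^bsub>?F\<^esub> free_gen K (x(i := v)))"
      and x: "x \<in> tuples M d" "i \<in> {1..d}" "u \<in> carrier M" "v \<in> carrier M"
    note L = multilinearD(3)[OF \<phi> tup[OF x(1)] x(2)]
    have "f r = \<phi> (x(i := u \<oplus>\<^bsub>M\<^esub> v)) \<ominus>\<^bsub>P\<^esub> (\<phi> (x(i := u)) \<oplus>\<^bsub>P\<^esub> \<phi> (x(i := v)))"
      using x unfolding r by (simp add: lm lin_mapsD(2)[OF f(1)] f(2) g upd_tuples)
    moreover have "\<phi> (x(i := u \<oplus>\<^bsub>M\<^esub> v)) = \<phi> (x(i := u)) \<oplus>\<^bsub>P\<^esub> \<phi> (x(i := v))"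
      by (rule lin_mapsD(2)[OF L x(3,4)])
    ultimately show ?thesis
      using lin_mapsD(1)[OF L x(3)] lin_mapsD(1)[OF L x(4)] by (simp add: a_minus_def P.r_neg)
  next
    fix x i k u
    assume r: "r = free_gen K (x(i := k \<odot>\<^bsub>M\<^esub> u)) \<ominus>\<^bsub>?F\<^esub> k \<odot>\<^bsub>?F\<^esub> free_gen K (x(i := u))"
      and x: "x \<in> tuples M d" "i \<in> {1..d}" "k \<in> carrier K" "u \<in> carrier M"
    note L = multilinearD(3)[OF \<phi> tup[OF x(1)] x(2)]
    have "f r = \<phi> (x(i := k \<odot>\<^bsub>M\<^esub> u)) \<ominus>\<^bsub>P\<^esub> k \<odot>\<^bsub>P\<^esub> \<phi> (x(i := u))"
      using x unfolding r by (simp add: lm lin_mapsD(3)[OF f(1)] f(2) g upd_tuples)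
    moreover have "\<phi> (x(i := k \<odot>\<^bsub>M\<^esub> u)) = k \<odot>\<^bsub>P\<^esub> \<phi> (x(i := u))"
      by (rule lin_mapsD(3)[OF L x(3,4)])
    ultimately show ?thesis
      using lin_mapsD(1)[OF L x(4)] x(3) by (simp add: a_minus_def P.r_neg)
  qed
  then have "f r = \<zero>\<^bsub>P\<^esub>" if "r \<in> ?N" for r
    using gen_submodule_kernel[OF F.module_axioms P f(1) tensor_rels_closed] that
    by (simp add: tensor_null_def)
  from quot_lift[OF tensor_quot P f(1) this] obtain h where h: "h \<in> lin_maps K (tensor_power K M d) P"
    "\<And>r. r \<in> carrier ?F \<Longrightarrow> h (?N +>\<^bsub>?F\<^esub> r) = f r"
    by (auto simp: tensor_power_def)
  have "h (tensor K M d x) = \<phi> x" if x: "x \<in> {1..d} \<rightarrow> carrier M" for x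
  proof -
    have y: "restrict x {1..d} \<in> tuples M d" using x by (auto simp: tuples_def)
    have "h (tensor K M d x) = \<phi> (restrict x {1..d})"
      unfolding tensor_def h(2)[OF g[OF y]] by (rule f(2)[OF y])
    then show ?thesis by (simp only: multilinearD(2)[OF \<phi> x])
  qed
  with h(1) show ?thesis by blast
qed

text \<open>Along the projection the comparison is pulled back to the free generators. This is the
  sense in which a linear map picked by \<open>SOME\<close> is determined by its values on
  decomposable tensors.\<close>

lemma tensor_lin_eqI:
  assumes P: "module K P" and f: "f \<in> lin_maps K (tensor_power K M d) P"
    and g: "g \<in> lin_maps K (tensor_power K M d) P"
    and eq: "\<And>x. x \<in> {1..d} \<rightarrow> carrier M \<Longrightarrow> f (tensor K M d x) = g (tensor K M d x)"
    and z: "z \<in> carrier (tensor_power K M d)"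
  shows "f z = g z"
proof -
  let ?F = "free_module K (tuples M d)" and ?N = "tensor_null K M d"
  note pr = quot_proj_lin[OF tensor_quot, of d, folded tensor_power_def]
  obtain r where r: "r \<in> carrier ?F" "z = ?N +>\<^bsub>?F\<^esub> r"
    using z by (auto simp: tensor_power_def quot_carrier[OF tensor_quot])
  have "f (?N +>\<^bsub>?F\<^esub> free_gen K x) = g (?N +>\<^bsub>?F\<^esub> free_gen K x)" if x: "x \<in> tuples M d" for x
  proof -
    have "x \<in> {1..d} \<rightarrow> carrier M" "restrict x {1..d} = x"
      using x by (auto simp: tuples_def PiE_def extensional_restrict)
    then show ?thesis using eq[of x] by (simp add: tensor_def)
  qed
  then show ?thesis
    unfolding r(2)
    by (intro free_module_lin_eqI[OF M.cring_axioms P lin_maps_comp[OF pr f] lin_maps_comp[OF pr g]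
          _ r(1)])
qed

text \<open>Permuting the arguments of the tensor map is again multilinear, so the choice in
  \<open>perm_act\<close> has a witness and inherits its defining properties.\<close>

lemma perm_act:
  assumes "\<sigma> permutes {1..d}"
  shows "perm_act K M d \<sigma> \<in> lin_maps K (tensor_power K M d) (tensor_power K M d)"
    and "x \<in> {1..d} \<rightarrow> carrier M \<Longrightarrow>
      perm_act K M d \<sigma> (tensor K M d x) = tensor K M d (\<lambda>t. x (inv' \<sigma> t))"
proof -
  have "\<exists>f. f \<in> lin_maps K (tensor_power K M d) (tensor_power K M d) \<and>
     (\<forall>x \<in> {1..d} \<rightarrow> carrier M. f (tensor K M d x) = tensor K M d (\<lambda>t. x (inv' \<sigma> t)))"
    using tensor_lift[OF tensor_power_module multilinear_perm[OF tensor_multilinear assms]]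
    by blast
  from someI_ex[OF this]
  show "perm_act K M d \<sigma> \<in> lin_maps K (tensor_power K M d) (tensor_power K M d)"
    and "x \<in> {1..d} \<rightarrow> carrier M \<Longrightarrow>
      perm_act K M d \<sigma> (tensor K M d x) = tensor K M d (\<lambda>t. x (inv' \<sigma> t))"
    by (auto simp: perm_act_def)
qed

end

section \<open>The modules of chi-vectors\<close>

locale invariant_chars = K: cring K for K :: "('k, 'r) ring_scheme" +
  fixes W :: "nat \<Rightarrow> (nat \<Rightarrow> nat) set" and \<chi> :: "nat \<Rightarrow> (nat \<Rightarrow> nat) \<Rightarrow> 'k"
  assumes inv: "omega_invariant K W \<chi>"
begin

lemma W_subgroup: "subgroup (W d) (sym_group d)"
  using inv by (simp add: omega_invariant_def)

lemma W_permutes: "\<sigma> \<in> W d \<Longrightarrow> \<sigma> permutes {1..d}"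
  using subgroup.subset[OF W_subgroup] by (auto simp: sym_group_def)

lemma chi_Units: "\<sigma> \<in> W d \<Longrightarrow> \<chi> d \<sigma> \<in> Units K"
  using inv by (auto simp: omega_invariant_def hom_def units_of_def)

lemma chi_closed [simp]: "\<sigma> \<in> W d \<Longrightarrow> \<chi> d \<sigma> \<in> carrier K"
  using chi_Units K.Units_closed by blast

lemma inv_chi_closed [simp]: "\<sigma> \<in> W d \<Longrightarrow> inv\<^bsub>K\<^esub> (\<chi> d \<sigma>) \<in> carrier K"
  using chi_Units K.Units_inv_closed by blast

text \<open>These are the maps that factor through \<open>chi_power\<close>, as
  \<open>chi_lift\<close> shows; the inverse of the character is the factor that occurs in
  \<open>chi_rels\<close>.\<close>

definition chi_multilinear ::
  "('k, 'e, 'm) module_scheme \<Rightarrow> nat \<Rightarrow> ('k, 'p, 'n) module_scheme \<Rightarrow>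
   ((nat \<Rightarrow> 'e) \<Rightarrow> 'p) \<Rightarrow> bool" where
  "chi_multilinear M d P \<phi> \<longleftrightarrow> multilinear K M d P \<phi> \<and>
     (\<forall>\<sigma>\<in>W d. \<forall>x\<in>{1..d} \<rightarrow> carrier M. \<phi> (\<lambda>t. x (inv' \<sigma> t)) = inv\<^bsub>K\<^esub> (\<chi> d \<sigma>) \<odot>\<^bsub>P\<^esub> \<phi> x)"

lemma chi_multilinearD:
  assumes "chi_multilinear M d P \<phi>"
  shows "multilinear K M d P \<phi>"
    and "\<sigma> \<in> W d \<Longrightarrow> x \<in> {1..d} \<rightarrow> carrier M \<Longrightarrow>
      \<phi> (\<lambda>t. x (inv' \<sigma> t)) = inv\<^bsub>K\<^esub> (\<chi> d \<sigma>) \<odot>\<^bsub>P\<^esub> \<phi> x"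
  using assms by (simp_all add: chi_multilinear_def)

context
  fixes M :: "('k, 'e, 'm) module_scheme"
  assumes M: "module K M"
begin

interpretation M: module K M by (fact M)

lemma chi_rels_closed: "chi_rels K W \<chi> M d \<subseteq> carrier (tensor_power K M d)"
proof -
  interpret T: module K "tensor_power K M d" by (rule tensor_power_module[OF M])
  show ?thesis
    by (auto simp: chi_rels_def Let_def
        intro!: T.minus_closed T.smult_closed lin_mapsD(1)[OF perm_act(1)[OF M]] W_permutes)
qed

lemma chi_null_submodule: "submodule (chi_null K W \<chi> M d) K (tensor_power K M d)"
  unfolding chi_null_def by (rule gen_submodule_submodule[OF tensor_power_module[OF M] chi_rels_closed])

lemmas chi_quot = tensor_power_module[OF M] chi_null_submodule

lemma chi_power_module: "module K (chi_power K W \<chi> M d)"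
  unfolding chi_power_def by (rule quot_module_module[OF chi_quot])

lemma chi_vec_chi_multilinear: "chi_multilinear M d (chi_power K W \<chi> M d) (chi_vec K W \<chi> M d)"
  unfolding chi_multilinear_def
proof (intro conjI ballI)
  note pr = quot_proj_lin[OF chi_quot, of d, folded chi_power_def]
  interpret T: module K "tensor_power K M d" by (rule tensor_power_module[OF M])
  show "multilinear K M d (chi_power K W \<chi> M d) (chi_vec K W \<chi> M d)"
    using lin_multilinear[OF tensor_multilinear[OF M] pr] by (simp add: chi_vec_def[abs_def])
  fix \<sigma> x assume \<sigma>: "\<sigma> \<in> W d" and x: "x \<in> {1..d} \<rightarrow> carrier M"
  let ?t = "tensor K M d"
  have t: "?t x \<in> carrier (tensor_power K M d)"
    by (rule multilinearD(1)[OF tensor_multilinear[OF M] x])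
  have "inv\<^bsub>K\<^esub> (\<chi> d \<sigma>) \<odot>\<^bsub>tensor_power K M d\<^esub> ?t x \<ominus>\<^bsub>tensor_power K M d\<^esub> perm_act K M d \<sigma> (?t x) \<in>
      chi_rels K W \<chi> M d"
    using \<sigma> t by (auto simp: chi_rels_def Let_def)
  then have "inv\<^bsub>K\<^esub> (\<chi> d \<sigma>) \<odot>\<^bsub>tensor_power K M d\<^esub> ?t x \<ominus>\<^bsub>tensor_power K M d\<^esub> perm_act K M d \<sigma> (?t x) \<in>
      chi_null K W \<chi> M d"
    unfolding chi_null_def by (rule subsetD[OF gen_submodule_incl])
  then have "chi_null K W \<chi> M d +>\<^bsub>tensor_power K M d\<^esub> (inv\<^bsub>K\<^esub> (\<chi> d \<sigma>) \<odot>\<^bsub>tensor_power K M d\<^esub> ?t x) =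
      chi_null K W \<chi> M d +>\<^bsub>tensor_power K M d\<^esub> perm_act K M d \<sigma> (?t x)"
    using t \<sigma> lin_mapsD(1)[OF perm_act(1)[OF M W_permutes[OF \<sigma>]] t]
    by (simp add: quot_eq_iff[OF chi_quot])
  then show "chi_vec K W \<chi> M d (\<lambda>t. x (inv' \<sigma> t)) =
      inv\<^bsub>K\<^esub> (\<chi> d \<sigma>) \<odot>\<^bsub>chi_power K W \<chi> M d\<^esub> chi_vec K W \<chi> M d x"
    using \<sigma> t by (simp add: chi_vec_def chi_power_def quot_smult[OF chi_quot]
        perm_act(2)[OF M W_permutes[OF \<sigma>] x])
qed

lemmas chi_vec_multilinear = chi_multilinearD(1)[OF chi_vec_chi_multilinear]
lemmas chi_vec_closed = multilinearD(1)[OF chi_vec_multilinear]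

lemma chi_lift:
  assumes P: "module K P" and \<phi>: "chi_multilinear M d P \<phi>"
  shows "\<exists>f\<in>lin_maps K (chi_power K W \<chi> M d) P.
    \<forall>x\<in>{1..d} \<rightarrow> carrier M. f (chi_vec K W \<chi> M d x) = \<phi> x"
proof -
  let ?T = "tensor_power K M d" and ?C = "chi_null K W \<chi> M d"
  interpret T: module K ?T by (rule tensor_power_module[OF M])
  interpret P: module K P by fact
  note \<phi>' = chi_multilinearD(1)[OF \<phi>]
  obtain f where f: "f \<in> lin_maps K ?T P" "\<And>x. x \<in> {1..d} \<rightarrow> carrier M \<Longrightarrow> f (tensor K M d x) = \<phi> x"
    using tensor_lift[OF M P \<phi>'] by blast
  have "f r = \<zero>\<^bsub>P\<^esub>" if "r \<in> chi_rels K W \<chi> M d" for r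
  proof -
    from that obtain \<sigma> z where \<sigma>: "\<sigma> \<in> W d" and z: "z \<in> carrier ?T"
      and r: "r = inv\<^bsub>K\<^esub> (\<chi> d \<sigma>) \<odot>\<^bsub>?T\<^esub> z \<ominus>\<^bsub>?T\<^esub> perm_act K M d \<sigma> z"
      by (auto simp: chi_rels_def Let_def)
    note pa = perm_act[OF M W_permutes[OF \<sigma>]]
    have p: "\<sigma> permutes {1..d}" by (rule W_permutes[OF \<sigma>])
    \<comment> \<open>The relations range over all tensors \<open>z\<close>, while the
      transformation law of \<open>\<phi>\<close> speaks of tuples. Both sides are linear in
      \<open>z\<close>, so decomposable tensors suffice.\<close>
    have "f (perm_act K M d \<sigma> z) = inv\<^bsub>K\<^esub> (\<chi> d \<sigma>) \<odot>\<^bsub>P\<^esub> f z"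
    proof (rule tensor_lin_eqI[OF M P _ _ _ z])
      show "(\<lambda>z. f (perm_act K M d \<sigma> z)) \<in> lin_maps K ?T P" by (rule lin_maps_comp[OF pa(1) f(1)])
      show "(\<lambda>z. inv\<^bsub>K\<^esub> (\<chi> d \<sigma>) \<odot>\<^bsub>P\<^esub> f z) \<in> lin_maps K ?T P"
        using \<sigma> by (intro lin_maps_smult[OF T.module_axioms P f(1)]) simp
      fix x assume x: "x \<in> {1..d} \<rightarrow> carrier M"
      have "(\<lambda>t. x (inv' \<sigma> t)) \<in> {1..d} \<rightarrow> carrier M"
        using x permutes_in_image[OF permutes_inv[OF p]] by (auto simp: Pi_def)
      then show "f (perm_act K M d \<sigma> (tensor K M d x)) = inv\<^bsub>K\<^esub> (\<chi> d \<sigma>) \<odot>\<^bsub>P\<^esub> f (tensor K M d x)"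
        by (simp add: pa(2)[OF x] f(2) x chi_multilinearD(2)[OF \<phi> \<sigma> x])
    qed
    moreover have "f (inv\<^bsub>K\<^esub> (\<chi> d \<sigma>) \<odot>\<^bsub>?T\<^esub> z) = inv\<^bsub>K\<^esub> (\<chi> d \<sigma>) \<odot>\<^bsub>P\<^esub> f z"
      using \<sigma> z by (intro lin_mapsD(3)[OF f(1)]) auto
    moreover have "f r = f (inv\<^bsub>K\<^esub> (\<chi> d \<sigma>) \<odot>\<^bsub>?T\<^esub> z) \<ominus>\<^bsub>P\<^esub> f (perm_act K M d \<sigma> z)"
      unfolding r using \<sigma> z
      by (intro lin_minus[OF T.module_axioms P f(1)] T.smult_closed lin_mapsD(1)[OF pa(1)]) simp_all
    ultimately show ?thesis
      using lin_mapsD(1)[OF f(1) z] \<sigma> by (simp add: a_minus_def P.r_neg)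
  qed
  then have "f r = \<zero>\<^bsub>P\<^esub>" if "r \<in> ?C" for r
    using gen_submodule_kernel[OF T.module_axioms P f(1) chi_rels_closed] that
    by (simp add: chi_null_def)
  from quot_lift[OF chi_quot P f(1) this] obtain h where h: "h \<in> lin_maps K (chi_power K W \<chi> M d) P"
    "\<And>z. z \<in> carrier ?T \<Longrightarrow> h (?C +>\<^bsub>?T\<^esub> z) = f z"
    by (auto simp: chi_power_def)
  have "h (chi_vec K W \<chi> M d x) = \<phi> x" if x: "x \<in> {1..d} \<rightarrow> carrier M" for x
    unfolding chi_vec_def h(2)[OF multilinearD(1)[OF tensor_multilinear[OF M] x]] by (rule f(2)[OF x])
  with h(1) show ?thesis by blast
qed

lemma chi_lin_eqI:
  assumes P: "module K P" and f: "f \<in> lin_maps K (chi_power K W \<chi> M d) P"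
    and g: "g \<in> lin_maps K (chi_power K W \<chi> M d) P"
    and eq: "\<And>x. x \<in> {1..d} \<rightarrow> carrier M \<Longrightarrow> f (chi_vec K W \<chi> M d x) = g (chi_vec K W \<chi> M d x)"
    and u: "u \<in> carrier (chi_power K W \<chi> M d)"
  shows "f u = g u"
proof -
  let ?T = "tensor_power K M d" and ?C = "chi_null K W \<chi> M d"
  note pr = quot_proj_lin[OF chi_quot, of d, folded chi_power_def]
  obtain z where z: "z \<in> carrier ?T" "u = ?C +>\<^bsub>?T\<^esub> z"
    using u by (auto simp: chi_power_def quot_carrier[OF chi_quot])
  show ?thesis
    unfolding z(2)
    using eq by (intro tensor_lin_eqI[OF M P lin_maps_comp[OF pr f] lin_maps_comp[OF pr g] _ z(1)])
      (simp add: chi_vec_def)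
qed

end

end

section \<open>Invariant characters have order at most two\<close>

lemma transpose_conj:
  assumes "bij f"
  shows "f \<circ> transpose x y \<circ> inv' f = transpose (f x) (f y)"
proof
  fix t
  have "inv' f t = x \<longleftrightarrow> t = f x" "inv' f t = y \<longleftrightarrow> t = f y" "f (inv' f t) = t"
    using assms by (auto simp: bij_def inv_f_eq surj_f_inv_f)
  then show "(f \<circ> transpose x y \<circ> inv' f) t = transpose (f x) (f y) t"
    by (auto simp: transpose_def)
qed

text \<open>With \<open>?c\<close> for the three-cycle, the claim amounts to
  \<open>\<sigma> (\<tau> t) = ?c (\<tau> (\<sigma> t))\<close> for all \<open>t\<close>. Since
  \<open>m\<close> is the only point moved by both, \<open>\<tau>\<close> fixes
  \<open>\<sigma> m\<close> and \<open>\<sigma>\<close> fixes \<open>\<tau> m\<close>; elsewhere the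
  two permutations interfere only at the points that one of them sends to \<open>m\<close>.\<close>

lemma commutator_three_cycle:
  assumes \<sigma>: "bij \<sigma>" and \<tau>: "bij \<tau>" and m: "\<sigma> m \<noteq> m" "\<tau> m \<noteq> m"
    and meet: "\<And>t. t \<noteq> m \<Longrightarrow> \<sigma> t = t \<or> \<tau> t = t"
  shows "\<sigma> \<circ> \<tau> \<circ> inv' \<sigma> \<circ> inv' \<tau> = transpose m (\<sigma> m) \<circ> transpose (\<sigma> m) (\<tau> m)"
proof -
  let ?c = "transpose m (\<sigma> m) \<circ> transpose (\<sigma> m) (\<tau> m)"
  have s: "\<sigma> x = \<sigma> y \<longleftrightarrow> x = y" "\<tau> x = \<tau> y \<longleftrightarrow> x = y" for x y
    using \<sigma> \<tau> by (auto simp: bij_def inj_eq)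
  have \<sigma>m: "\<tau> (\<sigma> m) = \<sigma> m" and \<tau>m: "\<sigma> (\<tau> m) = \<tau> m"
    using meet[of "\<sigma> m"] meet[of "\<tau> m"] m s by auto
  have ne: "\<sigma> m \<noteq> \<tau> m" using \<sigma>m m s by metis
  have c: "?c t = t" if "t \<noteq> m" "t \<noteq> \<sigma> m" "t \<noteq> \<tau> m" for t
    using that by (auto simp: transpose_def)
  have c1: "?c m = \<sigma> m" "?c (\<sigma> m) = \<tau> m" "?c (\<tau> m) = m"
    using m ne by (auto simp: transpose_def)
  have eq: "\<sigma> (\<tau> t) = ?c (\<tau> (\<sigma> t))" for t
  proof -
    consider "t = m" | "t \<noteq> m" "\<sigma> t = m" | "t \<noteq> m" "\<tau> t = m"
      | "t \<noteq> m" "\<sigma> t \<noteq> m" "\<tau> t \<noteq> m" "\<sigma> t \<noteq> t"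
      | "t \<noteq> m" "\<sigma> t \<noteq> m" "\<tau> t \<noteq> m" "\<sigma> t = t" by blast
    then show ?thesis
    proof cases
      case 1
      then show ?thesis using \<sigma>m \<tau>m c1 by simp
    next
      case 2
      then have "\<tau> t = t" using meet by metis
      then show ?thesis using 2 c1 by simp
    next
      case 3
      then have "\<sigma> t = t" using meet by metis
      then show ?thesis using 3 c1 by simp
    next
      case 4
      then have t: "\<tau> t = t" "\<tau> (\<sigma> t) = \<sigma> t" using meet[of t] meet[of "\<sigma> t"] s by auto
      have "\<sigma> t \<noteq> \<sigma> m" using 4 s by auto
      moreover have "\<sigma> t \<noteq> \<tau> m" using 4 \<tau>m s by metis
      ultimately show ?thesis using t 4 c by simp
    next
      case 5
      then have "\<sigma> (\<tau> t) = \<tau> t"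
        using meet[of "\<tau> t"] s by metis
      moreover have "\<tau> t \<noteq> \<tau> m" using 5 s by auto
      moreover have "\<tau> t \<noteq> \<sigma> m" using 5 \<sigma>m s by metis
      ultimately show ?thesis using 5 c by simp
    qed
  qed
  have "\<sigma> \<circ> \<tau> = ?c \<circ> \<tau> \<circ> \<sigma>" using eq by (simp add: fun_eq_iff)
  then have "\<sigma> \<circ> \<tau> \<circ> inv' \<sigma> \<circ> inv' \<tau> = ?c \<circ> (\<tau> \<circ> (\<sigma> \<circ> inv' \<sigma>) \<circ> inv' \<tau>)"
    by (simp add: comp_assoc)
  then show ?thesis
    using \<sigma> \<tau> by (simp add: bij_is_surj surj_iff[THEN iffD1])
qed

section \<open>Three-cycles in a group of permutations\<close>

locale perm_set =
  fixes H :: "('a \<Rightarrow> 'a) set"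
  assumes id_in: "id \<in> H"
    and comp_in: "f \<in> H \<Longrightarrow> g \<in> H \<Longrightarrow> f \<circ> g \<in> H"
    and inv_in: "f \<in> H \<Longrightarrow> inv' f \<in> H"
    and bij_in: "f \<in> H \<Longrightarrow> bij f"
begin

text \<open>The product of transpositions sends \<open>x\<close> to \<open>y\<close>,
  \<open>y\<close> to \<open>z\<close> and \<open>z\<close> to \<open>x\<close>, functions being
  composed from the right.\<close>

definition cyc :: "'a \<Rightarrow> 'a \<Rightarrow> 'a \<Rightarrow> bool" where
  "cyc x y z \<longleftrightarrow> distinct [x, y, z] \<and> transpose x y \<circ> transpose y z \<in> H"

text \<open>This turns out to be an equivalence relation. The third point is left open because, by
  \<open>linked_cyc\<close>, any further point of the class can take its place.\<close>

definition linked :: "'a \<Rightarrow> 'a \<Rightarrow> bool" where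
  "linked x y \<longleftrightarrow> x = y \<or> (\<exists>z. cyc x y z)"

lemma cyc_rot: "cyc x y z \<Longrightarrow> cyc y z x"
proof -
  assume c: "cyc x y z"
  then have "transpose x y \<circ> transpose y z = transpose y z \<circ> transpose z x"
    by (auto simp: cyc_def transpose_def fun_eq_iff)
  with c show ?thesis by (auto simp: cyc_def)
qed

lemma cyc_rev: "cyc x y z \<Longrightarrow> cyc z y x"
proof -
  assume c: "cyc x y z"
  have "inv' (transpose x y \<circ> transpose y z) = transpose z y \<circ> transpose y x"
    by (subst o_inv_distrib) (simp_all add: transpose_commute)
  with c inv_in show ?thesis by (fastforce simp: cyc_def)
qed

text \<open>Only the conjugate is required to lie in \<open>H\<close>, not \<open>g\<close> itself:
  one of its uses conjugates by an element of \<open>W\<close>, which merely normalises the kernel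
  of \<chi>.\<close>

lemma cyc_conj:
  assumes "cyc x y z" "bij g" "g \<circ> (transpose x y \<circ> transpose y z) \<circ> inv' g \<in> H"
  shows "cyc (g x) (g y) (g z)"
proof -
  have "g \<circ> (transpose x y \<circ> transpose y z) \<circ> inv' g =
      (g \<circ> transpose x y \<circ> inv' g) \<circ> (g \<circ> transpose y z \<circ> inv' g)"
    using assms(2) by (auto simp: fun_eq_iff bij_def)
  then have "transpose (g x) (g y) \<circ> transpose (g y) (g z) \<in> H"
    using assms(3) transpose_conj[OF assms(2)] by simp
  moreover have "distinct [g x, g y, g z]"
    using assms(1,2) by (auto simp: cyc_def bij_def inj_eq)
  ultimately show ?thesis by (simp add: cyc_def)
qed

text \<open>After rotating the first cycle and reversing the second, both are products of
  transpositions that have the one of \<open>x\<close> and \<open>y\<close> in common; in the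
  composition the two copies meet and cancel.\<close>

lemma cyc_share: "cyc x y z \<Longrightarrow> cyc x y w \<Longrightarrow> z \<noteq> w \<Longrightarrow> cyc z x w"
proof -
  assume c: "cyc x y z" "cyc x y w" "z \<noteq> w"
  have "cyc z x y" "cyc y x w"
    using cyc_rot[OF cyc_rot[OF c(1)]] cyc_rev[OF cyc_rot[OF cyc_rot[OF c(2)]]] by auto
  then have "(transpose z x \<circ> transpose x y) \<circ> (transpose y x \<circ> transpose x w) \<in> H"
    unfolding cyc_def by (blast intro: comp_in)
  moreover have "(transpose z x \<circ> transpose x y) \<circ> (transpose y x \<circ> transpose x w) =
      transpose z x \<circ> transpose x w"
    by (simp add: fun_eq_iff transpose_commute[of y x])
  ultimately have "transpose z x \<circ> transpose x w \<in> H" by (simp only:)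
  then show ?thesis using c by (simp add: cyc_def eq_commute)
qed

text \<open>Three-cycles meeting in a point generate the alternating group on their union.\<close>

lemma linked_cyc:
  assumes "linked x y" "linked y w" "distinct [x, y, w]"
  shows "cyc x y w"
proof -
  from assms obtain z v where z: "cyc x y z" and v: "cyc y w v"
    by (auto simp: linked_def)
  consider "z = w" | "v = x" | "z \<noteq> w" "v \<noteq> x" "v = z" | "z \<noteq> w" "v \<noteq> x" "v \<noteq> z" by blast
  then show ?thesis
  proof cases
    case 1
    with z show ?thesis by simp
  next
    case 2
    with v show ?thesis using cyc_rot by blast
  next
    case 3
    have "cyc y z x" "cyc y z w"
      using cyc_rot[OF z] cyc_rev[OF cyc_rot[OF v]] cyc_rot v 3 cyc_rev by blast+
    then show ?thesis using cyc_share[of y z x w] assms(3) by auto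
  next
    case 4
    \<comment> \<open>Conjugation by the second cycle carries \<open>y\<close> to \<open>w\<close>
      and fixes \<open>x\<close> and \<open>z\<close>, so it turns the cycle on \<open>x\<close>,
      \<open>y\<close>, \<open>z\<close> into one on \<open>x\<close>, \<open>w\<close>,
      \<open>z\<close>. The two then share \<open>x\<close> and \<open>z\<close>, and
      \<open>cyc_share\<close> applies.\<close>
    let ?g = "transpose y w \<circ> transpose w v"
    have g: "?g \<in> H" "bij ?g" using v bij_in by (auto simp: cyc_def)
    have "?g \<circ> (transpose x y \<circ> transpose y z) \<circ> inv' ?g \<in> H"
      using z comp_in[OF comp_in[OF g(1)] inv_in[OF g(1)]] by (simp add: cyc_def)
    from cyc_conj[OF z g(2) this] have "cyc (?g x) (?g y) (?g z)" .
    moreover have "?g x = x" "?g y = w" "?g z = z"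
      using 4 z v assms(3) by (auto simp: cyc_def transpose_def)
    ultimately have "cyc x w z" by simp
    then have "cyc z x w" "cyc z x y"
      using cyc_rot z by blast+
    then have "cyc x z y" "cyc x z w" using cyc_rot cyc_rev by blast+
    then show ?thesis using cyc_share[of x z y w] assms(3) cyc_rot cyc_rev
      by (metis distinct_length_2_or_more)
  qed
qed

lemma linked_sym: "linked x y \<Longrightarrow> linked y x"
  using cyc_rot cyc_rev unfolding linked_def by blast

lemma linked_trans:
  assumes "linked x y" "linked y w"
  shows "linked x w"
proof (cases "distinct [x, y, w]")
  case True
  then show ?thesis
    using linked_cyc[OF assms] cyc_rot cyc_rev unfolding linked_def by blast
next
  case False
  with assms show ?thesis by (auto simp: linked_def)
qed

text \<open>Splitting off the transposition of \<open>x\<close> and \<open>y = \<pi> x\<close>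
  leaves a \<open>\<rho>\<close> with smaller support and \<open>\<rho> x = x\<close>. Moving the
  second transposition past \<open>\<rho>\<close> gives \<open>\<pi> \<circ> \<pi> = (transpose x y
  \<circ> transpose x (\<rho> y)) \<circ> (\<rho> \<circ> \<rho>)\<close>, whose first factor is the
  identity or a three-cycle on linked points.\<close>

lemma square_in:
  assumes "bij \<pi>" "finite {x. \<pi> x \<noteq> x}" "\<And>x. linked x (\<pi> x)"
  shows "\<pi> \<circ> \<pi> \<in> H"
  using assms
proof (induction "card {x. \<pi> x \<noteq> x}" arbitrary: \<pi> rule: less_induct)
  case less
  show ?case
  proof (cases "\<exists>x. \<pi> x \<noteq> x")
    case False
    then have "\<pi> = id" by auto
    then show ?thesis using id_in by simp
  next
    case True
    then obtain x where x: "\<pi> x \<noteq> x" by blast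
    define y where "y = \<pi> x"
    define \<rho> where "\<rho> = transpose x y \<circ> \<pi>"
    have xy: "x \<noteq> y" using x y_def by simp
    have \<pi>inj: "\<pi> s = \<pi> t \<longleftrightarrow> s = t" for s t
      using less.prems(1) by (auto simp: bij_def inj_eq)
    have \<rho>x: "\<rho> x = x" by (simp add: \<rho>_def y_def)
    have sub: "{z. \<rho> z \<noteq> z} \<subset> {z. \<pi> z \<noteq> z}"
    proof
      show "{z. \<rho> z \<noteq> z} \<subseteq> {z. \<pi> z \<noteq> z}"
        using x \<pi>inj by (auto simp: \<rho>_def y_def transpose_def)
      show "{z. \<rho> z \<noteq> z} \<noteq> {z. \<pi> z \<noteq> z}" using \<rho>x x by auto
    qed
    have \<rho>: "bij \<rho>" unfolding \<rho>_def using less.prems(1) by (intro bij_comp) auto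
    have "linked z (\<rho> z)" for z
    proof (cases "\<pi> z = x")
      case True
      then have "\<rho> z = y" by (simp add: \<rho>_def)
      then show ?thesis
        using linked_trans[OF less.prems(3)[of z]] less.prems(3)[of x] True by (simp add: y_def)
    next
      case False
      then have "\<rho> z = x \<and> z = x \<or> \<rho> z = \<pi> z"
        using \<pi>inj by (auto simp: \<rho>_def y_def transpose_def)
      then show ?thesis using less.prems(3)[of z] by (auto simp: linked_def)
    qed
    note lk = this
    have "card {z. \<rho> z \<noteq> z} < card {z. \<pi> z \<noteq> z}"
      by (rule psubset_card_mono[OF less.prems(2) sub])
    then have \<rho>\<rho>: "\<rho> \<circ> \<rho> \<in> H"
      using less.hyps \<rho> lk finite_subset[OF _ less.prems(2)] sub by blast
    have \<pi>: "\<pi> = transpose x y \<circ> \<rho>" by (auto simp: \<rho>_def)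
    have "\<rho> \<circ> transpose x y \<circ> inv' \<rho> = transpose x (\<rho> y)"
      using transpose_conj[OF \<rho>] \<rho>x by simp
    then have "\<rho> \<circ> transpose x y \<circ> inv' \<rho> \<circ> \<rho> = transpose x (\<rho> y) \<circ> \<rho>" by simp
    then have "\<rho> \<circ> transpose x y = transpose x (\<rho> y) \<circ> \<rho>"
      using \<rho> by (simp add: comp_assoc bij_is_inj)
    then have eq: "\<pi> \<circ> \<pi> = (transpose x y \<circ> transpose x (\<rho> y)) \<circ> (\<rho> \<circ> \<rho>)"
      unfolding \<pi> by (metis comp_assoc)
    show ?thesis
    proof (cases "\<rho> y = y")
      case True
      then show ?thesis using eq \<rho>\<rho> by simp
    next
      case False
      have "\<rho> y \<noteq> x" using \<rho> \<rho>x xy by (metis bij_def inj_eq)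
      moreover have "linked y x" using linked_sym less.prems(3)[of x] by (simp add: y_def)
      moreover have "linked x (\<rho> y)"
        using linked_trans[OF _ lk[of y]] less.prems(3)[of x] by (simp add: y_def)
      ultimately have "cyc y x (\<rho> y)" using False xy by (intro linked_cyc) auto
      then have "transpose x y \<circ> transpose x (\<rho> y) \<in> H"
        by (simp add: cyc_def transpose_commute)
      then show ?thesis unfolding eq using \<rho>\<rho> by (rule comp_in)
    qed
  qed
qed

end

text \<open>The condition \<open>\<sigma> 0 = 0\<close> covers \<open>p = 0\<close>, where the first
  branch still claims that \<open>0\<close> is fixed.\<close>

lemma omega_pow_apply:
  assumes "\<sigma> 0 = 0"
  shows "(omega ^^ p) \<sigma> t = (if t \<le> p then t else \<sigma> (t - p) + p)"
proof (induction p arbitrary: t)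
  case 0
  then show ?case using assms by simp
next
  case (Suc p)
  have "(omega ^^ Suc p) \<sigma> t = (if t \<le> 1 then t else (omega ^^ p) \<sigma> (t - 1) + 1)"
    unfolding funpow.simps o_apply by (rule omega_def)
  then show ?case using Suc[of "t - 1"] assms by (auto simp: One_nat_def)
qed

section \<open>The groups \<open>W d\<close>, their shifts and the kernel of the characters\<close>

context invariant_chars
begin

lemma W_zero: "\<sigma> \<in> W d \<Longrightarrow> \<sigma> 0 = 0"
  using permutes_not_in[OF W_permutes] by auto

lemma W_bij: "\<sigma> \<in> W d \<Longrightarrow> bij \<sigma>"
  using permutes_bij[OF W_permutes] .

lemma W_id: "id \<in> W d"
  using subgroup.one_closed[OF W_subgroup] by (simp add: sym_group_def)

lemma W_comp: "\<sigma> \<in> W d \<Longrightarrow> \<tau> \<in> W d \<Longrightarrow> \<sigma> \<circ> \<tau> \<in> W d"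
  using subgroup.m_closed[OF W_subgroup] by (simp add: sym_group_def)

lemma W_inv: "\<sigma> \<in> W d \<Longrightarrow> inv' \<sigma> \<in> W d"
  using subgroup.m_inv_closed[OF W_subgroup] sym_group_inv_equality[of \<sigma> d]
    subgroup.subset[OF W_subgroup] by fastforce

lemma chi_comp: "\<sigma> \<in> W d \<Longrightarrow> \<tau> \<in> W d \<Longrightarrow> \<chi> d (\<sigma> \<circ> \<tau>) = \<chi> d \<sigma> \<otimes>\<^bsub>K\<^esub> \<chi> d \<tau>"
proof -
  assume "\<sigma> \<in> W d" "\<tau> \<in> W d"
  moreover have "\<chi> d \<in> hom ((sym_group d)\<lparr>carrier := W d\<rparr>) (units_of K)"
    using inv by (simp add: omega_invariant_def)
  ultimately show ?thesis
    by (auto simp: hom_def units_of_def sym_group_def)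
qed

lemma chi_id [simp]: "\<chi> d id = \<one>\<^bsub>K\<^esub>"
proof -
  have "\<chi> d id \<otimes>\<^bsub>K\<^esub> \<chi> d id = \<chi> d id \<otimes>\<^bsub>K\<^esub> \<one>\<^bsub>K\<^esub>"
    using chi_comp[OF W_id W_id, of d] W_id by simp
  then show ?thesis
    using K.Units_l_cancel[OF chi_Units[OF W_id], of "\<chi> d id" "\<one>\<^bsub>K\<^esub>" d]
      chi_closed[OF W_id] by blast
qed

lemma chi_inv: "\<sigma> \<in> W d \<Longrightarrow> \<chi> d (inv' \<sigma>) = inv\<^bsub>K\<^esub> (\<chi> d \<sigma>)"
proof -
  assume \<sigma>: "\<sigma> \<in> W d"
  have "\<chi> d (inv' \<sigma>) \<otimes>\<^bsub>K\<^esub> \<chi> d \<sigma> = \<one>\<^bsub>K\<^esub>"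
    using chi_comp[OF W_inv[OF \<sigma>] \<sigma>] W_bij[OF \<sigma>] by (simp add: bij_is_inj)
  then show ?thesis
    using K.inv_unique' \<sigma> W_inv[OF \<sigma>] K.m_comm by (metis chi_closed)
qed

lemma W_mono: "\<sigma> \<in> W d \<Longrightarrow> \<sigma> \<in> W (d + e) \<and> \<chi> (d + e) \<sigma> = \<chi> d \<sigma>"
  using inv by (induction e) (auto simp: omega_invariant_def)

lemma omega_pow_W:
  "\<sigma> \<in> W d \<Longrightarrow> (omega ^^ e) \<sigma> \<in> W (d + e) \<and> \<chi> (d + e) ((omega ^^ e) \<sigma>) = \<chi> d \<sigma>"
  using inv by (induction e) (auto simp: omega_invariant_def)

lemma chi_agree: "\<sigma> \<in> W d \<Longrightarrow> \<sigma> \<in> W e \<Longrightarrow> \<chi> d \<sigma> = \<chi> e \<sigma>"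
  using W_mono[of \<sigma> d e] W_mono[of \<sigma> e d] by (simp add: add.commute)

text \<open>The union over all degrees is taken because shifting leaves every fixed degree. The
  choice of \<open>d\<close> is immaterial: by \<open>chi_agree\<close> the value of a permutation
  is the same in all degrees that contain it.\<close>

definition chi_kernel :: "(nat \<Rightarrow> nat) set" where
  "chi_kernel = {\<sigma>. \<exists>d. \<sigma> \<in> W d \<and> \<chi> d \<sigma> = \<one>\<^bsub>K\<^esub>}"

text \<open>No single \<open>sym_group d\<close> need contain the kernel, which is why it is treated
  as a set of functions closed under composition and inversion. Two elements are compared in the
  degree \<open>d + e\<close>, which contains both.\<close>

sublocale ker: perm_set chi_kernel
proof
  show "id \<in> chi_kernel" using W_id by (auto simp: chi_kernel_def)
next
  fix f g assume "f \<in> chi_kernel" "g \<in> chi_kernel"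
  then obtain d e where "f \<in> W d" "\<chi> d f = \<one>\<^bsub>K\<^esub>" "g \<in> W e" "\<chi> e g = \<one>\<^bsub>K\<^esub>"
    by (auto simp: chi_kernel_def)
  then have "f \<in> W (d + e)" "\<chi> (d + e) f = \<one>\<^bsub>K\<^esub>" "g \<in> W (d + e)" "\<chi> (d + e) g = \<one>\<^bsub>K\<^esub>"
    using W_mono[of f d e] W_mono[of g e d] by (auto simp: add.commute)
  then show "f \<circ> g \<in> chi_kernel"
    using W_comp chi_comp unfolding chi_kernel_def by (auto intro!: exI[of _ "d + e"])
next
  fix f assume "f \<in> chi_kernel"
  then show "inv' f \<in> chi_kernel"
    using W_inv chi_inv unfolding chi_kernel_def by fastforce
next
  fix f assume "f \<in> chi_kernel"
  then show "bij f" using W_bij by (auto simp: chi_kernel_def)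
qed

lemma chi_kernel_conj:
  assumes "f \<in> chi_kernel" "g \<in> W e"
  shows "g \<circ> f \<circ> inv' g \<in> chi_kernel"
proof -
  obtain d where "f \<in> W d" "\<chi> d f = \<one>\<^bsub>K\<^esub>" using assms by (auto simp: chi_kernel_def)
  then have f: "f \<in> W (d + e)" "\<chi> (d + e) f = \<one>\<^bsub>K\<^esub>" and g: "g \<in> W (d + e)"
    using W_mono[of f d e] W_mono[of g e d] assms by (auto simp: add.commute)
  have "\<chi> (d + e) (g \<circ> f \<circ> inv' g) = \<one>\<^bsub>K\<^esub>"
    using f g chi_Units[OF g] by (simp add: chi_comp chi_inv W_comp W_inv)
  then show ?thesis using f g W_comp W_inv unfolding chi_kernel_def by blast
qed

lemma chi_kernel_omega:
  assumes "f \<in> chi_kernel"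
  shows "(omega ^^ s) f \<in> chi_kernel"
  using assms omega_pow_W unfolding chi_kernel_def by fastforce

lemma commutator_chi_kernel:
  assumes "\<sigma> \<in> W d" "\<tau> \<in> W e"
  shows "\<sigma> \<circ> \<tau> \<circ> inv' \<sigma> \<circ> inv' \<tau> \<in> chi_kernel"
proof -
  have \<sigma>: "\<sigma> \<in> W (d + e)" and \<tau>: "\<tau> \<in> W (d + e)"
    using W_mono[of \<sigma> d e] W_mono[of \<tau> e d] assms by (auto simp: add.commute)
  have "\<chi> (d + e) (\<sigma> \<circ> \<tau> \<circ> inv' \<sigma> \<circ> inv' \<tau>) =
      (\<chi> (d + e) \<sigma> \<otimes>\<^bsub>K\<^esub> inv\<^bsub>K\<^esub> \<chi> (d + e) \<sigma>) \<otimes>\<^bsub>K\<^esub> (\<chi> (d + e) \<tau> \<otimes>\<^bsub>K\<^esub> inv\<^bsub>K\<^esub> \<chi> (d + e) \<tau>)"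
    using \<sigma> \<tau> by (simp add: chi_comp chi_inv W_comp W_inv K.m_ac)
  also have "\<dots> = \<one>\<^bsub>K\<^esub>" using chi_Units \<sigma> \<tau> by simp
  finally show ?thesis using \<sigma> \<tau> W_comp W_inv unfolding chi_kernel_def by blast
qed

text \<open>A shift of \<open>\<sigma>\<close> whose support meets that of \<open>\<sigma>\<close> in one point yields a commutator which is
  a three-cycle; its shifts link all points far to the right in arithmetic progressions.\<close>

lemma linked_progression:
  assumes "\<sigma> \<in> W d" "\<sigma> \<noteq> id"
  obtains a i where "0 < i" "\<And>x. a \<le> x \<Longrightarrow> ker.linked x (x + i)"
proof -
  let ?S = "{t. \<sigma> t \<noteq> t}"
  have S: "?S \<subseteq> {1..d}" using permutes_not_in[OF W_permutes[OF assms(1)]] by blast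
  then have fin: "finite ?S" by (rule finite_subset) simp
  have ne: "?S \<noteq> {}" using assms(2) by auto
  define m where "m = Max ?S"
  define l where "l = Min ?S"
  have m: "\<sigma> m \<noteq> m" and l: "\<sigma> l \<noteq> l"
    using Max_in[OF fin ne] Min_in[OF fin ne] by (auto simp: m_def l_def)
  have lem: "l \<le> t" "t \<le> m" if "\<sigma> t \<noteq> t" for t
    using that fin by (auto simp: m_def l_def)
  have l1: "1 \<le> l" using S l by auto
  have \<sigma>0: "\<sigma> 0 = 0" by (rule W_zero[OF assms(1)])
  have inj: "\<sigma> s = \<sigma> t \<longleftrightarrow> s = t" for s t using W_bij[OF assms(1)] by (auto simp: bij_def inj_eq)
  \<comment> \<open>The shift by \<open>m - l\<close> carries the least moved point \<open>l\<close>
    to the greatest moved point \<open>m\<close>, so the support of \<open>\<tau>\<close> begins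
    where that of \<open>\<sigma>\<close> ends.\<close>
  define \<tau> where "\<tau> = (omega ^^ (m - l)) \<sigma>"
  have \<tau>W: "\<tau> \<in> W (d + (m - l))" using omega_pow_W[OF assms(1)] by (simp add: \<tau>_def)
  have \<tau>: "\<tau> t = (if t \<le> m - l then t else \<sigma> (t - (m - l)) + (m - l))" for t
    unfolding \<tau>_def by (rule omega_pow_apply[where \<sigma> = \<sigma>, OF \<sigma>0])
  have lm: "l \<le> m" using lem[OF m] by simp
  have a: "\<sigma> m < m" using lem(2)[of "\<sigma> m"] m inj by (simp add: le_less)
  have "l < \<sigma> l" using lem(1)[of "\<sigma> l"] l inj by (simp add: le_less)
  then have b: "m < \<tau> m" using lm l1 by (auto simp: \<tau>)
  have a1: "1 \<le> \<sigma> m" using lem(1)[of "\<sigma> m"] m inj l1 by auto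
  have meet: "\<sigma> t = t \<or> \<tau> t = t" if "t \<noteq> m" for t
    using lem[of t] lem[of "t - (m - l)"] that lm by (auto simp: \<tau>) linarith+
  define c where "c = \<sigma> \<circ> \<tau> \<circ> inv' \<sigma> \<circ> inv' \<tau>"
  have c: "c = transpose m (\<sigma> m) \<circ> transpose (\<sigma> m) (\<tau> m)"
    unfolding c_def using m b meet
    by (intro commutator_three_cycle W_bij[OF assms(1)] W_bij[OF \<tau>W]) auto
  have cK: "c \<in> chi_kernel"
    unfolding c_def by (rule commutator_chi_kernel[OF assms(1) \<tau>W])
  have "ker.linked x (x + (m - \<sigma> m))" if x: "\<sigma> m \<le> x" for x
  proof -
    \<comment> \<open>Shifting the cycle \<open>c\<close> by \<open>s\<close> carries
      \<open>\<sigma> m\<close> to \<open>x\<close> and \<open>m\<close> to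
      \<open>x + (m - \<sigma> m)\<close>; hence the threshold \<open>\<sigma> m\<close> and the
      step \<open>m - \<sigma> m\<close>.\<close>
    define s where "s = x - \<sigma> m"
    have c0: "c 0 = 0" using m a1 b a by (auto simp: c transpose_def)
    have eq: "(omega ^^ s) c = transpose (m + s) (\<sigma> m + s) \<circ> transpose (\<sigma> m + s) (\<tau> m + s)"
    proof
      fix t
      show "(omega ^^ s) c t =
          (transpose (m + s) (\<sigma> m + s) \<circ> transpose (\<sigma> m + s) (\<tau> m + s)) t"
        unfolding omega_pow_apply[where \<sigma> = c, OF c0] unfolding c using a1 a b
        by (auto simp: transpose_def)
    qed
    have "ker.cyc (m + s) (\<sigma> m + s) (\<tau> m + s)"
      using chi_kernel_omega[OF cK, of s] a b unfolding ker.cyc_def eq by auto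
    then have "ker.linked (m + s) (\<sigma> m + s)" by (auto simp: ker.linked_def)
    then have "ker.linked (\<sigma> m + s) (m + s)" by (rule ker.linked_sym)
    moreover have "\<sigma> m + s = x" "m + s = x + (m - \<sigma> m)" using x a by (auto simp: s_def)
    ultimately show ?thesis by simp
  qed
  then show ?thesis using that[of "m - \<sigma> m" "\<sigma> m"] a by simp
qed

text \<open>A shift \<open>\<pi>\<close> of \<open>\<sigma>\<close> has the same character value and
  moves only points beyond \<open>a\<close>, where links are available. Once every \<open>x\<close>
  is linked to \<open>\<pi> x\<close>, \<open>square_in\<close> places
  \<open>\<pi> \<circ> \<pi>\<close> in the kernel. The identity is set apart because it has no
  moved point from which to produce three-cycles.\<close>

theorem chi_involutive:
  assumes "\<sigma> \<in> W d"
  shows "\<chi> d \<sigma> \<otimes>\<^bsub>K\<^esub> \<chi> d \<sigma> = \<one>\<^bsub>K\<^esub>"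
proof (cases "\<sigma> = id")
  case True
  then show ?thesis by simp
next
  case False
  obtain a i where i: "0 < i" and step: "\<And>x. a \<le> x \<Longrightarrow> ker.linked x (x + i)"
    using linked_progression[OF assms False] by blast
  have steps: "ker.linked x (x + k * i)" if "a \<le> x" for x k
  proof (induction k)
    case 0
    then show ?case by (simp add: ker.linked_def)
  next
    case (Suc k)
    from ker.linked_trans[OF this step[of "x + k * i"]] that show ?case by (simp add: ac_simps)
  qed
  define \<pi> where "\<pi> = (omega ^^ a) \<sigma>"
  have \<pi>W: "\<pi> \<in> W (d + a)" and \<chi>\<pi>: "\<chi> (d + a) \<pi> = \<chi> d \<sigma>"
    using omega_pow_W[OF assms] by (auto simp: \<pi>_def)
  have \<pi>: "\<pi> t = (if t \<le> a then t else \<sigma> (t - a) + a)" for t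
    unfolding \<pi>_def by (rule omega_pow_apply[where \<sigma> = \<sigma>, OF W_zero[OF assms]])
  have perm: "\<pi> permutes {1..d + a}" by (rule W_permutes[OF \<pi>W])
  have "ker.linked x (\<pi> x)" for x
  proof (cases "\<pi> x = x")
    case True
    then show ?thesis by (simp add: ker.linked_def)
  next
    case ne: False
    have x: "a < x" using ne \<pi>[of x] by (simp split: if_splits)
    have "x \<in> {1..d + a}" using permutes_not_in[OF perm] ne by blast
    moreover have "\<pi> x \<in> {1..d + a}"
      by (rule iffD2[OF permutes_in_image[OF perm]]) fact
    ultimately have bd: "x \<le> d + a" "\<pi> x \<le> d + a" by auto
    \<comment> \<open>The points \<open>u\<close> and \<open>v\<close> lie on the progression of
      \<open>x\<close> and, since \<open>i\<close> is positive, beyond \<open>d + a\<close>; so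
      \<open>\<pi>\<close> fixes them. Conjugating the cycle on \<open>x\<close>, \<open>u\<close>,
      \<open>v\<close> by \<open>\<pi>\<close> yields one on \<open>\<pi> x\<close>,
      \<open>u\<close>, \<open>v\<close>, which links \<open>\<pi> x\<close> to \<open>u\<close> and
      thereby to \<open>x\<close>.\<close>
    define u where "u = x + (d + a + 1) * i"
    define v where "v = u + i"
    have "d + a < (d + a + 1) * i" using i by (cases i) auto
    then have "d + a < u" unfolding u_def by (rule trans_less_add2)
    then have big: "d + a < u" "u < v" using i by (auto simp: v_def)
    have uv: "\<pi> u = u" "\<pi> v = v" using big by (intro permutes_not_in[OF perm], simp)+
    have xu: "ker.linked x u" unfolding u_def by (rule steps) (use x in simp)
    have c: "ker.cyc x u v"
      using xu step[of u] bd x big by (intro ker.linked_cyc) (auto simp: v_def)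
    then have "ker.cyc (\<pi> x) (\<pi> u) (\<pi> v)"
      by (rule ker.cyc_conj[OF _ W_bij[OF \<pi>W] chi_kernel_conj[OF _ \<pi>W]])
        (use c in \<open>simp add: ker.cyc_def\<close>)
    then have "ker.linked (\<pi> x) u" unfolding uv ker.linked_def by blast
    then show ?thesis by (rule ker.linked_trans[OF xu ker.linked_sym])
  qed
  moreover have "finite {x. \<pi> x \<noteq> x}"
    by (rule finite_subset[of _ "{1..d + a}"]) (use permutes_not_in[OF perm] in blast, simp)
  ultimately have "\<pi> \<circ> \<pi> \<in> chi_kernel"
    by (intro ker.square_in W_bij[OF \<pi>W])
  then obtain e where e: "\<pi> \<circ> \<pi> \<in> W e" "\<chi> e (\<pi> \<circ> \<pi>) = \<one>\<^bsub>K\<^esub>"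
    by (auto simp: chi_kernel_def)
  have "\<chi> (d + a) (\<pi> \<circ> \<pi>) = \<one>\<^bsub>K\<^esub>"
    using chi_agree[OF W_comp[OF \<pi>W \<pi>W] e(1)] e(2) by simp
  then show ?thesis using chi_comp[OF \<pi>W \<pi>W] \<chi>\<pi> by simp
qed

corollary inv_chi: "\<sigma> \<in> W d \<Longrightarrow> inv\<^bsub>K\<^esub> (\<chi> d \<sigma>) = \<chi> d \<sigma>"
  using chi_involutive K.inv_unique' by (metis chi_closed)

end

section \<open>Bilinear maps on chi-vectors\<close>

lemma bilinear_mapD:
  assumes "bilinear_map K M N P f"
  shows "y \<in> carrier N \<Longrightarrow> (\<lambda>x. f x y) \<in> lin_maps K M P"
    and "x \<in> carrier M \<Longrightarrow> f x \<in> lin_maps K N P"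
  using assms by (simp_all add: bilinear_map_def)

lemma linear_functional_prod_multilinear:
  assumes M: "module K M" and l: "\<And>t. t \<in> {1..d} \<Longrightarrow> l t \<in> lin_maps K M (ring_module K)"
  shows "multilinear K M d (ring_module K) (\<lambda>x. \<Otimes>\<^bsub>K\<^esub>t\<in>{1..d}. l t (x t))"
proof (rule multilinearI)
  interpret M: module K M by fact
  have lc: "l t u \<in> carrier K" if "t \<in> {1..d}" "u \<in> carrier M" for t u
    using lin_mapsD(1)[OF l[OF that(1)] that(2)] by simp
  fix x assume x: "x \<in> {1..d} \<rightarrow> carrier M"
  show "(\<Otimes>\<^bsub>K\<^esub>t\<in>{1..d}. l t (x t)) \<in> carrier (ring_module K)"
    using x lc by (auto simp: Pi_iff intro!: M.finprod_closed)
  show "(\<Otimes>\<^bsub>K\<^esub>t\<in>{1..d}. l t (restrict x {1..d} t)) = (\<Otimes>\<^bsub>K\<^esub>t\<in>{1..d}. l t (x t))"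
    using x lc by (intro M.finprod_cong') (auto simp: Pi_iff)
  fix i assume i: "i \<in> {1..d}"
  define c where "c = (\<Otimes>\<^bsub>K\<^esub>t\<in>{1..d} - {i}. l t (x t))"
  have c: "c \<in> carrier K"
    unfolding c_def using x lc by (intro M.finprod_closed) (auto simp: Pi_iff)
  have L: "(\<lambda>u. l i u \<otimes>\<^bsub>K\<^esub> c) \<in> lin_maps K M (ring_module K)"
    using lin_maps_comp[OF l[OF i] lin_maps_scale[OF ring_module_module[OF M.cring_axioms], of c]] c
    by simp
  have "(\<Otimes>\<^bsub>K\<^esub>t\<in>{1..d}. l t ((x(i := u)) t)) = l i u \<otimes>\<^bsub>K\<^esub> c" if u: "u \<in> carrier M" for u
  proof -
    have "(\<Otimes>\<^bsub>K\<^esub>t\<in>insert i ({1..d} - {i}). l t ((x(i := u)) t)) =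
        l i ((x(i := u)) i) \<otimes>\<^bsub>K\<^esub> (\<Otimes>\<^bsub>K\<^esub>t\<in>{1..d} - {i}. l t ((x(i := u)) t))"
      using i u x lc by (intro M.finprod_insert) (auto simp: Pi_iff)
    also have "(\<Otimes>\<^bsub>K\<^esub>t\<in>{1..d} - {i}. l t ((x(i := u)) t)) = c"
      unfolding c_def using x lc by (intro M.finprod_cong') (auto simp: Pi_iff)
    finally show ?thesis using i by (simp add: insert_absorb)
  qed
  then show "(\<lambda>u. \<Otimes>\<^bsub>K\<^esub>t\<in>{1..d}. l t ((x(i := u)) t)) \<in> lin_maps K M (ring_module K)"
    by (rule lin_maps_cong[OF L M.abelian_group_axioms M])
qed

lemma hom_module_eval:
  assumes "module K M" "z \<in> carrier M"
  shows "(\<lambda>f. f z) \<in> lin_maps K (hom_module K M N) N"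
  using assms(2) by (intro lin_mapsI) (auto simp: hom_module_simps intro: lin_mapsD(1))

lemma dual_module: "module K E \<Longrightarrow> module K (dual K E)"
  unfolding dual_eq_hom_module
  by (rule hom_module_module[OF _ ring_module_module]) (simp_all add: module_def)

lemma dual_lin: "f \<in> carrier (dual K E) \<Longrightarrow> f \<in> lin_maps K E (ring_module K)"
  by (simp add: dual_def)

lemma dual_apply_closed: "f \<in> carrier (dual K E) \<Longrightarrow> x \<in> carrier E \<Longrightarrow> f x \<in> carrier K"
  using lin_mapsD(1)[OF dual_lin] by fastforce

context invariant_chars
begin

lemma finite_W: "finite (W d)"
proof (rule finite_subset)
  show "W d \<subseteq> {\<sigma>. \<sigma> permutes {1..d}}" using W_permutes by blast
qed (simp add: finite_permutations)

section \<open>Bilinear extension from decomposable elements\<close>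

context
  fixes M :: "('k, 'e, 'm) module_scheme" and N :: "('k, 'f, 'n) module_scheme"
    and P :: "('k, 'p, 'o) module_scheme" and d e :: nat
    and \<phi> :: "(nat \<Rightarrow> 'e) \<Rightarrow> (nat \<Rightarrow> 'f) \<Rightarrow> 'p"
  assumes M: "module K M" and N: "module K N" and P: "module K P"
    and \<phi>1: "\<And>y. y \<in> {1..e} \<rightarrow> carrier N \<Longrightarrow> chi_multilinear M d P (\<lambda>x. \<phi> x y)"
    and \<phi>2: "\<And>x. x \<in> {1..d} \<rightarrow> carrier M \<Longrightarrow> chi_multilinear N e P (\<phi> x)"
begin

text \<open>The universal property is applied twice. For a fixed tuple \<open>x\<close> it extends
  \<open>\<phi> x\<close> to a linear map \<open>G x\<close> in the second variable; then
  \<open>G\<close>, as a map into the module \<open>H\<close> of linear maps, is itself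
  chi-multilinear and extends in the first variable.\<close>

lemma chi_bilinear_lift:
  "\<exists>f. bilinear_map K (chi_power K W \<chi> M d) (chi_power K W \<chi> N e) P f \<and>
    (\<forall>x\<in>{1..d} \<rightarrow> carrier M. \<forall>y\<in>{1..e} \<rightarrow> carrier N.
      f (chi_vec K W \<chi> M d x) (chi_vec K W \<chi> N e y) = \<phi> x y)"
proof -
  let ?M = "chi_power K W \<chi> M d" and ?N = "chi_power K W \<chi> N e"
  let ?v = "chi_vec K W \<chi> N e"
  note mN = chi_power_module[OF N, of e]
  define H where "H = hom_module K ?N P"
  interpret M: module K M by (fact M)
  interpret P: module K P by (fact P)
  interpret H: module K H unfolding H_def by (rule hom_module_module[OF mN P])
  note vc = chi_vec_closed[OF N, of _ e]
  have ev: "(\<lambda>g. g z) \<in> lin_maps K H P" if "z \<in> carrier ?N" for z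
    unfolding H_def by (rule hom_module_eval[OF mN that])
  have H_lin: "g \<in> lin_maps K ?N P" if "g \<in> carrier H" for g
    using that by (simp add: H_def hom_module_simps)
  have H_eqI: "g = g'" if g: "g \<in> carrier H" "g' \<in> carrier H"
    and eq: "\<And>y. y \<in> {1..e} \<rightarrow> carrier N \<Longrightarrow> g (?v y) = g' (?v y)" for g g'
  proof (rule extensionalityI)
    show "g \<in> extensional (carrier ?N)" "g' \<in> extensional (carrier ?N)"
      using g by (simp_all add: H_def hom_module_simps)
    show "g z = g' z" if "z \<in> carrier ?N" for z
      by (rule chi_lin_eqI[OF N P H_lin[OF g(1)] H_lin[OF g(2)] eq that])
  qed
  \<comment> \<open>An element of \<open>H\<close> is chosen for each tuple separately. Its
    uniqueness, \<open>H_eqI\<close>, makes these choices fit together: every law required of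
    \<open>G\<close> can be tested on chi-vectors, where it becomes a law of \<open>\<phi>\<close>
    in the first argument.\<close>
  define G where "G x = (SOME g. g \<in> carrier H \<and> (\<forall>y\<in>{1..e} \<rightarrow> carrier N. g (?v y) = \<phi> x y))" for x
  have G: "G x \<in> carrier H" "y \<in> {1..e} \<rightarrow> carrier N \<Longrightarrow> G x (?v y) = \<phi> x y"
    if x: "x \<in> {1..d} \<rightarrow> carrier M" for x y
  proof -
    obtain g where g: "g \<in> lin_maps K ?N P" "\<And>y. y \<in> {1..e} \<rightarrow> carrier N \<Longrightarrow> g (?v y) = \<phi> x y"
      using chi_lift[OF N P \<phi>2[OF x]] by blast
    have "restrict g (carrier ?N) \<in> carrier H"
      unfolding H_def by (rule restrict_lin_maps[OF mN g(1)])
    moreover have "restrict g (carrier ?N) (?v y) = \<phi> x y" if "y \<in> {1..e} \<rightarrow> carrier N" for y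
      using g(2)[OF that] vc[OF that] by simp
    ultimately have "\<exists>g. g \<in> carrier H \<and> (\<forall>y\<in>{1..e} \<rightarrow> carrier N. g (?v y) = \<phi> x y)"
      by blast
    from someI_ex[OF this, folded G_def]
    show "G x \<in> carrier H" "y \<in> {1..e} \<rightarrow> carrier N \<Longrightarrow> G x (?v y) = \<phi> x y" by auto
  qed
  have "chi_multilinear M d H G"
    unfolding chi_multilinear_def
  proof (intro conjI ballI multilinearI)
    fix x assume x: "x \<in> {1..d} \<rightarrow> carrier M"
    show "G x \<in> carrier H" by (rule G(1)[OF x])
    have rx: "restrict x {1..d} \<in> {1..d} \<rightarrow> carrier M" using x by auto
    show "G (restrict x {1..d}) = G x"
      by (intro H_eqI G(1) x rx)
        (simp add: G(2)[OF x] G(2)[OF rx] multilinearD(2)[OF chi_multilinearD(1)[OF \<phi>1] x])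
  next
    fix x i assume x: "x \<in> {1..d} \<rightarrow> carrier M" and i: "i \<in> {1..d}"
    have up: "x(i := u) \<in> {1..d} \<rightarrow> carrier M" if "u \<in> carrier M" for u
      using x that by (auto simp: Pi_iff)
    note L = multilinearD(3)[OF chi_multilinearD(1)[OF \<phi>1] x i]
    show "(\<lambda>u. G (x(i := u))) \<in> lin_maps K M H"
    proof (rule lin_mapsI)
      fix u v assume u: "u \<in> carrier M" and v: "v \<in> carrier M"
      show "G (x(i := u \<oplus>\<^bsub>M\<^esub> v)) = G (x(i := u)) \<oplus>\<^bsub>H\<^esub> G (x(i := v))"
      proof (rule H_eqI)
        fix y assume y: "y \<in> {1..e} \<rightarrow> carrier N"
        have "G (x(i := u \<oplus>\<^bsub>M\<^esub> v)) (?v y) = \<phi> (x(i := u)) y \<oplus>\<^bsub>P\<^esub> \<phi> (x(i := v)) y"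
          using u v lin_mapsD(2)[OF L[OF y] u v] by (simp add: G(2)[OF up y])
        also have "\<dots> = (G (x(i := u)) \<oplus>\<^bsub>H\<^esub> G (x(i := v))) (?v y)"
          using lin_mapsD(2)[OF ev[OF vc[OF y]] G(1)[OF up[OF u]] G(1)[OF up[OF v]]]
          by (simp only: G(2)[OF up[OF u] y] G(2)[OF up[OF v] y])
        finally show "G (x(i := u \<oplus>\<^bsub>M\<^esub> v)) (?v y) = (G (x(i := u)) \<oplus>\<^bsub>H\<^esub> G (x(i := v))) (?v y)" .
      qed (use u v in \<open>auto intro!: G(1) up\<close>)
    next
      fix k u assume k: "k \<in> carrier K" and u: "u \<in> carrier M"
      show "G (x(i := k \<odot>\<^bsub>M\<^esub> u)) = k \<odot>\<^bsub>H\<^esub> G (x(i := u))"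
      proof (rule H_eqI)
        fix y assume y: "y \<in> {1..e} \<rightarrow> carrier N"
        have "G (x(i := k \<odot>\<^bsub>M\<^esub> u)) (?v y) = k \<odot>\<^bsub>P\<^esub> \<phi> (x(i := u)) y"
          using u k lin_mapsD(3)[OF L[OF y] k u] by (simp add: G(2)[OF up y])
        also have "\<dots> = (k \<odot>\<^bsub>H\<^esub> G (x(i := u))) (?v y)"
          using lin_mapsD(3)[OF ev[OF vc[OF y]] k G(1)[OF up[OF u]]]
          by (simp only: G(2)[OF up[OF u] y])
        finally show "G (x(i := k \<odot>\<^bsub>M\<^esub> u)) (?v y) = (k \<odot>\<^bsub>H\<^esub> G (x(i := u))) (?v y)" .
      qed (use u k in \<open>auto intro!: G(1) up\<close>)
    qed (auto intro!: G(1) up)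
  next
    fix \<sigma> x assume \<sigma>: "\<sigma> \<in> W d" and x: "x \<in> {1..d} \<rightarrow> carrier M"
    have \<sigma>x: "(\<lambda>t. x (inv' \<sigma> t)) \<in> {1..d} \<rightarrow> carrier M"
      using x permutes_in_image[OF permutes_inv[OF W_permutes[OF \<sigma>]]] by (auto simp: Pi_iff)
    note k = inv_chi_closed[OF \<sigma>]
    show "G (\<lambda>t. x (inv' \<sigma> t)) = inv\<^bsub>K\<^esub> \<chi> d \<sigma> \<odot>\<^bsub>H\<^esub> G x"
    proof (rule H_eqI)
      fix y assume y: "y \<in> {1..e} \<rightarrow> carrier N"
      have "G (\<lambda>t. x (inv' \<sigma> t)) (?v y) = inv\<^bsub>K\<^esub> \<chi> d \<sigma> \<odot>\<^bsub>P\<^esub> \<phi> x y"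
        using chi_multilinearD(2)[OF \<phi>1[OF y] \<sigma> x] by (simp add: G(2)[OF \<sigma>x y])
      also have "\<dots> = (inv\<^bsub>K\<^esub> \<chi> d \<sigma> \<odot>\<^bsub>H\<^esub> G x) (?v y)"
        using lin_mapsD(3)[OF ev[OF vc[OF y]] k G(1)[OF x]] by (simp only: G(2)[OF x y])
      finally show "G (\<lambda>t. x (inv' \<sigma> t)) (?v y) = (inv\<^bsub>K\<^esub> \<chi> d \<sigma> \<odot>\<^bsub>H\<^esub> G x) (?v y)" .
    qed (use x \<sigma>x k in \<open>auto intro!: G(1)\<close>)
  qed
  from chi_lift[OF M H.module_axioms this] obtain F where F: "F \<in> lin_maps K ?M H"
    "\<And>x. x \<in> {1..d} \<rightarrow> carrier M \<Longrightarrow> F (chi_vec K W \<chi> M d x) = G x"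
    by blast
  have "bilinear_map K ?M ?N P F"
    unfolding bilinear_map_def
    using lin_maps_comp[OF F(1) ev] H_lin[OF lin_mapsD(1)[OF F(1)]] by blast
  with F(2) G(2) show ?thesis by auto
qed

end

section \<open>The product of chi-vectors\<close>

definition juxt :: "nat \<Rightarrow> (nat \<Rightarrow> 'x) \<Rightarrow> (nat \<Rightarrow> 'x) \<Rightarrow> nat \<Rightarrow> 'x" where
  "juxt d x y = (\<lambda>t. if t \<le> d then x t else y (t - d))"

lemma juxt_in:
  assumes "x \<in> {1..d} \<rightarrow> A" "y \<in> {1..e} \<rightarrow> A"
  shows "juxt d x y \<in> {1..d + e} \<rightarrow> A"
proof
  fix t assume "t \<in> {1..d + e}"
  then have "t \<le> d \<and> t \<in> {1..d} \<or> \<not> t \<le> d \<and> t - d \<in> {1..e}" by auto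
  then show "juxt d x y t \<in> A" using assms by (auto simp: juxt_def Pi_iff)
qed

text \<open>Tuples are permuted through inverses, so invariance in the second factor of a product
  needs the inverse of a shifted permutation as a shift.\<close>

lemma inv_omega_pow:
  assumes "\<tau> \<in> W e"
  shows "inv' ((omega ^^ d) \<tau>) = (omega ^^ d) (inv' \<tau>)"
proof (rule inv_unique_comp)
  \<comment> \<open>Positive arguments stay positive, so a value such as
    \<open>\<tau> (t - d) + d\<close> with \<open>d < t\<close> lies above \<open>d\<close>, and the
    outer shift again takes its second branch.\<close>
  have pos: "\<rho> t \<noteq> 0" if "\<rho> \<in> W e" "t \<noteq> 0" for \<rho> t
    using W_bij[OF that(1)] W_zero[OF that(1)] that(2) by (metis bij_def inj_eq)
  have ap: "(omega ^^ d) \<rho> t = (if t \<le> d then t else \<rho> (t - d) + d)" if "\<rho> \<in> W e" for \<rho> t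
    by (rule omega_pow_apply[where \<sigma> = \<rho>, OF W_zero[OF that]])
  have "\<tau> (inv' \<tau> t) = t" "inv' \<tau> (\<tau> t) = t" for t
    using W_bij[OF assms] by (simp_all add: bij_is_surj surj_f_inv_f bij_is_inj)
  then show "(omega ^^ d) \<tau> \<circ> (omega ^^ d) (inv' \<tau>) = id"
    "(omega ^^ d) (inv' \<tau>) \<circ> (omega ^^ d) \<tau> = id"
    using pos[OF assms] pos[OF W_inv[OF assms]]
    by (auto simp: fun_eq_iff ap[OF assms] ap[OF W_inv[OF assms]])
qed

text \<open>Each factor uses one half of \<omega>-invariance: \<open>W d\<close>, as part of
  \<open>W (d + e)\<close>, permutes the first block, and the \<open>d\<close>-fold shift of
  \<open>W e\<close> permutes the second, in both cases with unchanged character values.\<close>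

lemma chi_mult_spec:
  assumes M: "module K M"
  shows "bilinear_map K (chi_power K W \<chi> M d) (chi_power K W \<chi> M e) (chi_power K W \<chi> M (d + e))
      (chi_mult K W \<chi> M d e)" (is "?A (chi_mult K W \<chi> M d e)")
    and "x \<in> {1..d} \<rightarrow> carrier M \<Longrightarrow> y \<in> {1..e} \<rightarrow> carrier M \<Longrightarrow>
      chi_mult K W \<chi> M d e (chi_vec K W \<chi> M d x) (chi_vec K W \<chi> M e y) =
      chi_vec K W \<chi> M (d + e) (juxt d x y)"
proof -
  let ?v = "chi_vec K W \<chi> M (d + e)"
  note ml = chi_vec_multilinear[OF M, of "d + e"]
  note cml = chi_multilinearD(2)[OF chi_vec_chi_multilinear[OF M, of "d + e"]]
  have 1: "chi_multilinear M d (chi_power K W \<chi> M (d + e)) (\<lambda>x. ?v (juxt d x y))"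
    if y: "y \<in> {1..e} \<rightarrow> carrier M" for y
    unfolding chi_multilinear_def
  proof (intro conjI ballI multilinearI)
    fix x assume x: "x \<in> {1..d} \<rightarrow> carrier M"
    note j = juxt_in[OF x y]
    show "?v (juxt d x y) \<in> carrier (chi_power K W \<chi> M (d + e))" by (rule chi_vec_closed[OF M j])
    show "?v (juxt d (restrict x {1..d}) y) = ?v (juxt d x y)"
      by (rule multilinear_cong[OF ml j]) (auto simp: juxt_def)
    fix i assume i: "i \<in> {1..d}"
    have "juxt d (x(i := u)) y = (juxt d x y)(i := u)" for u
      using i by (auto simp: juxt_def fun_eq_iff)
    moreover have "i \<in> {1..d + e}" using i by auto
    ultimately show "(\<lambda>u. ?v (juxt d (x(i := u)) y)) \<in> lin_maps K M (chi_power K W \<chi> M (d + e))"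
      using multilinearD(3)[OF ml j] by simp
  next
    fix \<sigma> x assume \<sigma>: "\<sigma> \<in> W d" and x: "x \<in> {1..d} \<rightarrow> carrier M"
    note p = permutes_inv[OF W_permutes[OF \<sigma>]]
    have "juxt d (\<lambda>t. x (inv' \<sigma> t)) y t = juxt d x y (inv' \<sigma> t)" for t
    proof (cases "t \<in> {1..d}")
      case True
      then have "inv' \<sigma> t \<in> {1..d}" using permutes_in_image[OF p] by blast
      with True show ?thesis by (auto simp: juxt_def)
    next
      case False
      then have "inv' \<sigma> t = t" by (rule permutes_not_in[OF p])
      then show ?thesis by (simp add: juxt_def)
    qed
    then have "juxt d (\<lambda>t. x (inv' \<sigma> t)) y = (\<lambda>t. juxt d x y (inv' \<sigma> t))" by blast
    moreover have "\<sigma> \<in> W (d + e)" "\<chi> (d + e) \<sigma> = \<chi> d \<sigma>" using W_mono[OF \<sigma>] by auto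
    ultimately show "?v (juxt d (\<lambda>t. x (inv' \<sigma> t)) y) =
        inv\<^bsub>K\<^esub> \<chi> d \<sigma> \<odot>\<^bsub>chi_power K W \<chi> M (d + e)\<^esub> ?v (juxt d x y)"
      using cml[OF _ juxt_in[OF x y]] by simp
  qed
  have 2: "chi_multilinear M e (chi_power K W \<chi> M (d + e)) (\<lambda>y. ?v (juxt d x y))"
    if x: "x \<in> {1..d} \<rightarrow> carrier M" for x
    unfolding chi_multilinear_def
  proof (intro conjI ballI multilinearI)
    fix y assume y: "y \<in> {1..e} \<rightarrow> carrier M"
    note j = juxt_in[OF x y]
    show "?v (juxt d x y) \<in> carrier (chi_power K W \<chi> M (d + e))" by (rule chi_vec_closed[OF M j])
    show "?v (juxt d x (restrict y {1..e})) = ?v (juxt d x y)"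
      by (rule multilinear_cong[OF ml j]) (auto simp: juxt_def)
    fix i assume i: "i \<in> {1..e}"
    have "juxt d x (y(i := u)) = (juxt d x y)(d + i := u)" for u
      using i by (auto simp: juxt_def fun_eq_iff)
    moreover have "d + i \<in> {1..d + e}" using i by auto
    ultimately show "(\<lambda>u. ?v (juxt d x (y(i := u)))) \<in> lin_maps K M (chi_power K W \<chi> M (d + e))"
      using multilinearD(3)[OF ml j] by simp
  next
    fix \<tau> y assume \<tau>: "\<tau> \<in> W e" and y: "y \<in> {1..e} \<rightarrow> carrier M"
    have pos: "inv' \<tau> t \<noteq> 0" if "t \<noteq> 0" for t
      using W_bij[OF W_inv[OF \<tau>]] W_zero[OF W_inv[OF \<tau>]] that by (metis bij_def inj_eq)
    have "juxt d x (\<lambda>t. y (inv' \<tau> t)) t = juxt d x y (inv' ((omega ^^ d) \<tau>) t)" for t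
      unfolding inv_omega_pow[OF \<tau>] omega_pow_apply[where \<sigma> = "inv' \<tau>", OF W_zero[OF W_inv[OF \<tau>]]]
      using pos[of "t - d"] by (auto simp: juxt_def)
    then have "juxt d x (\<lambda>t. y (inv' \<tau> t)) = (\<lambda>t. juxt d x y (inv' ((omega ^^ d) \<tau>) t))" by blast
    moreover have "(omega ^^ d) \<tau> \<in> W (d + e)" "\<chi> (d + e) ((omega ^^ d) \<tau>) = \<chi> e \<tau>"
      using omega_pow_W[OF \<tau>, of d] by (auto simp: add.commute)
    ultimately show "?v (juxt d x (\<lambda>t. y (inv' \<tau> t))) =
        inv\<^bsub>K\<^esub> \<chi> e \<tau> \<odot>\<^bsub>chi_power K W \<chi> M (d + e)\<^esub> ?v (juxt d x y)"
      using cml[OF _ juxt_in[OF x y]] by simp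
  qed
  have "\<exists>f. ?A f \<and> (\<forall>x \<in> {1..d} \<rightarrow> carrier M. \<forall>y \<in> {1..e} \<rightarrow> carrier M.
        f (chi_vec K W \<chi> M d x) (chi_vec K W \<chi> M e y) = ?v (juxt d x y))"
    by (rule chi_bilinear_lift[OF M M chi_power_module[OF M] 1 2])
  from someI_ex[OF this]
  show "?A (chi_mult K W \<chi> M d e)"
    and "x \<in> {1..d} \<rightarrow> carrier M \<Longrightarrow> y \<in> {1..e} \<rightarrow> carrier M \<Longrightarrow>
      chi_mult K W \<chi> M d e (chi_vec K W \<chi> M d x) (chi_vec K W \<chi> M e y) = ?v (juxt d x y)"
    by (auto simp: chi_mult_def juxt_def)
qed

section \<open>The pairing on tuples and its descent to chi-vectors\<close>

definition pairing :: "nat \<Rightarrow> (nat \<Rightarrow> 'e) \<Rightarrow> (nat \<Rightarrow> 'e \<Rightarrow> 'k) \<Rightarrow> 'k" where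
  "pairing d x y = (\<Oplus>\<^bsub>K\<^esub>\<sigma>\<in>W d. \<chi> d \<sigma> \<otimes>\<^bsub>K\<^esub> (\<Otimes>\<^bsub>K\<^esub>t\<in>{1..d}. y t (x (inv' \<sigma> t))))"

lemma W_inv_in:
  assumes "\<sigma> \<in> W d" "t \<in> {1..d}"
  shows "inv' \<sigma> t \<in> {1..d}"
  using permutes_in_image[OF permutes_inv[OF W_permutes[OF assms(1)]]] assms(2) by blast

lemma W_in:
  assumes "\<sigma> \<in> W d" "t \<in> {1..d}"
  shows "\<sigma> t \<in> {1..d}"
  using permutes_in_image[OF W_permutes[OF assms(1)]] assms(2) by blast

lemma pairing_term_closed:
  assumes "x \<in> {1..d} \<rightarrow> carrier E" "y \<in> {1..d} \<rightarrow> carrier (dual K E)"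
    "\<And>t. t \<in> {1..d} \<Longrightarrow> f t \<in> {1..d} \<and> g t \<in> {1..d}"
  shows "(\<Otimes>\<^bsub>K\<^esub>t\<in>{1..d}. y (f t) (x (g t))) \<in> carrier K"
  using assms(3)
  by (intro K.finprod_closed Pi_I dual_apply_closed[OF funcset_mem[OF assms(2)] funcset_mem[OF assms(1)]])
    blast+

text \<open>The second invariance moves the permutation to the other side of the product, which inverts
  it; this is where \<open>\<chi>\<close> has to agree with its inverse.\<close>

lemma pairing_perm:
  assumes x: "x \<in> {1..d} \<rightarrow> carrier E" and y: "y \<in> {1..d} \<rightarrow> carrier (dual K E)" and \<rho>: "\<rho> \<in> W d"
  shows "pairing d (\<lambda>t. x (inv' \<rho> t)) y = inv\<^bsub>K\<^esub> \<chi> d \<rho> \<otimes>\<^bsub>K\<^esub> pairing d x y"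
    and "pairing d x (\<lambda>t. y (inv' \<rho> t)) = inv\<^bsub>K\<^esub> \<chi> d \<rho> \<otimes>\<^bsub>K\<^esub> pairing d x y"
proof -
  define T where "T \<sigma> = (\<Otimes>\<^bsub>K\<^esub>t\<in>{1..d}. y t (x (inv' \<sigma> t)))" for \<sigma>
  have T: "T \<sigma> \<in> carrier K" if "\<sigma> \<in> W d" for \<sigma>
    unfolding T_def using pairing_term_closed[OF x y, of "\<lambda>t. t" "inv' \<sigma>"] W_inv_in[OF that] by blast
  define F where "F \<sigma> = inv\<^bsub>K\<^esub> \<chi> d \<rho> \<otimes>\<^bsub>K\<^esub> (\<chi> d \<sigma> \<otimes>\<^bsub>K\<^esub> T \<sigma>)" for \<sigma>
  have F: "F \<sigma> \<in> carrier K" if "\<sigma> \<in> W d" for \<sigma> using T that \<rho> by (simp add: F_def)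
  have "(\<Oplus>\<^bsub>K\<^esub>\<sigma>\<in>W d. F \<sigma>) = inv\<^bsub>K\<^esub> \<chi> d \<rho> \<otimes>\<^bsub>K\<^esub> pairing d x y"
    unfolding F_def pairing_def T_def[symmetric]
    using \<rho> T by (intro K.finsum_rdistr[symmetric] finite_W) auto
  note sumF = this
  \<comment> \<open>Translating the summation index turns the sum of \<open>F\<close> into the
    pairing of a permuted tuple: right translation by \<open>\<rho>\<close> serves the vectors, left
    translation by its inverse serves the forms.\<close>
  have reindex: "(\<Oplus>\<^bsub>K\<^esub>\<sigma>\<in>W d. F \<sigma>) = (\<Oplus>\<^bsub>K\<^esub>\<sigma>\<in>W d. F (h \<sigma>))" if h: "bij_betw h (W d) (W d)" for h
  proof -
    have "(\<Oplus>\<^bsub>K\<^esub>\<sigma>\<in>h ` W d. F \<sigma>) = (\<Oplus>\<^bsub>K\<^esub>\<sigma>\<in>W d. F (h \<sigma>))"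
      using h F by (intro K.finsum_reindex) (auto simp: bij_betw_def)
    then show ?thesis using h by (simp add: bij_betw_def)
  qed
  have bij\<rho>: "\<rho> \<circ> inv' \<rho> = id" "inv' \<rho> \<circ> \<rho> = id"
    using W_bij[OF \<rho>] by (simp_all add: bij_is_surj bij_is_inj surj_iff[THEN iffD1])
  have "bij_betw (\<lambda>\<sigma>. \<sigma> \<circ> \<rho>) (W d) (W d)"
    by (rule bij_betwI[where g = "\<lambda>\<sigma>. \<sigma> \<circ> inv' \<rho>"])
      (auto simp: comp_assoc bij\<rho> intro!: W_comp W_inv \<rho>)
  note r1 = reindex[OF this]
  have "bij_betw (\<lambda>\<sigma>. inv' \<rho> \<circ> \<sigma>) (W d) (W d)"
    by (rule bij_betwI[where g = "\<lambda>\<sigma>. \<rho> \<circ> \<sigma>"])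
      (auto simp: bij\<rho> intro!: W_comp W_inv \<rho> simp flip: comp_assoc)
  note r2 = reindex[OF this]
  have un: "\<chi> d \<rho> \<otimes>\<^bsub>K\<^esub> \<chi> d \<rho> = \<one>\<^bsub>K\<^esub>" by (rule chi_involutive[OF \<rho>])
  show "pairing d (\<lambda>t. x (inv' \<rho> t)) y = inv\<^bsub>K\<^esub> \<chi> d \<rho> \<otimes>\<^bsub>K\<^esub> pairing d x y"
    unfolding sumF[symmetric] r1 unfolding pairing_def
  proof (rule K.finsum_cong')
    fix \<sigma> assume \<sigma>: "\<sigma> \<in> W d"
    note \<sigma>\<rho> = W_comp[OF \<sigma> \<rho>]
    have "F (\<sigma> \<circ> \<rho>) = (\<chi> d \<rho> \<otimes>\<^bsub>K\<^esub> \<chi> d \<rho>) \<otimes>\<^bsub>K\<^esub> (\<chi> d \<sigma> \<otimes>\<^bsub>K\<^esub> T (\<sigma> \<circ> \<rho>))"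
      using \<sigma> \<rho> T[OF \<sigma>\<rho>] by (simp add: F_def inv_chi chi_comp K.m_ac)
    also have "\<dots> = \<chi> d \<sigma> \<otimes>\<^bsub>K\<^esub> T (\<sigma> \<circ> \<rho>)" using \<sigma> T[OF \<sigma>\<rho>] by (simp add: un)
    also have "T (\<sigma> \<circ> \<rho>) = (\<Otimes>\<^bsub>K\<^esub>t\<in>{1..d}. y t (x (inv' \<rho> (inv' \<sigma> t))))"
      unfolding T_def o_inv_distrib[OF W_bij[OF \<sigma>] W_bij[OF \<rho>]] by simp
    finally show "\<chi> d \<sigma> \<otimes>\<^bsub>K\<^esub> (\<Otimes>\<^bsub>K\<^esub>t\<in>{1..d}. y t (x (inv' \<rho> (inv' \<sigma> t)))) = F (\<sigma> \<circ> \<rho>)" ..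
  qed (auto intro!: F W_comp \<rho>)
  show "pairing d x (\<lambda>t. y (inv' \<rho> t)) = inv\<^bsub>K\<^esub> \<chi> d \<rho> \<otimes>\<^bsub>K\<^esub> pairing d x y"
    unfolding sumF[symmetric] r2 unfolding pairing_def
  proof (rule K.finsum_cong')
    fix \<sigma> assume \<sigma>: "\<sigma> \<in> W d"
    note \<sigma>\<rho> = W_comp[OF W_inv[OF \<rho>] \<sigma>]
    have "F (inv' \<rho> \<circ> \<sigma>) = (\<chi> d \<rho> \<otimes>\<^bsub>K\<^esub> \<chi> d \<rho>) \<otimes>\<^bsub>K\<^esub> (\<chi> d \<sigma> \<otimes>\<^bsub>K\<^esub> T (inv' \<rho> \<circ> \<sigma>))"
      using \<sigma> \<rho> T[OF \<sigma>\<rho>] by (simp add: F_def inv_chi chi_inv W_inv chi_comp K.m_ac)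
    also have "\<dots> = \<chi> d \<sigma> \<otimes>\<^bsub>K\<^esub> T (inv' \<rho> \<circ> \<sigma>)" using \<sigma> T[OF \<sigma>\<rho>] by (simp add: un)
    also have "T (inv' \<rho> \<circ> \<sigma>) = (\<Otimes>\<^bsub>K\<^esub>t\<in>{1..d}. y t (x (inv' \<sigma> (\<rho> t))))"
      unfolding T_def o_inv_distrib[OF W_bij[OF W_inv[OF \<rho>]] W_bij[OF \<sigma>]]
      by (simp add: inv_inv_eq[OF W_bij[OF \<rho>]])
    \<comment> \<open>The index of \<open>y\<close> is written through \<open>\<rho> t\<close> as
      well, so that the whole factor depends on \<open>\<rho> t\<close> and the product can be
      reindexed along \<open>\<rho>\<close>.\<close>
    also have "\<dots> = (\<Otimes>\<^bsub>K\<^esub>t\<in>{1..d}. y (inv' \<rho> (\<rho> t)) (x (inv' \<sigma> (\<rho> t))))"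
      using bij\<rho>(2) by (simp add: fun_eq_iff)
    also have "\<dots> = (\<Otimes>\<^bsub>K\<^esub>t\<in>\<rho> ` {1..d}. y (inv' \<rho> t) (x (inv' \<sigma> t)))"
    proof (rule K.finprod_reindex[symmetric])
      show "inj_on \<rho> {1..d}" using W_bij[OF \<rho>] by (auto simp: bij_def intro: inj_on_subset)
      show "(\<lambda>t. y (inv' \<rho> t) (x (inv' \<sigma> t))) \<in> \<rho> ` {1..d} \<rightarrow> carrier K"
        unfolding permutes_image[OF W_permutes[OF \<rho>]]
        using \<sigma> \<rho> by (intro Pi_I dual_apply_closed[OF funcset_mem[OF y] funcset_mem[OF x]] W_inv_in)
    qed
    also have "\<rho> ` {1..d} = {1..d}" by (rule permutes_image[OF W_permutes[OF \<rho>]])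
    finally show "\<chi> d \<sigma> \<otimes>\<^bsub>K\<^esub> (\<Otimes>\<^bsub>K\<^esub>t\<in>{1..d}. y (inv' \<rho> t) (x (inv' \<sigma> t))) = F (inv' \<rho> \<circ> \<sigma>)" ..
  qed (auto intro!: F W_comp W_inv \<rho>)
qed

lemma chi_form_deg_spec:
  assumes E: "module K E"
  shows "bilinear_map K (chi_power K W \<chi> E d) (chi_power K W \<chi> (dual K E) d) (ring_module K)
      (chi_form_deg K W \<chi> E d)" (is "?A (chi_form_deg K W \<chi> E d)")
    and "x \<in> {1..d} \<rightarrow> carrier E \<Longrightarrow> y \<in> {1..d} \<rightarrow> carrier (dual K E) \<Longrightarrow>
      chi_form_deg K W \<chi> E d (chi_vec K W \<chi> E d x) (chi_vec K W \<chi> (dual K E) d y) = pairing d x y"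
proof -
  note R = ring_module_module[OF K.cring_axioms]
  note D = dual_module[OF E]
  have sum: "multilinear K M d (ring_module K) (\<lambda>x. \<Oplus>\<^bsub>K\<^esub>\<sigma>\<in>W d. \<chi> d \<sigma> \<otimes>\<^bsub>K\<^esub> \<psi> \<sigma> x)"
    if M: "module K M" and "\<And>\<sigma>. \<sigma> \<in> W d \<Longrightarrow> multilinear K M d (ring_module K) (\<psi> \<sigma>)"
    for M :: "('k, 'x, 'm) module_scheme" and \<psi>
    using multilinear_finsum[OF M R finite_W multilinear_smult[OF M R that(2) chi_closed]] by simp
  have 1: "chi_multilinear E d (ring_module K) (\<lambda>x. pairing d x y)"
    if y: "y \<in> {1..d} \<rightarrow> carrier (dual K E)" for y
    unfolding chi_multilinear_def
  proof (intro conjI ballI)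
    show "multilinear K E d (ring_module K) (\<lambda>x. pairing d x y)"
      unfolding pairing_def
      by (intro sum[OF E] multilinear_perm[OF linear_functional_prod_multilinear[OF E]] W_permutes
          dual_lin funcset_mem[OF y])
  qed (simp add: pairing_perm(1)[OF _ y])
  have 2: "chi_multilinear (dual K E) d (ring_module K) (pairing d x)"
    if x: "x \<in> {1..d} \<rightarrow> carrier E" for x
    unfolding chi_multilinear_def
  proof (intro conjI ballI)
    show "multilinear K (dual K E) d (ring_module K) (pairing d x)"
      unfolding pairing_def[abs_def]
    proof (rule sum[OF D])
      fix \<sigma> assume \<sigma>: "\<sigma> \<in> W d"
      show "multilinear K (dual K E) d (ring_module K) (\<lambda>y. \<Otimes>\<^bsub>K\<^esub>t\<in>{1..d}. y t (x (inv' \<sigma> t)))"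
        by (rule linear_functional_prod_multilinear[OF D, of d "\<lambda>t f. f (x (inv' \<sigma> t))"])
          (auto simp: dual_eq_hom_module intro!: hom_module_eval[OF E] funcset_mem[OF x] W_inv_in[OF \<sigma>])
    qed
  qed (simp add: pairing_perm(2)[OF x])
  have "\<exists>f. ?A f \<and> (\<forall>x \<in> {1..d} \<rightarrow> carrier E. \<forall>y \<in> {1..d} \<rightarrow> carrier (dual K E).
        f (chi_vec K W \<chi> E d x) (chi_vec K W \<chi> (dual K E) d y) = pairing d x y)"
    by (rule chi_bilinear_lift[OF E D R 1 2])
  from someI_ex[OF this]
  show "?A (chi_form_deg K W \<chi> E d)"
    and "x \<in> {1..d} \<rightarrow> carrier E \<Longrightarrow> y \<in> {1..d} \<rightarrow> carrier (dual K E) \<Longrightarrow>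
      chi_form_deg K W \<chi> E d (chi_vec K W \<chi> E d x) (chi_vec K W \<chi> (dual K E) d y) = pairing d x y"
    by (auto simp: chi_form_deg_def pairing_def)
qed

end

section \<open>Non-degeneracy of the pairing\<close>

lemma (in abelian_monoid) finsum_swap:
  assumes "finite A" "finite B" "\<And>i j. i \<in> A \<Longrightarrow> j \<in> B \<Longrightarrow> f i j \<in> carrier G"
  shows "(\<Oplus>i\<in>A. \<Oplus>j\<in>B. f i j) = (\<Oplus>j\<in>B. \<Oplus>i\<in>A. f i j)"
  using assms(1,3)
proof (induction A rule: finite_induct)
  case (insert a A)
  have "(\<Oplus>j\<in>B. \<Oplus>i\<in>insert a A. f i j) = (\<Oplus>j\<in>B. f a j \<oplus> (\<Oplus>i\<in>A. f i j))"
    using insert by (intro finsum_cong') (auto intro!: finsum_closed)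
  also have "\<dots> = (\<Oplus>j\<in>B. f a j) \<oplus> (\<Oplus>j\<in>B. \<Oplus>i\<in>A. f i j)"
    using insert by (intro finsum_addf) (auto intro!: finsum_closed)
  also have "(\<Oplus>j\<in>B. \<Oplus>i\<in>A. f i j) = (\<Oplus>i\<in>A. \<Oplus>j\<in>B. f i j)"
    using insert by simp
  also have "(\<Oplus>j\<in>B. f a j) \<oplus> \<dots> = (\<Oplus>i\<in>insert a A. \<Oplus>j\<in>B. f i j)"
    using insert by (intro finsum_insert[symmetric]) (auto intro!: finsum_closed)
  finally show ?case ..
qed simp

text \<open>The sum of ones is the image of the rational number \<open>card A\<close>, which is
  nonzero; the image of its rational inverse serves as \<open>c\<close>.\<close>

lemma contains_rationals_card_unit:
  assumes "cring K" "contains_rationals K" "finite A" "A \<noteq> {}"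
  shows "\<exists>c\<in>carrier K. c \<otimes>\<^bsub>K\<^esub> (\<Oplus>\<^bsub>K\<^esub>i\<in>A. \<one>\<^bsub>K\<^esub>) = \<one>\<^bsub>K\<^esub>"
proof -
  interpret K: cring K by fact
  obtain f where "f \<in> ring_hom rat_ring K" using assms(2) by (auto simp: contains_rationals_def)
  then have f: "f r \<in> carrier K" "f (r + s) = f r \<oplus>\<^bsub>K\<^esub> f s" "f (r * s) = f r \<otimes>\<^bsub>K\<^esub> f s"
    "f 1 = \<one>\<^bsub>K\<^esub>" for r s
    by (auto simp: ring_hom_def rat_ring_def)
  \<comment> \<open>The conditions in \<open>ring_hom\<close> do not mention zero; additivity alone
    shows that \<open>f 0\<close> is its own double and hence zero.\<close>
  have "f 0 \<oplus>\<^bsub>K\<^esub> f 0 = f 0" using f(2)[of 0 0] by simp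
  then have f0: "f 0 = \<zero>\<^bsub>K\<^esub>" using f(1)[of 0] by (metis K.add.r_cancel_one')
  have card: "(\<Oplus>\<^bsub>K\<^esub>i\<in>A. \<one>\<^bsub>K\<^esub>) = f (of_nat (card A))"
    using assms(3) by (induction A rule: finite_induct) (auto simp: f f0)
  have "card A \<noteq> 0" using assms(3,4) by simp
  then have "f (1 / of_nat (card A)) \<otimes>\<^bsub>K\<^esub> f (of_nat (card A)) = \<one>\<^bsub>K\<^esub>"
    by (simp add: f(4) flip: f(3))
  with card f(1) show ?thesis by auto
qed

text \<open>The coordinate functions are additive and homogeneous because coefficients are unique.
  The basis is a plain set, so the dual family is indexed by the basis vectors themselves.\<close>

lemma finite_basis_dual:
  assumes E: "module K E" and basis: "has_finite_basis K E"
  obtains B \<epsilon> where "finite B" "B \<subseteq> carrier E" "\<And>b. b \<in> B \<Longrightarrow> \<epsilon> b \<in> carrier (dual K E)"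
    "\<And>b b'. b \<in> B \<Longrightarrow> b' \<in> B \<Longrightarrow> \<epsilon> b b' = (if b = b' then \<one>\<^bsub>K\<^esub> else \<zero>\<^bsub>K\<^esub>)"
    "\<And>x. x \<in> carrier E \<Longrightarrow> x = (\<Oplus>\<^bsub>E\<^esub>b\<in>B. \<epsilon> b x \<odot>\<^bsub>E\<^esub> b)"
proof -
  interpret E: module K E by fact
  from basis[unfolded has_finite_basis_def]
  obtain B where B: "finite B \<and> B \<subseteq> carrier E \<and> (\<forall>x\<in>carrier E.
      \<exists>!c. c \<in> B \<rightarrow>\<^sub>E carrier K \<and> x = (\<Oplus>\<^bsub>E\<^esub>b\<in>B. c b \<odot>\<^bsub>E\<^esub> b))" ..
  note ex = bspec[OF conjunct2[OF conjunct2[OF B]]]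
  note B = conjunct1[OF B] conjunct1[OF conjunct2[OF B]]
  define co where "co x = (THE c. c \<in> B \<rightarrow>\<^sub>E carrier K \<and> x = (\<Oplus>\<^bsub>E\<^esub>b\<in>B. c b \<odot>\<^bsub>E\<^esub> b))" for x
  have co: "co x \<in> B \<rightarrow>\<^sub>E carrier K" "x = (\<Oplus>\<^bsub>E\<^esub>b\<in>B. co x b \<odot>\<^bsub>E\<^esub> b)" if "x \<in> carrier E" for x
    using theI'[OF ex[OF that], folded co_def] by blast+
  \<comment> \<open>Uniqueness in \<open>has_finite_basis\<close> concerns extensional coefficient
    families, so a family given by a formula is first restricted to \<open>B\<close>.\<close>
  have co_unique: "co x b = c b"
    if "x \<in> carrier E" "c \<in> B \<rightarrow> carrier K" "x = (\<Oplus>\<^bsub>E\<^esub>b\<in>B. c b \<odot>\<^bsub>E\<^esub> b)" "b \<in> B" for x c b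
  proof -
    have "x = (\<Oplus>\<^bsub>E\<^esub>b\<in>B. restrict c B b \<odot>\<^bsub>E\<^esub> b)"
      by (rule trans[OF that(3)]) (use that(2) B in \<open>auto simp: Pi_iff intro!: E.finsum_cong'\<close>)
    moreover have "restrict c B \<in> B \<rightarrow>\<^sub>E carrier K" using that(2) by auto
    ultimately have "co x = restrict c B"
      using ex[OF that(1)] co[OF that(1)] by blast
    with that(4) show ?thesis by simp
  qed
  have cc: "co x b \<in> carrier K" if "x \<in> carrier E" "b \<in> B" for x b
    using co(1)[OF that(1)] that(2) by auto
  define \<epsilon> where "\<epsilon> b = (\<lambda>x\<in>carrier E. co x b)" for b
  have Bc: "b \<in> carrier E" if "b \<in> B" for b using that B by auto
  show thesis
  proof (rule that[of B \<epsilon>])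
    fix b assume b: "b \<in> B"
    have "(\<lambda>x. co x b) \<in> lin_maps K E (ring_module K)"
    proof (rule lin_mapsI)
      fix x y assume x: "x \<in> carrier E" and y: "y \<in> carrier E"
      have "x \<oplus>\<^bsub>E\<^esub> y = (\<Oplus>\<^bsub>E\<^esub>b\<in>B. co x b \<odot>\<^bsub>E\<^esub> b) \<oplus>\<^bsub>E\<^esub> (\<Oplus>\<^bsub>E\<^esub>b\<in>B. co y b \<odot>\<^bsub>E\<^esub> b)"
        by (rule arg_cong2[OF co(2)[OF x] co(2)[OF y]])
      also have "\<dots> = (\<Oplus>\<^bsub>E\<^esub>b\<in>B. co x b \<odot>\<^bsub>E\<^esub> b \<oplus>\<^bsub>E\<^esub> co y b \<odot>\<^bsub>E\<^esub> b)"
        using x y cc Bc by (intro E.finsum_addf[symmetric]) auto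
      also have "\<dots> = (\<Oplus>\<^bsub>E\<^esub>b\<in>B. (co x b \<oplus>\<^bsub>K\<^esub> co y b) \<odot>\<^bsub>E\<^esub> b)"
        using x y cc Bc by (intro E.finsum_cong') (auto simp: E.smult_l_distr)
      finally have s: "x \<oplus>\<^bsub>E\<^esub> y = (\<Oplus>\<^bsub>E\<^esub>b\<in>B. (co x b \<oplus>\<^bsub>K\<^esub> co y b) \<odot>\<^bsub>E\<^esub> b)" .
      have "co (x \<oplus>\<^bsub>E\<^esub> y) b = co x b \<oplus>\<^bsub>K\<^esub> co y b"
        by (rule co_unique[OF E.a_closed[OF x y] _ s b]) (simp add: cc x y)
      then show "co (x \<oplus>\<^bsub>E\<^esub> y) b = co x b \<oplus>\<^bsub>ring_module K\<^esub> co y b" by simp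
    next
      fix k x assume k: "k \<in> carrier K" and x: "x \<in> carrier E"
      have "k \<odot>\<^bsub>E\<^esub> x = k \<odot>\<^bsub>E\<^esub> (\<Oplus>\<^bsub>E\<^esub>b\<in>B. co x b \<odot>\<^bsub>E\<^esub> b)"
        by (rule arg_cong[OF co(2)[OF x]])
      also have "\<dots> = (\<Oplus>\<^bsub>E\<^esub>b\<in>B. k \<odot>\<^bsub>E\<^esub> (co x b \<odot>\<^bsub>E\<^esub> b))"
        using x k cc Bc by (intro E.finsum_smult_ldistr B) auto
      also have "\<dots> = (\<Oplus>\<^bsub>E\<^esub>b\<in>B. (k \<otimes>\<^bsub>K\<^esub> co x b) \<odot>\<^bsub>E\<^esub> b)"
        using x k cc Bc by (intro E.finsum_cong') (auto simp: E.smult_assoc1)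
      finally have s: "k \<odot>\<^bsub>E\<^esub> x = (\<Oplus>\<^bsub>E\<^esub>b\<in>B. (k \<otimes>\<^bsub>K\<^esub> co x b) \<odot>\<^bsub>E\<^esub> b)" .
      have "co (k \<odot>\<^bsub>E\<^esub> x) b = k \<otimes>\<^bsub>K\<^esub> co x b"
        by (rule co_unique[OF E.smult_closed[OF k x] _ s b]) (simp add: cc k x)
      then show "co (k \<odot>\<^bsub>E\<^esub> x) b = k \<odot>\<^bsub>ring_module K\<^esub> co x b" by simp
    qed (simp add: cc b)
    from restrict_lin_maps[OF E this] show "\<epsilon> b \<in> carrier (dual K E)"
      by (simp add: \<epsilon>_def dual_eq_hom_module)
    fix b' assume b': "b' \<in> B"
    have "(\<Oplus>\<^bsub>E\<^esub>b\<in>B. (if b = b' then \<one>\<^bsub>K\<^esub> else \<zero>\<^bsub>K\<^esub>) \<odot>\<^bsub>E\<^esub> b) =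
        (\<Oplus>\<^bsub>E\<^esub>b\<in>B. if b' = b then b else \<zero>\<^bsub>E\<^esub>)"
      using Bc by (intro E.finsum_cong') auto
    also have "\<dots> = b'" using b' Bc B by (intro E.finsum_singleton) auto
    finally have "co b' b = (if b = b' then \<one>\<^bsub>K\<^esub> else \<zero>\<^bsub>K\<^esub>)"
      by (intro co_unique[OF Bc[OF b'] _ sym b]) simp
    then show "\<epsilon> b b' = (if b = b' then \<one>\<^bsub>K\<^esub> else \<zero>\<^bsub>K\<^esub>)"
      using Bc[OF b'] by (simp add: \<epsilon>_def)
  next
    fix x assume x: "x \<in> carrier E"
    show "x = (\<Oplus>\<^bsub>E\<^esub>b\<in>B. \<epsilon> b x \<odot>\<^bsub>E\<^esub> b)"
      unfolding \<epsilon>_def restrict_apply'[OF x] by (rule co(2)[OF x])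
  qed (fact B)+
qed

lemma lin_eq_on_spanning:
  assumes "module K M" "module K P" "finite B" "B \<subseteq> carrier M"
    and c: "\<And>b. b \<in> B \<Longrightarrow> c b \<in> carrier K" and x: "x = (\<Oplus>\<^bsub>M\<^esub>b\<in>B. c b \<odot>\<^bsub>M\<^esub> b)"
    and f: "f \<in> lin_maps K M P" and g: "g \<in> lin_maps K M P" and eq: "\<And>b. b \<in> B \<Longrightarrow> f b = g b"
  shows "f x = g x"
proof -
  interpret M: module K M by fact
  interpret P: module K P by fact
  have Bc: "b \<in> carrier M" if "b \<in> B" for b using that assms(4) by auto
  have cb: "(\<lambda>b. c b \<odot>\<^bsub>M\<^esub> b) \<in> B \<rightarrow> carrier M" using c Bc by auto
  have "(\<Oplus>\<^bsub>P\<^esub>b\<in>B. f (c b \<odot>\<^bsub>M\<^esub> b)) = (\<Oplus>\<^bsub>P\<^esub>b\<in>B. g (c b \<odot>\<^bsub>M\<^esub> b))"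
    using c Bc eq lin_mapsD(1)[OF g]
    by (intro P.finsum_cong') (auto simp: lin_mapsD(3)[OF f] lin_mapsD(3)[OF g])
  then show ?thesis
    unfolding x lin_finsum[OF assms(1,2) f assms(3) cb] lin_finsum[OF assms(1,2) g assms(3) cb] .
qed

text \<open>Induction on \<open>k\<close>, where the places up to \<open>k\<close> may hold
  arbitrary vectors and the later ones hold elements of \<open>B\<close>; each step frees one place
  by linearity in that place. The premise \<open>span\<close> packages the one-variable case, so
  that no sums occur here.\<close>

lemma multilinear_eq_on_basis:
  assumes \<phi>: "multilinear K M d P \<phi>" and \<psi>: "multilinear K M d P \<psi>" and B: "B \<subseteq> carrier M"
    and span: "\<And>f g x. f \<in> lin_maps K M P \<Longrightarrow> g \<in> lin_maps K M P \<Longrightarrow> (\<And>b. b \<in> B \<Longrightarrow> f b = g b) \<Longrightarrow>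
      x \<in> carrier M \<Longrightarrow> f x = g x"
    and eq: "\<And>x. x \<in> {1..d} \<rightarrow> B \<Longrightarrow> \<phi> x = \<psi> x"
    and x: "x \<in> {1..d} \<rightarrow> carrier M"
  shows "\<phi> x = \<psi> x"
proof -
  have "\<phi> x = \<psi> x" if "x \<in> {1..d} \<rightarrow> carrier M" "\<And>t. t \<in> {1..d} \<Longrightarrow> k < t \<Longrightarrow> x t \<in> B" for k x
    using that
  proof (induction k arbitrary: x)
    case 0
    then show ?case by (intro eq) auto
  next
    case (Suc k)
    show ?case
    proof (cases "Suc k \<in> {1..d}")
      case False
      then show ?thesis
        using Suc.prems(2) by (intro Suc.IH[OF Suc.prems(1)]) (auto simp: Suc_le_eq le_less)
    next
      case True
      have "\<phi> (x(Suc k := x (Suc k))) = \<psi> (x(Suc k := x (Suc k)))"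
      proof (rule span[OF multilinearD(3)[OF \<phi> Suc.prems(1) True] multilinearD(3)[OF \<psi> Suc.prems(1) True]])
        fix b assume b: "b \<in> B"
        have bd: "Suc k < t" if "t \<in> {1..d}" "k < t" "t \<noteq> Suc k" for t using that by auto
        show "\<phi> (x(Suc k := b)) = \<psi> (x(Suc k := b))"
          using Suc.prems b B bd by (intro Suc.IH) (auto simp: Pi_iff)
      next
        show "x (Suc k) \<in> carrier M" using Suc.prems(1) True by blast
      qed
      then show ?thesis by simp
    qed
  qed
  from this[of x d] x show ?thesis by auto
qed

context invariant_chars
begin

lemma pairing_closed:
  assumes x: "x \<in> {1..d} \<rightarrow> carrier E" and y: "y \<in> {1..d} \<rightarrow> carrier (dual K E)"
  shows "pairing d x y \<in> carrier K"
  unfolding pairing_def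
proof (intro K.finsum_closed Pi_I K.m_closed chi_closed)
  show "(\<Otimes>\<^bsub>K\<^esub>t\<in>{1..d}. y t (x (inv' \<sigma> t))) \<in> carrier K" if "\<sigma> \<in> W d" for \<sigma>
    using pairing_term_closed[OF x y, of "\<lambda>t. t" "inv' \<sigma>"] W_inv_in[OF that] by blast
qed

text \<open>Both sides of the averaging identity are linear in \<open>u\<close>, so it is verified
  for \<open>?v x\<close>. There each \<open>\<sigma>\<close> contributes
  \<open>\<chi> d \<sigma>\<close> times the expansion of the permuted vector, and permuting costs
  the inverse factor, which leaves one copy of \<open>?v x\<close> for every element of
  \<open>W d\<close>.\<close>

theorem chi_form_deg_nondegenerate:
  assumes E: "module K E" and basis: "has_finite_basis K E" and rat: "contains_rationals K"
    and u: "u \<in> carrier (chi_power K W \<chi> E d)"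
    and 0: "\<And>y. y \<in> {1..d} \<rightarrow> carrier (dual K E) \<Longrightarrow>
      chi_form_deg K W \<chi> E d u (chi_vec K W \<chi> (dual K E) d y) = \<zero>\<^bsub>K\<^esub>"
  shows "u = \<zero>\<^bsub>chi_power K W \<chi> E d\<^esub>"
proof -
  let ?P = "chi_power K W \<chi> E d" and ?v = "chi_vec K W \<chi> E d"
  let ?w = "chi_vec K W \<chi> (dual K E) d" and ?form = "chi_form_deg K W \<chi> E d"
  note D = dual_module[OF E] and mP = chi_power_module[OF E, of d]
    and R = ring_module_module[OF K.cring_axioms]
  interpret E: module K E by (fact E)
  interpret P: module K ?P by (rule mP)
  obtain B \<epsilon> where B: "finite B" "B \<subseteq> carrier E" and \<epsilon>: "\<And>b. b \<in> B \<Longrightarrow> \<epsilon> b \<in> carrier (dual K E)"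
    and \<delta>: "\<And>b b'. b \<in> B \<Longrightarrow> b' \<in> B \<Longrightarrow> \<epsilon> b b' = (if b = b' then \<one>\<^bsub>K\<^esub> else \<zero>\<^bsub>K\<^esub>)"
    and expand: "\<And>x. x \<in> carrier E \<Longrightarrow> x = (\<Oplus>\<^bsub>E\<^esub>b\<in>B. \<epsilon> b x \<odot>\<^bsub>E\<^esub> b)"
    by (rule finite_basis_dual[OF E basis]) (rule that)
  define I where "I = {1..d} \<rightarrow>\<^sub>E B"
  have finI: "finite I" unfolding I_def by (intro finite_PiE) (auto simp: B)
  have IB: "i t \<in> B" if "i \<in> I" "t \<in> {1..d}" for i t using that by (auto simp: I_def)
  have IE: "i \<in> {1..d} \<rightarrow> carrier E" and ID: "(\<lambda>t. \<epsilon> (i t)) \<in> {1..d} \<rightarrow> carrier (dual K E)"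
    if "i \<in> I" for i
    using IB[OF that] B \<epsilon> by auto
  have vI: "?v i \<in> carrier ?P" if "i \<in> I" for i by (rule chi_vec_closed[OF E IE[OF that]])
  \<comment> \<open>The product of the coordinates of \<open>x\<close> along \<open>i\<close>: the
    coefficient of the basis product with index \<open>i\<close>. The pairing of \<open>x\<close>
    with the dual product is the \<chi>-weighted sum of these coefficients over the permuted
    tuples.\<close>
  define m where "m i x = (\<Otimes>\<^bsub>K\<^esub>t\<in>{1..d}. \<epsilon> (i t) (x t))" for i x
  have m_ml: "multilinear K E d (ring_module K) (m i)" if "i \<in> I" for i
    unfolding m_def[abs_def]
    by (intro linear_functional_prod_multilinear[OF E] dual_lin funcset_mem[OF ID[OF that]])
  have mc: "m i x \<in> carrier K" if "i \<in> I" "x \<in> {1..d} \<rightarrow> carrier E" for i x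
    using multilinearD(1)[OF m_ml[OF that(1)] that(2)] by simp
  \<comment> \<open>Only spanning is asserted: in the quotient the vectors \<open>?v i\<close> are
    in general linearly dependent.\<close>
  have expand_v: "?v x = (\<Oplus>\<^bsub>?P\<^esub>i\<in>I. m i x \<odot>\<^bsub>?P\<^esub> ?v i)" if x: "x \<in> {1..d} \<rightarrow> carrier E" for x
  proof (rule multilinear_eq_on_basis[OF chi_vec_multilinear[OF E] _ B(2) _ _ x])
    show "multilinear K E d ?P (\<lambda>x. \<Oplus>\<^bsub>?P\<^esub>i\<in>I. m i x \<odot>\<^bsub>?P\<^esub> ?v i)"
      by (intro multilinear_finsum[OF E mP finI] lin_multilinear[OF m_ml] lin_maps_scale[OF mP] vI)
    show "f x = g x" if "f \<in> lin_maps K E ?P" "g \<in> lin_maps K E ?P" "\<And>b. b \<in> B \<Longrightarrow> f b = g b"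
      "x \<in> carrier E" for f g x
      by (rule lin_eq_on_spanning[OF E mP B _ expand[OF that(4)] that(1-3)])
        (rule dual_apply_closed[OF \<epsilon> that(4)])
    fix x assume x: "x \<in> {1..d} \<rightarrow> B"
    \<comment> \<open>\<open>I\<close> consists of extensional tuples, so \<open>x\<close> is
      matched with its restriction \<open>j\<close>; by duality of the bases the summand at
      \<open>j\<close> is the only one that survives.\<close>
    define j where "j = restrict x {1..d}"
    have j: "j \<in> I" using x by (auto simp: j_def I_def)
    have xE: "x \<in> {1..d} \<rightarrow> carrier E" using x B by auto
    have m: "m i x = (if j = i then \<one>\<^bsub>K\<^esub> else \<zero>\<^bsub>K\<^esub>)" if i: "i \<in> I" for i
    proof (cases "j = i")
      case True
      have "m i x = (\<Otimes>\<^bsub>K\<^esub>t\<in>{1..d}. \<one>\<^bsub>K\<^esub>)"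
        unfolding m_def True[symmetric]
        by (intro K.finprod_cong') (auto simp: j_def \<delta>[OF funcset_mem[OF x] funcset_mem[OF x]])
      with True show ?thesis by simp
    next
      case False
      then obtain s where s: "s \<in> {1..d}" "i s \<noteq> x s"
        using i unfolding j_def I_def by (metis PiE_restrict restrict_ext)
      have mc': "\<epsilon> (i t) (x t) \<in> carrier K" if "t \<in> {1..d}" for t
        by (rule dual_apply_closed[OF \<epsilon>[OF IB[OF i that]] funcset_mem[OF xE that]])
      have "m i x = (\<Otimes>\<^bsub>K\<^esub>t\<in>insert s ({1..d} - {s}). \<epsilon> (i t) (x t))"
        using s by (simp add: m_def insert_absorb)
      also have "\<dots> = \<epsilon> (i s) (x s) \<otimes>\<^bsub>K\<^esub> (\<Otimes>\<^bsub>K\<^esub>t\<in>{1..d} - {s}. \<epsilon> (i t) (x t))"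
        using mc' s by (intro K.finprod_insert) auto
      also have "\<epsilon> (i s) (x s) = \<zero>\<^bsub>K\<^esub>"
        using \<delta>[OF IB[OF i s(1)] funcset_mem[OF x s(1)]] s(2) by simp
      also have "\<zero>\<^bsub>K\<^esub> \<otimes>\<^bsub>K\<^esub> (\<Otimes>\<^bsub>K\<^esub>t\<in>{1..d} - {s}. \<epsilon> (i t) (x t)) = \<zero>\<^bsub>K\<^esub>"
        using mc' by (intro K.l_null K.finprod_closed) auto
      finally show ?thesis using False by simp
    qed
    have "(\<Oplus>\<^bsub>?P\<^esub>i\<in>I. m i x \<odot>\<^bsub>?P\<^esub> ?v i) = (\<Oplus>\<^bsub>?P\<^esub>i\<in>I. if j = i then ?v i else \<zero>\<^bsub>?P\<^esub>)"
      using vI by (intro P.finsum_cong') (auto simp: m)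
    also have "\<dots> = ?v j" using j vI finI by (intro P.finsum_singleton) auto
    also have "\<dots> = ?v x" unfolding j_def by (rule multilinearD(2)[OF chi_vec_multilinear[OF E] xE])
    finally show "?v x = (\<Oplus>\<^bsub>?P\<^esub>i\<in>I. m i x \<odot>\<^bsub>?P\<^esub> ?v i)" ..
  qed
  define N where "N = (\<Oplus>\<^bsub>K\<^esub>\<sigma>\<in>W d. \<one>\<^bsub>K\<^esub>)"
  have N: "N \<in> carrier K" unfolding N_def by (intro K.finsum_closed) auto
  define \<Phi> where "\<Phi> u = (\<Oplus>\<^bsub>?P\<^esub>i\<in>I. ?form u (?w (\<lambda>t. \<epsilon> (i t))) \<odot>\<^bsub>?P\<^esub> ?v i)" for u
  note form = bilinear_mapD(1)[OF chi_form_deg_spec(1)[OF E, of d]]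
  have "N \<odot>\<^bsub>?P\<^esub> u = \<Phi> u"
  proof (rule chi_lin_eqI[OF E mP _ _ _ u, symmetric])
    show "\<Phi> \<in> lin_maps K ?P ?P"
      unfolding \<Phi>_def[abs_def]
      by (intro lin_maps_finsum[OF mP mP finI] lin_maps_comp[OF form lin_maps_scale[OF mP]]
          chi_vec_closed[OF D] ID vI)
    show "(\<odot>\<^bsub>?P\<^esub>) N \<in> lin_maps K ?P ?P"
      using lin_maps_smult[OF mP mP _ N, of "\<lambda>x. x"] by (auto simp: lin_maps_def)
    fix x assume x: "x \<in> {1..d} \<rightarrow> carrier E"
    have x\<sigma>: "(\<lambda>t. x (inv' \<sigma> t)) \<in> {1..d} \<rightarrow> carrier E" if "\<sigma> \<in> W d" for \<sigma>
      using x W_inv_in[OF that] by (auto simp: Pi_iff)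
    have "\<Phi> (?v x) = (\<Oplus>\<^bsub>?P\<^esub>i\<in>I. pairing d x (\<lambda>t. \<epsilon> (i t)) \<odot>\<^bsub>?P\<^esub> ?v i)"
      unfolding \<Phi>_def
      by (intro P.finsum_cong')
        (auto simp: chi_form_deg_spec(2)[OF E x ID] intro!: P.smult_closed vI pairing_closed[OF x ID])
    also have "\<dots> = (\<Oplus>\<^bsub>?P\<^esub>i\<in>I. \<Oplus>\<^bsub>?P\<^esub>\<sigma>\<in>W d. (\<chi> d \<sigma> \<otimes>\<^bsub>K\<^esub> m i (\<lambda>t. x (inv' \<sigma> t))) \<odot>\<^bsub>?P\<^esub> ?v i)"
    proof (rule P.finsum_cong')
      fix i assume i: "i \<in> I"
      have c: "(\<lambda>\<sigma>. \<chi> d \<sigma> \<otimes>\<^bsub>K\<^esub> m i (\<lambda>t. x (inv' \<sigma> t))) \<in> W d \<rightarrow> carrier K"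
        using mc[OF i x\<sigma>] by auto
      \<comment> \<open>The scalar sum is read in \<open>ring_module K\<close>, so that multiplying
        \<open>?v i\<close> by it is a linear map applied to a finite sum.\<close>
      have "pairing d x (\<lambda>t. \<epsilon> (i t)) \<odot>\<^bsub>?P\<^esub> ?v i =
          (\<Oplus>\<^bsub>ring_module K\<^esub>\<sigma>\<in>W d. \<chi> d \<sigma> \<otimes>\<^bsub>K\<^esub> m i (\<lambda>t. x (inv' \<sigma> t))) \<odot>\<^bsub>?P\<^esub> ?v i"
        by (simp add: pairing_def m_def)
      also have "\<dots> = (\<Oplus>\<^bsub>?P\<^esub>\<sigma>\<in>W d. (\<chi> d \<sigma> \<otimes>\<^bsub>K\<^esub> m i (\<lambda>t. x (inv' \<sigma> t))) \<odot>\<^bsub>?P\<^esub> ?v i)"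
        using c by (intro lin_finsum[OF R mP lin_maps_scale[OF mP vI[OF i]] finite_W]) auto
      finally show "pairing d x (\<lambda>t. \<epsilon> (i t)) \<odot>\<^bsub>?P\<^esub> ?v i = \<dots>" .
    qed (auto intro!: P.finsum_closed P.smult_closed vI K.m_closed mc x\<sigma>)
    also have "\<dots> = (\<Oplus>\<^bsub>?P\<^esub>\<sigma>\<in>W d. \<Oplus>\<^bsub>?P\<^esub>i\<in>I. (\<chi> d \<sigma> \<otimes>\<^bsub>K\<^esub> m i (\<lambda>t. x (inv' \<sigma> t))) \<odot>\<^bsub>?P\<^esub> ?v i)"
      by (intro P.finsum_swap finI finite_W P.smult_closed vI K.m_closed mc x\<sigma> chi_closed)
    also have "\<dots> = (\<Oplus>\<^bsub>?P\<^esub>\<sigma>\<in>W d. \<one>\<^bsub>K\<^esub> \<odot>\<^bsub>?P\<^esub> ?v x)"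
    proof (rule P.finsum_cong')
      fix \<sigma> assume \<sigma>: "\<sigma> \<in> W d"
      have "(\<Oplus>\<^bsub>?P\<^esub>i\<in>I. (\<chi> d \<sigma> \<otimes>\<^bsub>K\<^esub> m i (\<lambda>t. x (inv' \<sigma> t))) \<odot>\<^bsub>?P\<^esub> ?v i) =
          (\<Oplus>\<^bsub>?P\<^esub>i\<in>I. \<chi> d \<sigma> \<odot>\<^bsub>?P\<^esub> (m i (\<lambda>t. x (inv' \<sigma> t)) \<odot>\<^bsub>?P\<^esub> ?v i))"
        using \<sigma> mc[OF _ x\<sigma>[OF \<sigma>]] vI by (intro P.finsum_cong') (auto simp: P.smult_assoc1)
      also have "\<dots> = \<chi> d \<sigma> \<odot>\<^bsub>?P\<^esub> ?v (\<lambda>t. x (inv' \<sigma> t))"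
        unfolding expand_v[OF x\<sigma>[OF \<sigma>]] using \<sigma> mc[OF _ x\<sigma>[OF \<sigma>]] vI
        by (intro P.finsum_smult_ldistr[symmetric] finI) auto
      also have "\<dots> = (\<chi> d \<sigma> \<otimes>\<^bsub>K\<^esub> inv\<^bsub>K\<^esub> \<chi> d \<sigma>) \<odot>\<^bsub>?P\<^esub> ?v x"
        using \<sigma> chi_vec_closed[OF E x]
        by (simp add: chi_multilinearD(2)[OF chi_vec_chi_multilinear[OF E] \<sigma> x] P.smult_assoc1)
      also have "\<chi> d \<sigma> \<otimes>\<^bsub>K\<^esub> inv\<^bsub>K\<^esub> \<chi> d \<sigma> = \<one>\<^bsub>K\<^esub>" using chi_Units[OF \<sigma>] by simp
      finally show "(\<Oplus>\<^bsub>?P\<^esub>i\<in>I. (\<chi> d \<sigma> \<otimes>\<^bsub>K\<^esub> m i (\<lambda>t. x (inv' \<sigma> t))) \<odot>\<^bsub>?P\<^esub> ?v i) =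
        \<one>\<^bsub>K\<^esub> \<odot>\<^bsub>?P\<^esub> ?v x" .
    qed (use chi_vec_closed[OF E x] in auto)
    also have "\<dots> = (\<Oplus>\<^bsub>ring_module K\<^esub>\<sigma>\<in>W d. \<one>\<^bsub>K\<^esub>) \<odot>\<^bsub>?P\<^esub> ?v x"
      by (intro lin_finsum[OF R mP lin_maps_scale[OF mP chi_vec_closed[OF E x]] finite_W, symmetric])
        auto
    finally show "\<Phi> (?v x) = N \<odot>\<^bsub>?P\<^esub> ?v x" by (simp add: N_def)
  qed
  also have "\<Phi> u = \<zero>\<^bsub>?P\<^esub>"
    unfolding \<Phi>_def by (intro P.add.finprod_one_eqI) (simp add: 0[OF ID] vI)
  finally have Nu: "N \<odot>\<^bsub>?P\<^esub> u = \<zero>\<^bsub>?P\<^esub>" .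
  obtain c where c: "c \<in> carrier K" "c \<otimes>\<^bsub>K\<^esub> N = \<one>\<^bsub>K\<^esub>"
    using contains_rationals_card_unit[OF K.cring_axioms rat finite_W] W_id
    unfolding N_def by blast
  have "u = (c \<otimes>\<^bsub>K\<^esub> N) \<odot>\<^bsub>?P\<^esub> u" using c u by simp
  also have "\<dots> = \<zero>\<^bsub>?P\<^esub>" using c(1) N u by (simp add: P.smult_assoc1 Nu)
  finally show ?thesis .
qed

end

section \<open>Minimal coset representatives and the product formula\<close>

lemma (in abelian_monoid) finsum_Times:
  assumes "finite A" "finite B" "\<And>i j. i \<in> A \<Longrightarrow> j \<in> B \<Longrightarrow> f i j \<in> carrier G"
  shows "finsum G (\<lambda>(i, j). f i j) (A \<times> B) = (\<Oplus>i\<in>A. \<Oplus>j\<in>B. f i j)"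
  using assms(1,3)
proof (induction A rule: finite_induct)
  case (insert a A)
  have "insert a A \<times> B = Pair a ` B \<union> A \<times> B" by auto
  moreover have "finsum G (\<lambda>(i, j). f i j) (Pair a ` B \<union> A \<times> B) =
      finsum G (\<lambda>(i, j). f i j) (Pair a ` B) \<oplus> finsum G (\<lambda>(i, j). f i j) (A \<times> B)"
    using insert assms(2) by (intro finsum_Un_disjoint) auto
  moreover have "finsum G (\<lambda>(i, j). f i j) (Pair a ` B) = (\<Oplus>j\<in>B. f a j)"
    using insert by (subst finsum_reindex) (auto simp: inj_on_def)
  moreover have "(\<Oplus>i\<in>insert a A. \<Oplus>j\<in>B. f i j) = (\<Oplus>j\<in>B. f a j) \<oplus> (\<Oplus>i\<in>A. \<Oplus>j\<in>B. f i j)"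
    using insert by (intro finsum_insert) (auto intro!: finsum_closed)
  ultimately show ?case using insert by simp
qed simp

lemma (in abelian_monoid) finsum_eq_single:
  assumes "finite A" "d \<in> A" "f d \<in> carrier G" "\<And>i. i \<in> A \<Longrightarrow> i \<noteq> d \<Longrightarrow> f i = \<zero>"
  shows "(\<Oplus>i\<in>A. f i) = f d"
proof -
  have "(\<Oplus>i\<in>A. f i) = (\<Oplus>i\<in>A. if d = i then f d else \<zero>)"
    using assms(3,4) by (intro finsum_cong') auto
  also have "\<dots> = f d"
    using finsum_singleton[OF assms(2,1), of "\<lambda>_. f d"] assms(3) by simp
  finally show ?thesis .
qed

lemma finite_has_lexordp_min:
  fixes w :: "'a \<Rightarrow> nat list"
  assumes "finite A" "A \<noteq> {}"
  shows "\<exists>m\<in>A. \<forall>x\<in>A. ord_class.lexordp_eq (w m) (w x)"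
  using assms
proof (induction A rule: finite_ne_induct)
  case (singleton x)
  show ?case by (simp add: lexordp_eq_refl)
next
  case (insert x A)
  then obtain m where m: "m \<in> A" "\<And>y. y \<in> A \<Longrightarrow> ord_class.lexordp_eq (w m) (w y)" by blast
  show ?case
  proof (cases "ord_class.lexordp_eq (w m) (w x)")
    case True
    with m show ?thesis by auto
  next
    case False
    then have "ord_class.lexordp_eq (w x) (w m)" using lexordp_eq_linear by blast
    then have "ord_class.lexordp_eq (w x) (w y)" if "y \<in> A" for y
      using m(2)[OF that] by (rule lexordp_eq_trans)
    then show ?thesis by (auto simp: lexordp_eq_refl)
  qed
qed

text \<open>Outside \<open>{1..n}\<close> both permutations are the identity, so the word loses
  nothing. This converts antisymmetry of the lexicographic order on words into uniqueness of the
  minimal representative.\<close>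

lemma word_inj:
  assumes "\<rho> permutes {1..n}" "\<rho>' permutes {1..n}" "word n \<rho> = word n \<rho>'"
  shows "\<rho> = \<rho>'"
proof
  fix t
  show "\<rho> t = \<rho>' t"
  proof (cases "t \<in> {1..n}")
    case True
    then have "t \<in> set [1..<Suc n]" by auto
    then show ?thesis using assms(3) by (simp only: word_def map_eq_conv)
  next
    case False
    show ?thesis by (simp only: permutes_not_in[OF assms(1) False] permutes_not_in[OF assms(2) False])
  qed
qed

section \<open>Unique factorisation along the minimal representatives\<close>

context invariant_chars
begin

text \<open>The general element of the subgroup \<open>X\<close>: \<open>\<sigma>\<close> permutes
  the first \<open>p\<close> places and the shifted \<open>\<tau>\<close> the following
  \<open>h\<close>.\<close>

definition block :: "nat \<Rightarrow> (nat \<Rightarrow> nat) \<Rightarrow> (nat \<Rightarrow> nat) \<Rightarrow> nat \<Rightarrow> nat" where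
  "block p \<sigma> \<tau> = \<sigma> \<circ> (omega ^^ p) \<tau>"

lemma young_subgroup_eq: "young_subgroup W p h = {block p \<sigma> \<tau> | \<sigma> \<tau>. \<sigma> \<in> W p \<and> \<tau> \<in> W h}"
  by (simp add: young_subgroup_def block_def)

lemma W_pos: "\<sigma> \<in> W d \<Longrightarrow> t \<noteq> 0 \<Longrightarrow> \<sigma> t \<noteq> 0"
  using W_bij W_zero by (metis bij_def inj_eq)

lemma W_fix: "\<sigma> \<in> W d \<Longrightarrow> d < t \<Longrightarrow> \<sigma> t = t"
  using permutes_not_in[OF W_permutes] by simp

lemma W_le: "\<sigma> \<in> W d \<Longrightarrow> t \<le> d \<Longrightarrow> \<sigma> t \<le> d"
  using W_in[of \<sigma> d t] W_zero[of \<sigma> d] by (cases "t = 0") auto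

lemma block_apply:
  assumes "\<sigma> \<in> W p" "\<tau> \<in> W h"
  shows "block p \<sigma> \<tau> t = (if t \<le> p then \<sigma> t else \<tau> (t - p) + p)"
proof -
  have "\<sigma> (\<tau> (t - p) + p) = \<tau> (t - p) + p" if "p < t"
    using W_pos[OF assms(2), of "t - p"] that by (intro W_fix[OF assms(1)]) simp
  then show ?thesis
    by (simp add: block_def omega_pow_apply[where \<sigma> = \<tau>, OF W_zero[OF assms(2)]])
qed

lemma block_W:
  assumes "\<sigma> \<in> W p" "\<tau> \<in> W h"
  shows "block p \<sigma> \<tau> \<in> W (p + h)"
    and "\<chi> (p + h) (block p \<sigma> \<tau>) = \<chi> p \<sigma> \<otimes>\<^bsub>K\<^esub> \<chi> h \<tau>"
proof -
  note s = W_mono[OF assms(1), of h] omega_pow_W[OF assms(2), of p]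
  show "block p \<sigma> \<tau> \<in> W (p + h)"
    unfolding block_def using s by (auto simp: add.commute intro: W_comp)
  show "\<chi> (p + h) (block p \<sigma> \<tau>) = \<chi> p \<sigma> \<otimes>\<^bsub>K\<^esub> \<chi> h \<tau>"
    unfolding block_def using s by (simp add: add.commute chi_comp)
qed

text \<open>The two parts act on disjoint sets of places and do not interfere. Together with
  \<open>block_id\<close> and \<open>block_inj\<close> this makes \<open>X\<close> the direct
  product of \<open>W p\<close> and \<open>W h\<close>.\<close>

lemma block_comp:
  assumes "\<sigma> \<in> W p" "\<tau> \<in> W h" "\<sigma>' \<in> W p" "\<tau>' \<in> W h"
  shows "block p \<sigma> \<tau> \<circ> block p \<sigma>' \<tau>' = block p (\<sigma> \<circ> \<sigma>') (\<tau> \<circ> \<tau>')"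
proof
  fix t
  show "(block p \<sigma> \<tau> \<circ> block p \<sigma>' \<tau>') t = block p (\<sigma> \<circ> \<sigma>') (\<tau> \<circ> \<tau>') t"
    using W_pos[OF assms(4), of "t - p"] W_le[OF assms(3), of t]
    by (auto simp: block_apply[OF assms(1,2)] block_apply[OF assms(3,4)]
        block_apply[OF W_comp[OF assms(1,3)] W_comp[OF assms(2,4)]])
qed

lemma block_id: "block p id id = id"
  by (auto simp: fun_eq_iff block_apply[OF W_id[of p] W_id[of p]])

lemma block_inj:
  assumes "\<sigma> \<in> W p" "\<tau> \<in> W h" "\<sigma>' \<in> W p" "\<tau>' \<in> W h" "block p \<sigma> \<tau> = block p \<sigma>' \<tau>'"
  shows "\<sigma> = \<sigma>' \<and> \<tau> = \<tau>'"
proof -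
  have eq: "(if t \<le> p then \<sigma> t else \<tau> (t - p) + p) = (if t \<le> p then \<sigma>' t else \<tau>' (t - p) + p)" for t
    using fun_cong[OF assms(5), of t]
    by (simp only: block_apply[OF assms(1,2)] block_apply[OF assms(3,4)])
  have "\<sigma> t = \<sigma>' t" for t
    using eq[of t] W_fix[OF assms(1), of t] W_fix[OF assms(3), of t] by (cases "t \<le> p") auto
  moreover have "\<tau> t = \<tau>' t" for t
    using eq[of "t + p"] W_zero[OF assms(2)] W_zero[OF assms(4)] by (cases "t = 0") auto
  ultimately show ?thesis by auto
qed

lemma min_reps_iff:
  "\<rho> \<in> min_reps W n p h \<longleftrightarrow> \<rho> \<in> W n \<and> (\<forall>\<sigma>\<in>W p. \<forall>\<tau>\<in>W h.
    ord_class.lexordp_eq (word n \<rho>) (word n (\<rho> \<circ> block p \<sigma> \<tau>)))"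
  by (auto simp: min_reps_def l_coset_def young_subgroup_eq sym_group_def)

text \<open>A coset is finite and so contains an element with least word, which gives surjectivity.
  Two minimal representatives of one coset have words below each other and hence coincide;
  cancelling them leaves an equation between blocks, and \<open>block_inj\<close> settles the
  remaining factors.\<close>

lemma min_reps_bij:
  "bij_betw (\<lambda>(\<rho>, \<sigma>, \<tau>). \<rho> \<circ> block p \<sigma> \<tau>) (min_reps W (p + h) p h \<times> W p \<times> W h) (W (p + h))"
proof (rule bij_betwI')
  fix x y assume "x \<in> min_reps W (p + h) p h \<times> W p \<times> W h" "y \<in> min_reps W (p + h) p h \<times> W p \<times> W h"
  then obtain \<rho> \<sigma> \<tau> \<rho>' \<sigma>' \<tau>' where x: "x = (\<rho>, \<sigma>, \<tau>)" and y: "y = (\<rho>', \<sigma>', \<tau>')"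
    and \<rho>: "\<rho> \<in> min_reps W (p + h) p h" "\<rho>' \<in> min_reps W (p + h) p h"
    and W: "\<sigma> \<in> W p" "\<tau> \<in> W h" "\<sigma>' \<in> W p" "\<tau>' \<in> W h" by (cases x, cases y) auto
  \<comment> \<open>Equality of the products places \<open>\<rho>'\<close> in the coset of
    \<open>\<rho>\<close>, which gives one of two inequalities; the other is the same statement with
    the roles exchanged.\<close>
  have le: "ord_class.lexordp_eq (word (p + h) \<rho>) (word (p + h) \<rho>')"
    if "\<rho> \<in> min_reps W (p + h) p h" "\<sigma> \<in> W p" "\<tau> \<in> W h" "\<sigma>' \<in> W p" "\<tau>' \<in> W h"
      "\<rho> \<circ> block p \<sigma> \<tau> = \<rho>' \<circ> block p \<sigma>' \<tau>'" for \<rho> \<sigma> \<tau> \<rho>' \<sigma>' \<tau>'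
  proof -
    note i = W_inv[OF that(4)] W_inv[OF that(5)]
    have "\<rho>' = \<rho>' \<circ> block p (\<sigma>' \<circ> inv' \<sigma>') (\<tau>' \<circ> inv' \<tau>')"
      using W_bij[OF that(4)] W_bij[OF that(5)]
      by (simp add: bij_is_surj surj_iff[THEN iffD1] block_id)
    also have "\<dots> = (\<rho>' \<circ> block p \<sigma>' \<tau>') \<circ> block p (inv' \<sigma>') (inv' \<tau>')"
      by (simp only: comp_assoc block_comp[OF that(4,5) i])
    also have "\<dots> = \<rho> \<circ> block p (\<sigma> \<circ> inv' \<sigma>') (\<tau> \<circ> inv' \<tau>')"
      unfolding that(6)[symmetric] by (simp only: comp_assoc block_comp[OF that(2,3) i])
    finally show ?thesis
      using that(1) W_comp[OF that(2) i(1)] W_comp[OF that(3) i(2)] unfolding min_reps_iff by metis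
  qed
  show "((case x of (\<rho>, \<sigma>, \<tau>) \<Rightarrow> \<rho> \<circ> block p \<sigma> \<tau>) = (case y of (\<rho>, \<sigma>, \<tau>) \<Rightarrow> \<rho> \<circ> block p \<sigma> \<tau>)) = (x = y)"
  proof
    assume "(case x of (\<rho>, \<sigma>, \<tau>) \<Rightarrow> \<rho> \<circ> block p \<sigma> \<tau>) = (case y of (\<rho>, \<sigma>, \<tau>) \<Rightarrow> \<rho> \<circ> block p \<sigma> \<tau>)"
    then have eq: "\<rho> \<circ> block p \<sigma> \<tau> = \<rho>' \<circ> block p \<sigma>' \<tau>'" by (simp add: x y)
    have "word (p + h) \<rho> = word (p + h) \<rho>'"
      using le[OF \<rho>(1) W eq] le[OF \<rho>(2) W(3,4,1,2) eq[symmetric]] by (rule lexordp_eq_antisym)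
    moreover have \<rho>W: "\<rho> \<in> W (p + h)" "\<rho>' \<in> W (p + h)" using \<rho> by (auto simp: min_reps_iff)
    ultimately have \<rho>\<rho>: "\<rho> = \<rho>'" using word_inj W_permutes by blast
    have "block p \<sigma> \<tau> = block p \<sigma>' \<tau>'"
      using eq W_bij[OF \<rho>W(1)] unfolding \<rho>\<rho>[symmetric]
      by (metis (no_types, lifting) bij_is_inj comp_assoc id_comp inv_o_cancel)
    with block_inj[OF W] show "x = y" by (simp add: x y \<rho>\<rho>)
  qed simp
next
  fix x assume "x \<in> min_reps W (p + h) p h \<times> W p \<times> W h"
  then show "(case x of (\<rho>, \<sigma>, \<tau>) \<Rightarrow> \<rho> \<circ> block p \<sigma> \<tau>) \<in> W (p + h)"
    by (auto simp: min_reps_iff intro!: W_comp block_W)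
next
  fix \<pi> assume \<pi>: "\<pi> \<in> W (p + h)"
  \<comment> \<open>\<open>?S\<close> is the coset of \<open>\<pi>\<close>. The least element
    \<open>\<rho>\<close> found in it is minimal in its own coset because, by
    \<open>block_comp\<close>, further blocks do not lead out of \<open>?S\<close>.\<close>
  let ?S = "(\<lambda>(\<sigma>, \<tau>). \<pi> \<circ> block p \<sigma> \<tau>) ` (W p \<times> W h)"
  have "finite ?S" "?S \<noteq> {}" using finite_W W_id by auto
  from finite_has_lexordp_min[OF this, of "word (p + h)"] obtain \<sigma> \<tau>
    where W: "\<sigma> \<in> W p" "\<tau> \<in> W h" and min: "\<And>\<sigma>' \<tau>'. \<sigma>' \<in> W p \<Longrightarrow> \<tau>' \<in> W h \<Longrightarrow>
      ord_class.lexordp_eq (word (p + h) (\<pi> \<circ> block p \<sigma> \<tau>)) (word (p + h) (\<pi> \<circ> block p \<sigma>' \<tau>'))"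
    by auto
  define \<rho> where "\<rho> = \<pi> \<circ> block p \<sigma> \<tau>"
  have "\<rho> \<in> min_reps W (p + h) p h"
    unfolding min_reps_iff \<rho>_def comp_assoc
  proof (intro conjI ballI)
    show "\<pi> \<circ> block p \<sigma> \<tau> \<in> W (p + h)" by (intro W_comp \<pi> block_W W)
    fix \<sigma>' \<tau>' assume W': "\<sigma>' \<in> W p" "\<tau>' \<in> W h"
    show "ord_class.lexordp_eq (word (p + h) (\<pi> \<circ> block p \<sigma> \<tau>))
        (word (p + h) (\<pi> \<circ> (block p \<sigma> \<tau> \<circ> block p \<sigma>' \<tau>')))"
      unfolding block_comp[OF W W'] by (intro min W_comp W W')
  qed
  moreover have "\<pi> = \<rho> \<circ> block p (inv' \<sigma>) (inv' \<tau>)"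
    unfolding \<rho>_def comp_assoc block_comp[OF W W_inv[OF W(1)] W_inv[OF W(2)]]
    using W_bij[OF W(1)] W_bij[OF W(2)]
    by (simp add: bij_is_surj surj_iff[THEN iffD1] block_id)
  ultimately show "\<exists>x\<in>min_reps W (p + h) p h \<times> W p \<times> W h. \<pi> = (case x of (\<rho>, \<sigma>, \<tau>) \<Rightarrow> \<rho> \<circ> block p \<sigma> \<tau>)"
    using W_inv W by (intro bexI[of _ "(\<rho>, inv' \<sigma>, inv' \<tau>)"]) auto
qed

section \<open>The pairing with a product of forms\<close>

lemma min_reps_subset: "min_reps W n p h \<subseteq> W n"
  by (auto simp: min_reps_def)

text \<open>Inverting the summation index replaces the character by its inverse, which is the
  character again. In this form the permutation is composed directly with the tuple, as a
  factorisation \<open>\<rho> \<circ> block p \<sigma> \<tau>\<close> taken from left cosets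
  requires.\<close>

lemma pairing_inv:
  assumes x: "x \<in> {1..d} \<rightarrow> carrier E" and y: "y \<in> {1..d} \<rightarrow> carrier (dual K E)"
  shows "pairing d x y = (\<Oplus>\<^bsub>K\<^esub>\<sigma>\<in>W d. \<chi> d \<sigma> \<otimes>\<^bsub>K\<^esub> (\<Otimes>\<^bsub>K\<^esub>t\<in>{1..d}. y t (x (\<sigma> t))))"
proof -
  let ?F = "\<lambda>\<sigma>. \<chi> d \<sigma> \<otimes>\<^bsub>K\<^esub> (\<Otimes>\<^bsub>K\<^esub>t\<in>{1..d}. y t (x (\<sigma> t)))"
  have F: "?F \<sigma> \<in> carrier K" if "\<sigma> \<in> W d" for \<sigma>
    using pairing_term_closed[OF x y, of "\<lambda>t. t" \<sigma>] W_in[OF that] that by auto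
  have inv_inv: "inv' (inv' \<sigma>) = \<sigma>" if "\<sigma> \<in> W d" for \<sigma> using inv_inv_eq[OF W_bij[OF that]] .
  have "bij_betw inv' (W d) (W d)"
    by (rule bij_betwI[where g = inv']) (auto simp: inv_inv W_inv)
  then have im: "inv' ` W d = W d" and inj: "inj_on inv' (W d)" by (auto simp: bij_betw_def)
  have "(\<Oplus>\<^bsub>K\<^esub>\<sigma>\<in>inv' ` W d. ?F \<sigma>) = (\<Oplus>\<^bsub>K\<^esub>\<sigma>\<in>W d. ?F (inv' \<sigma>))"
    using F inj by (intro K.finsum_reindex) (auto simp: im)
  also have "\<dots> = pairing d x y"
    unfolding pairing_def
  proof (rule K.finsum_cong')
    show "(\<lambda>\<sigma>. \<chi> d \<sigma> \<otimes>\<^bsub>K\<^esub> (\<Otimes>\<^bsub>K\<^esub>t\<in>{1..d}. y t (x (inv' \<sigma> t)))) \<in> W d \<rightarrow> carrier K"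
      using F[OF W_inv] by (auto simp: chi_inv inv_chi)
  qed (simp_all add: chi_inv inv_chi)
  finally show ?thesis by (simp add: im)
qed

lemma prod_juxt_block:
  assumes x: "x \<in> {1..p + h} \<rightarrow> carrier E" and y: "y \<in> {1..p} \<rightarrow> carrier (dual K E)"
    and z: "z \<in> {1..h} \<rightarrow> carrier (dual K E)" and \<sigma>: "\<sigma> \<in> W p" and \<tau>: "\<tau> \<in> W h"
  shows "(\<Otimes>\<^bsub>K\<^esub>t\<in>{1..p + h}. juxt p y z t (x (block p \<sigma> \<tau> t))) =
    (\<Otimes>\<^bsub>K\<^esub>t\<in>{1..p}. y t (x (\<sigma> t))) \<otimes>\<^bsub>K\<^esub> (\<Otimes>\<^bsub>K\<^esub>t\<in>{1..h}. z t (x (p + \<tau> t)))"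
proof -
  let ?g = "\<lambda>t. juxt p y z t (x (block p \<sigma> \<tau> t))"
  have g: "?g t \<in> carrier K" if t: "t \<in> {1..p + h}" for t
    by (rule dual_apply_closed[OF funcset_mem[OF juxt_in[OF y z] t]
          funcset_mem[OF x W_in[OF block_W(1)[OF \<sigma> \<tau>] t]]])
  have split: "{1..p + h} = {1..p} \<union> (\<lambda>t. p + t) ` {1..h}" by (auto simp: image_iff)
  have "(\<Otimes>\<^bsub>K\<^esub>t\<in>{1..p + h}. ?g t) =
      (\<Otimes>\<^bsub>K\<^esub>t\<in>{1..p}. ?g t) \<otimes>\<^bsub>K\<^esub> (\<Otimes>\<^bsub>K\<^esub>t\<in>(\<lambda>t. p + t) ` {1..h}. ?g t)"
    unfolding split using g by (intro K.finprod_Un_disjoint) (auto simp: split)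
  also have "(\<Otimes>\<^bsub>K\<^esub>t\<in>(\<lambda>t. p + t) ` {1..h}. ?g t) = (\<Otimes>\<^bsub>K\<^esub>t\<in>{1..h}. ?g (p + t))"
    using g by (intro K.finprod_reindex) (auto simp: split inj_on_def)
  also have "\<dots> = (\<Otimes>\<^bsub>K\<^esub>t\<in>{1..h}. z t (x (p + \<tau> t)))"
  proof (rule K.finprod_cong')
    fix t assume t: "t \<in> {1..h}"
    then show "?g (p + t) = z t (x (p + \<tau> t))"
      by (simp add: juxt_def block_apply[OF \<sigma> \<tau>] add.commute)
  next
    show "(\<lambda>t. z t (x (p + \<tau> t))) \<in> {1..h} \<rightarrow> carrier K"
    proof
      fix t assume t: "t \<in> {1..h}"
      have "p + \<tau> t \<in> {1..p + h}" using W_in[OF \<tau> t] by auto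
      then show "z t (x (p + \<tau> t)) \<in> carrier K"
        by (rule dual_apply_closed[OF funcset_mem[OF z t] funcset_mem[OF x]])
    qed
  qed simp
  also have "(\<Otimes>\<^bsub>K\<^esub>t\<in>{1..p}. ?g t) = (\<Otimes>\<^bsub>K\<^esub>t\<in>{1..p}. y t (x (\<sigma> t)))"
  proof (rule K.finprod_cong')
    fix t assume t: "t \<in> {1..p}"
    then show "?g t = y t (x (\<sigma> t))"
      by (simp add: juxt_def block_apply[OF \<sigma> \<tau>])
  next
    show "(\<lambda>t. y t (x (\<sigma> t))) \<in> {1..p} \<rightarrow> carrier K"
    proof
      fix t assume t: "t \<in> {1..p}"
      have "\<sigma> t \<in> {1..p + h}" using W_in[OF \<sigma> t] by auto
      then show "y t (x (\<sigma> t)) \<in> carrier K"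
        by (rule dual_apply_closed[OF funcset_mem[OF y t] funcset_mem[OF x]])
    qed
  qed simp
  finally show ?thesis .
qed

lemma pairing_juxt:
  assumes x: "x \<in> {1..p + h} \<rightarrow> carrier E" and y: "y \<in> {1..p} \<rightarrow> carrier (dual K E)"
    and z: "z \<in> {1..h} \<rightarrow> carrier (dual K E)"
  shows "pairing (p + h) x (juxt p y z) =
    (\<Oplus>\<^bsub>K\<^esub>\<rho>\<in>min_reps W (p + h) p h.
      (\<chi> (p + h) \<rho> \<otimes>\<^bsub>K\<^esub> pairing p (\<lambda>t. x (\<rho> t)) y) \<otimes>\<^bsub>K\<^esub> pairing h (\<lambda>t. x (\<rho> (p + t))) z)"
proof -
  let ?M = "min_reps W (p + h) p h"
  have finM: "finite ?M" by (rule finite_subset[OF min_reps_subset finite_W])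
  define F where "F \<pi> = \<chi> (p + h) \<pi> \<otimes>\<^bsub>K\<^esub> (\<Otimes>\<^bsub>K\<^esub>t\<in>{1..p + h}. juxt p y z t (x (\<pi> t)))" for \<pi>
  have F: "F \<pi> \<in> carrier K" if "\<pi> \<in> W (p + h)" for \<pi>
    unfolding F_def
    using pairing_term_closed[OF x juxt_in[OF y z], of "\<lambda>t. t" \<pi>] W_in[OF that] that by auto
  define \<Psi> :: "(nat \<Rightarrow> nat) \<times> (nat \<Rightarrow> nat) \<times> (nat \<Rightarrow> nat) \<Rightarrow> nat \<Rightarrow> nat"
    where "\<Psi> = (\<lambda>(\<rho>, \<sigma>, \<tau>). \<rho> \<circ> block p \<sigma> \<tau>)"
  have \<Psi>: "\<Psi> ` (?M \<times> W p \<times> W h) = W (p + h)" "inj_on \<Psi> (?M \<times> W p \<times> W h)"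
    using min_reps_bij by (auto simp: bij_betw_def \<Psi>_def)
  have FM: "F (\<rho> \<circ> block p \<sigma> \<tau>) \<in> carrier K" if "\<rho> \<in> ?M" "\<sigma> \<in> W p" "\<tau> \<in> W h" for \<rho> \<sigma> \<tau>
    using that min_reps_subset by (intro F W_comp block_W) auto
  have "pairing (p + h) x (juxt p y z) = (\<Oplus>\<^bsub>K\<^esub>\<pi>\<in>\<Psi> ` (?M \<times> W p \<times> W h). F \<pi>)"
    unfolding pairing_inv[OF x juxt_in[OF y z]] \<Psi>(1) by (simp add: F_def)
  also have "\<dots> = (\<Oplus>\<^bsub>K\<^esub>i\<in>?M \<times> W p \<times> W h. F (\<Psi> i))"
    using \<Psi> F by (intro K.finsum_reindex) auto
  also have "\<dots> = finsum K (\<lambda>(\<rho>, j). F (\<Psi> (\<rho>, j))) (?M \<times> (W p \<times> W h))"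
    by (rule arg_cong2[where f = "finsum K"]) auto
  also have "\<dots> = (\<Oplus>\<^bsub>K\<^esub>\<rho>\<in>?M. \<Oplus>\<^bsub>K\<^esub>j\<in>W p \<times> W h. F (\<Psi> (\<rho>, j)))"
    using FM finite_W finM by (intro K.finsum_Times) (auto simp: \<Psi>_def)
  also have "\<dots> = (\<Oplus>\<^bsub>K\<^esub>\<rho>\<in>?M. (\<chi> (p + h) \<rho> \<otimes>\<^bsub>K\<^esub> pairing p (\<lambda>t. x (\<rho> t)) y) \<otimes>\<^bsub>K\<^esub>
      pairing h (\<lambda>t. x (\<rho> (p + t))) z)"
  proof (rule K.finsum_cong')
    fix \<rho> assume \<rho>M: "\<rho> \<in> ?M"
    then have \<rho>: "\<rho> \<in> W (p + h)" using min_reps_subset by auto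
    \<comment> \<open>The tuple is first rearranged by \<open>\<rho>\<close>. Its first
      \<open>p\<close> entries meet the forms \<open>y\<close>; the next \<open>h\<close>,
      renumbered from one as \<open>x2\<close>, meet the forms \<open>z\<close>.\<close>
    define x1 where "x1 = (\<lambda>t. x (\<rho> t))"
    define x2 where "x2 = (\<lambda>t. x1 (p + t))"
    have x1: "x1 \<in> {1..p + h} \<rightarrow> carrier E"
      unfolding x1_def by (intro Pi_I funcset_mem[OF x] W_in[OF \<rho>])
    then have x1p: "x1 \<in> {1..p} \<rightarrow> carrier E" and x2: "x2 \<in> {1..h} \<rightarrow> carrier E"
      by (auto simp: x2_def Pi_iff)
    define A where "A \<sigma> = \<chi> p \<sigma> \<otimes>\<^bsub>K\<^esub> (\<Otimes>\<^bsub>K\<^esub>t\<in>{1..p}. y t (x1 (\<sigma> t)))" for \<sigma>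
    define B where "B \<tau> = \<chi> h \<tau> \<otimes>\<^bsub>K\<^esub> (\<Otimes>\<^bsub>K\<^esub>t\<in>{1..h}. z t (x2 (\<tau> t)))" for \<tau>
    have P1: "(\<Otimes>\<^bsub>K\<^esub>t\<in>{1..p}. y t (x1 (\<sigma> t))) \<in> carrier K" if "\<sigma> \<in> W p" for \<sigma>
      using pairing_term_closed[OF x1p y, of "\<lambda>t. t" \<sigma>] W_in[OF that] by auto
    have P2: "(\<Otimes>\<^bsub>K\<^esub>t\<in>{1..h}. z t (x2 (\<tau> t))) \<in> carrier K" if "\<tau> \<in> W h" for \<tau>
      using pairing_term_closed[OF x2 z, of "\<lambda>t. t" \<tau>] W_in[OF that] by auto
    have A: "A \<sigma> \<in> carrier K" if "\<sigma> \<in> W p" for \<sigma> unfolding A_def using P1 that by simp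
    have B: "B \<tau> \<in> carrier K" if "\<tau> \<in> W h" for \<tau> unfolding B_def using P2 that by simp
    have sums: "pairing p x1 y = (\<Oplus>\<^bsub>K\<^esub>\<sigma>\<in>W p. A \<sigma>)" "pairing h x2 z = (\<Oplus>\<^bsub>K\<^esub>\<tau>\<in>W h. B \<tau>)"
      unfolding pairing_inv[OF x1p y] pairing_inv[OF x2 z] A_def B_def by simp_all
    have sc: "pairing p x1 y \<in> carrier K" "pairing h x2 z \<in> carrier K"
      by (rule pairing_closed[OF x1p y], rule pairing_closed[OF x2 z])
    \<comment> \<open>Commutativity of \<open>K\<close> collects what depends on
      \<open>\<sigma>\<close> and what depends on \<open>\<tau>\<close> into separate factors, which
      lets the double sum split into a product of sums.\<close>
    have FAB: "F (\<Psi> (\<rho>, \<sigma>, \<tau>)) = \<chi> (p + h) \<rho> \<otimes>\<^bsub>K\<^esub> (A \<sigma> \<otimes>\<^bsub>K\<^esub> B \<tau>)"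
      if \<sigma>: "\<sigma> \<in> W p" and \<tau>: "\<tau> \<in> W h" for \<sigma> \<tau>
    proof -
      have "F (\<Psi> (\<rho>, \<sigma>, \<tau>)) = (\<chi> (p + h) \<rho> \<otimes>\<^bsub>K\<^esub> (\<chi> p \<sigma> \<otimes>\<^bsub>K\<^esub> \<chi> h \<tau>)) \<otimes>\<^bsub>K\<^esub>
          (\<Otimes>\<^bsub>K\<^esub>t\<in>{1..p + h}. juxt p y z t (x1 (block p \<sigma> \<tau> t)))"
        by (simp add: F_def \<Psi>_def chi_comp[OF \<rho> block_W(1)[OF \<sigma> \<tau>]] block_W(2)[OF \<sigma> \<tau>] x1_def)
      also have "\<dots> = (\<chi> (p + h) \<rho> \<otimes>\<^bsub>K\<^esub> (\<chi> p \<sigma> \<otimes>\<^bsub>K\<^esub> \<chi> h \<tau>)) \<otimes>\<^bsub>K\<^esub>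
          ((\<Otimes>\<^bsub>K\<^esub>t\<in>{1..p}. y t (x1 (\<sigma> t))) \<otimes>\<^bsub>K\<^esub> (\<Otimes>\<^bsub>K\<^esub>t\<in>{1..h}. z t (x2 (\<tau> t))))"
        unfolding prod_juxt_block[OF x1 y z \<sigma> \<tau>] x2_def ..
      also have "\<dots> = \<chi> (p + h) \<rho> \<otimes>\<^bsub>K\<^esub> (A \<sigma> \<otimes>\<^bsub>K\<^esub> B \<tau>)"
        using P1[OF \<sigma>] P2[OF \<tau>] \<rho> \<sigma> \<tau> by (simp add: A_def B_def K.m_ac)
      finally show ?thesis .
    qed
    have "(\<Oplus>\<^bsub>K\<^esub>j\<in>W p \<times> W h. F (\<Psi> (\<rho>, j))) =
        finsum K (\<lambda>(\<sigma>, \<tau>). \<chi> (p + h) \<rho> \<otimes>\<^bsub>K\<^esub> (A \<sigma> \<otimes>\<^bsub>K\<^esub> B \<tau>)) (W p \<times> W h)"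
      using A B \<rho> by (intro K.finsum_cong') (auto simp: FAB)
    also have "\<dots> = (\<Oplus>\<^bsub>K\<^esub>\<sigma>\<in>W p. \<Oplus>\<^bsub>K\<^esub>\<tau>\<in>W h. \<chi> (p + h) \<rho> \<otimes>\<^bsub>K\<^esub> (A \<sigma> \<otimes>\<^bsub>K\<^esub> B \<tau>))"
      using A B \<rho> by (intro K.finsum_Times finite_W) auto
    also have "\<dots> = (\<Oplus>\<^bsub>K\<^esub>\<sigma>\<in>W p. \<chi> (p + h) \<rho> \<otimes>\<^bsub>K\<^esub> A \<sigma> \<otimes>\<^bsub>K\<^esub> pairing h x2 z)"
    proof (rule K.finsum_cong')
      fix \<sigma> assume \<sigma>: "\<sigma> \<in> W p"
      have "(\<Oplus>\<^bsub>K\<^esub>\<tau>\<in>W h. \<chi> (p + h) \<rho> \<otimes>\<^bsub>K\<^esub> (A \<sigma> \<otimes>\<^bsub>K\<^esub> B \<tau>)) =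
          (\<Oplus>\<^bsub>K\<^esub>\<tau>\<in>W h. (\<chi> (p + h) \<rho> \<otimes>\<^bsub>K\<^esub> A \<sigma>) \<otimes>\<^bsub>K\<^esub> B \<tau>)"
        using A[OF \<sigma>] B \<rho> by (intro K.finsum_cong') (auto simp: K.m_assoc)
      also have "\<dots> = (\<chi> (p + h) \<rho> \<otimes>\<^bsub>K\<^esub> A \<sigma>) \<otimes>\<^bsub>K\<^esub> pairing h x2 z"
        unfolding sums(2) using A[OF \<sigma>] B \<rho> by (intro K.finsum_rdistr[symmetric] finite_W) auto
      finally show "(\<Oplus>\<^bsub>K\<^esub>\<tau>\<in>W h. \<chi> (p + h) \<rho> \<otimes>\<^bsub>K\<^esub> (A \<sigma> \<otimes>\<^bsub>K\<^esub> B \<tau>)) =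
        \<chi> (p + h) \<rho> \<otimes>\<^bsub>K\<^esub> A \<sigma> \<otimes>\<^bsub>K\<^esub> pairing h x2 z" .
    qed (use A \<rho> sc in auto)
    also have "\<dots> = (\<Oplus>\<^bsub>K\<^esub>\<sigma>\<in>W p. \<chi> (p + h) \<rho> \<otimes>\<^bsub>K\<^esub> A \<sigma>) \<otimes>\<^bsub>K\<^esub> pairing h x2 z"
      using A \<rho> sc by (intro K.finsum_ldistr[symmetric] finite_W) auto
    also have "(\<Oplus>\<^bsub>K\<^esub>\<sigma>\<in>W p. \<chi> (p + h) \<rho> \<otimes>\<^bsub>K\<^esub> A \<sigma>) = \<chi> (p + h) \<rho> \<otimes>\<^bsub>K\<^esub> pairing p x1 y"
      unfolding sums(1) using A \<rho> by (intro K.finsum_rdistr[symmetric] finite_W) auto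
    finally show "(\<Oplus>\<^bsub>K\<^esub>j\<in>W p \<times> W h. F (\<Psi> (\<rho>, j))) =
      (\<chi> (p + h) \<rho> \<otimes>\<^bsub>K\<^esub> pairing p (\<lambda>t. x (\<rho> t)) y) \<otimes>\<^bsub>K\<^esub> pairing h (\<lambda>t. x (\<rho> (p + t))) z"
      unfolding x2_def x1_def .
  next
    show "(\<lambda>\<rho>. (\<chi> (p + h) \<rho> \<otimes>\<^bsub>K\<^esub> pairing p (\<lambda>t. x (\<rho> t)) y) \<otimes>\<^bsub>K\<^esub> pairing h (\<lambda>t. x (\<rho> (p + t))) z)
        \<in> ?M \<rightarrow> carrier K"
    proof
      fix \<rho> assume "\<rho> \<in> ?M"
      then have \<rho>: "\<rho> \<in> W (p + h)" using min_reps_subset by auto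
      have "(\<lambda>t. x (\<rho> t)) \<in> {1..p + h} \<rightarrow> carrier E"
        by (intro Pi_I funcset_mem[OF x] W_in[OF \<rho>])
      then have "(\<lambda>t. x (\<rho> t)) \<in> {1..p} \<rightarrow> carrier E" "(\<lambda>t. x (\<rho> (p + t))) \<in> {1..h} \<rightarrow> carrier E"
        by (auto simp: Pi_iff)
      then show "(\<chi> (p + h) \<rho> \<otimes>\<^bsub>K\<^esub> pairing p (\<lambda>t. x (\<rho> t)) y) \<otimes>\<^bsub>K\<^esub>
          pairing h (\<lambda>t. x (\<rho> (p + t))) z \<in> carrier K"
        using \<rho> by (intro K.m_closed chi_closed pairing_closed[OF _ y] pairing_closed[OF _ z])
    qed
  qed simp
  finally show ?thesis .
qed

end

section \<open>The right inner product\<close>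

text \<open>Subtraction in \<open>ring_module K\<close> is formed with the additive inverse of that
  record, which \<open>ring_module_simps\<close> does not rewrite to the one of \<open>K\<close>.
  The difference of equal elements is the case that arises when uniqueness is proved.\<close>

lemma ring_module_minus:
  assumes "x \<in> carrier K" "cring K"
  shows "x \<ominus>\<^bsub>ring_module K\<^esub> x = \<zero>\<^bsub>K\<^esub>"
proof -
  interpret R: module K "ring_module K" by (rule ring_module_module) fact
  have "x \<ominus>\<^bsub>ring_module K\<^esub> x = \<zero>\<^bsub>ring_module K\<^esub>"
    unfolding a_minus_def using assms(1) by (intro R.r_neg) simp
  then show ?thesis by simp
qed

lemma chi_algebra_simps:
  "a \<in> carrier (chi_algebra K W \<chi> M) \<longleftrightarrow>
    (\<forall>d. a d \<in> carrier (chi_power K W \<chi> M d)) \<and> finite {d. a d \<noteq> \<zero>\<^bsub>chi_power K W \<chi> M d\<^esub>}"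
  "\<zero>\<^bsub>chi_algebra K W \<chi> M\<^esub> = (\<lambda>d. \<zero>\<^bsub>chi_power K W \<chi> M d\<^esub>)"
  "(a \<otimes>\<^bsub>chi_algebra K W \<chi> M\<^esub> b) n =
    (\<Oplus>\<^bsub>chi_power K W \<chi> M n\<^esub>d\<in>{0..n}. chi_mult K W \<chi> M d (n - d) (a d) (b (n - d)))"
  by (simp_all add: chi_algebra_def Let_def)

context invariant_chars
begin

section \<open>Multiplication by a homogeneous element\<close>

context
  fixes M :: "('k, 'e, 'm) module_scheme"
  assumes M: "module K M"
begin

lemma in_degree_carrier:
  assumes "u \<in> carrier (chi_power K W \<chi> M d)"
  shows "in_degree (chi_power K W \<chi> M) d u \<in> carrier (chi_algebra K W \<chi> M)"
proof -
  interpret P: module K "chi_power K W \<chi> M i" for i by (rule chi_power_module[OF M])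
  have "{i. in_degree (chi_power K W \<chi> M) d u i \<noteq> \<zero>\<^bsub>chi_power K W \<chi> M i\<^esub>} \<subseteq> {d}"
    by (auto simp: in_degree_def)
  then show ?thesis
    using assms by (auto simp: chi_algebra_simps in_degree_def intro: finite_subset)
qed

lemma zero_carrier: "\<zero>\<^bsub>chi_algebra K W \<chi> M\<^esub> \<in> carrier (chi_algebra K W \<chi> M)"
proof -
  interpret P: module K "chi_power K W \<chi> M i" for i by (rule chi_power_module[OF M])
  show ?thesis by (simp add: chi_algebra_simps)
qed

lemma chi_mult_zero:
  assumes "v \<in> carrier (chi_power K W \<chi> M e)"
  shows "chi_mult K W \<chi> M d e \<zero>\<^bsub>chi_power K W \<chi> M d\<^esub> v = \<zero>\<^bsub>chi_power K W \<chi> M (d + e)\<^esub>"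
  by (rule lin_zero[OF chi_power_module[OF M] chi_power_module[OF M]
        bilinear_mapD(1)[OF chi_mult_spec(1)[OF M] assms]])

text \<open>The left factor vanishes outside degree \<open>p\<close> and the product is bilinear, so
  only the summand \<open>d = p\<close> can be nonzero; for \<open>n < p\<close> it does not occur
  among the indices \<open>0..n\<close>.\<close>

lemma in_degree_mult:
  assumes u: "u \<in> carrier (chi_power K W \<chi> M p)" and x: "x \<in> carrier (chi_algebra K W \<chi> M)"
  shows "(in_degree (chi_power K W \<chi> M) p u \<otimes>\<^bsub>chi_algebra K W \<chi> M\<^esub> x) (p + h) =
      chi_mult K W \<chi> M p h u (x h)"
    and "n < p \<Longrightarrow> (in_degree (chi_power K W \<chi> M) p u \<otimes>\<^bsub>chi_algebra K W \<chi> M\<^esub> x) n =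
      \<zero>\<^bsub>chi_power K W \<chi> M n\<^esub>"
proof -
  interpret P: module K "chi_power K W \<chi> M i" for i by (rule chi_power_module[OF M])
  have xc: "x i \<in> carrier (chi_power K W \<chi> M i)" for i using x by (simp add: chi_algebra_simps)
  have 0: "chi_mult K W \<chi> M d (n - d) (in_degree (chi_power K W \<chi> M) p u d) (x (n - d)) =
      \<zero>\<^bsub>chi_power K W \<chi> M n\<^esub>" if "d \<in> {0..n}" "d \<noteq> p" for d n
    using chi_mult_zero[OF xc, of d "n - d"] that by (simp add: in_degree_def)
  have c: "chi_mult K W \<chi> M p h u (x h) \<in> carrier (chi_power K W \<chi> M (p + h))"
    using lin_mapsD(1)[OF bilinear_mapD(2)[OF chi_mult_spec(1)[OF M] u] xc] .
  show "(in_degree (chi_power K W \<chi> M) p u \<otimes>\<^bsub>chi_algebra K W \<chi> M\<^esub> x) (p + h) =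
      chi_mult K W \<chi> M p h u (x h)"
    unfolding chi_algebra_simps(3)
    by (subst P.finsum_eq_single[of _ p]) (auto simp: 0 c, auto simp: in_degree_def c)
  show "(in_degree (chi_power K W \<chi> M) p u \<otimes>\<^bsub>chi_algebra K W \<chi> M\<^esub> x) n =
      \<zero>\<^bsub>chi_power K W \<chi> M n\<^esub>" if "n < p"
    unfolding chi_algebra_simps(3) using that by (intro P.add.finprod_one_eqI 0) auto
qed

end

section \<open>Homogeneous components of the pairing and the inner product\<close>

context
  fixes E :: "('k, 'e, 'm) module_scheme"
  assumes E: "module K E"
begin

lemma chi_form_deg_zero:
  "w \<in> carrier (chi_power K W \<chi> (dual K E) d) \<Longrightarrow>
    chi_form_deg K W \<chi> E d \<zero>\<^bsub>chi_power K W \<chi> E d\<^esub> w = \<zero>\<^bsub>K\<^esub>"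
  "u \<in> carrier (chi_power K W \<chi> E d) \<Longrightarrow>
    chi_form_deg K W \<chi> E d u \<zero>\<^bsub>chi_power K W \<chi> (dual K E) d\<^esub> = \<zero>\<^bsub>K\<^esub>"
  using lin_zero[OF chi_power_module[OF E] ring_module_module[OF K.cring_axioms]
      bilinear_mapD(1)[OF chi_form_deg_spec(1)[OF E]]]
    lin_zero[OF chi_power_module[OF dual_module[OF E]] ring_module_module[OF K.cring_axioms]
      bilinear_mapD(2)[OF chi_form_deg_spec(1)[OF E]]]
  by simp_all

lemma chi_form_deg_closed:
  "u \<in> carrier (chi_power K W \<chi> E d) \<Longrightarrow> w \<in> carrier (chi_power K W \<chi> (dual K E) d) \<Longrightarrow>
    chi_form_deg K W \<chi> E d u w \<in> carrier K"
  using lin_mapsD(1)[OF bilinear_mapD(2)[OF chi_form_deg_spec(1)[OF E]]] by simp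

text \<open>The premise on \<open>b\<close> concerns the single component \<open>b d\<close>. A
  product of forms can therefore stand for \<open>b\<close> once its component in one degree is
  known, without a proof that it has finite support.\<close>

lemma chi_form_in_degree_left:
  assumes "u \<in> carrier (chi_power K W \<chi> E d)" "b d \<in> carrier (chi_power K W \<chi> (dual K E) d)"
  shows "chi_form K W \<chi> E (in_degree (chi_power K W \<chi> E) d u) b = chi_form_deg K W \<chi> E d u (b d)"
\<comment> \<open>\<open>chi_form\<close> sums over the support of its first argument, which is
  empty rather than \<open>{d}\<close> when \<open>u\<close> is zero.\<close>
proof (cases "u = \<zero>\<^bsub>chi_power K W \<chi> E d\<^esub>")
  case True
  then have "{i. in_degree (chi_power K W \<chi> E) d u i \<noteq> \<zero>\<^bsub>chi_power K W \<chi> E i\<^esub>} = {}"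
    by (auto simp: in_degree_def)
  then show ?thesis using True assms chi_form_deg_zero(1) by (simp add: chi_form_def)
next
  case False
  then have "{i. in_degree (chi_power K W \<chi> E) d u i \<noteq> \<zero>\<^bsub>chi_power K W \<chi> E i\<^esub>} = {d}"
    by (auto simp: in_degree_def)
  then show ?thesis
    using chi_form_deg_closed[OF assms] by (simp add: chi_form_def in_degree_def)
qed

text \<open>The sum runs over the support of \<open>b\<close>, which may or may not contain
  \<open>d\<close>. Other degrees contribute zero because the second argument vanishes there; if
  \<open>d\<close> is missing, the right-hand side is zero as well.\<close>

lemma chi_form_in_degree_right:
  assumes b: "b \<in> carrier (chi_algebra K W \<chi> E)"
    and w: "w \<in> carrier (chi_power K W \<chi> (dual K E) d)"
  shows "chi_form K W \<chi> E b (in_degree (chi_power K W \<chi> (dual K E)) d w) =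
    chi_form_deg K W \<chi> E d (b d) w"
proof -
  let ?S = "{i. b i \<noteq> \<zero>\<^bsub>chi_power K W \<chi> E i\<^esub>}"
  have bc: "b i \<in> carrier (chi_power K W \<chi> E i)" and fin: "finite ?S" for i
    using b by (simp_all add: chi_algebra_simps)
  have 0: "chi_form_deg K W \<chi> E i (b i) (in_degree (chi_power K W \<chi> (dual K E)) d w i) = \<zero>\<^bsub>K\<^esub>"
    if "i \<noteq> d" for i
    using that chi_form_deg_zero(2)[OF bc] by (simp add: in_degree_def)
  have d: "in_degree (chi_power K W \<chi> (dual K E)) d w d = w" by (simp add: in_degree_def)
  show ?thesis
  proof (cases "d \<in> ?S")
    case True
    show ?thesis
      unfolding chi_form_def
      by (subst K.finsum_eq_single[OF fin True]) (simp_all add: 0 d chi_form_deg_closed[OF bc w])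
  next
    case False
    then have "chi_form_deg K W \<chi> E d (b d) w = \<zero>\<^bsub>K\<^esub>"
      using chi_form_deg_zero(1)[OF w] by simp
    moreover have "chi_form K W \<chi> E b (in_degree (chi_power K W \<chi> (dual K E)) d w) = \<zero>\<^bsub>K\<^esub>"
      unfolding chi_form_def using False by (intro K.add.finprod_one_eqI 0) auto
    ultimately show ?thesis by simp
  qed
qed

text \<open>Non-degeneracy turns the description behind \<open>THE\<close> into a criterion: testing
  against forms concentrated in degree \<open>d\<close> isolates the component in degree
  \<open>d\<close>, so any two candidates agree degree by degree.\<close>

lemma right_inner_eqI:
  assumes basis: "has_finite_basis K E" and rat: "contains_rationals K"
    and b: "b \<in> carrier (chi_algebra K W \<chi> E)"
    and eq: "\<And>x. x \<in> carrier (chi_algebra K W \<chi> (dual K E)) \<Longrightarrow>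
      chi_form K W \<chi> E b x = chi_form K W \<chi> E a (a' \<otimes>\<^bsub>chi_algebra K W \<chi> (dual K E)\<^esub> x)"
  shows "right_inner K W \<chi> E a a' = b"
  unfolding right_inner_def
proof (rule the_equality)
  show "b \<in> carrier (chi_algebra K W \<chi> E) \<and>
     (\<forall>x \<in> carrier (chi_algebra K W \<chi> (dual K E)).
        chi_form K W \<chi> E b x = chi_form K W \<chi> E a (a' \<otimes>\<^bsub>chi_algebra K W \<chi> (dual K E)\<^esub> x))"
    using b eq by blast
next
  note D = dual_module[OF E] and R = ring_module_module[OF K.cring_axioms]
  fix c assume c: "c \<in> carrier (chi_algebra K W \<chi> E) \<and>
     (\<forall>x \<in> carrier (chi_algebra K W \<chi> (dual K E)).
        chi_form K W \<chi> E c x = chi_form K W \<chi> E a (a' \<otimes>\<^bsub>chi_algebra K W \<chi> (dual K E)\<^esub> x))"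
  show "c = b"
  proof
    fix d
    interpret P: module K "chi_power K W \<chi> E d" by (rule chi_power_module[OF E])
    have cd: "c d \<in> carrier (chi_power K W \<chi> E d)" and bd: "b d \<in> carrier (chi_power K W \<chi> E d)"
      using c b by (simp_all add: chi_algebra_simps)
    have "c d \<ominus>\<^bsub>chi_power K W \<chi> E d\<^esub> b d = \<zero>\<^bsub>chi_power K W \<chi> E d\<^esub>"
    proof (rule chi_form_deg_nondegenerate[OF E basis rat])
      show "c d \<ominus>\<^bsub>chi_power K W \<chi> E d\<^esub> b d \<in> carrier (chi_power K W \<chi> E d)"
        by (rule P.minus_closed[OF cd bd])
      fix y assume y: "y \<in> {1..d} \<rightarrow> carrier (dual K E)"
      let ?w = "chi_vec K W \<chi> (dual K E) d y"
      have w: "?w \<in> carrier (chi_power K W \<chi> (dual K E) d)" by (rule chi_vec_closed[OF D y])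
      note x = in_degree_carrier[OF D w]
      have "chi_form_deg K W \<chi> E d (c d) ?w = chi_form_deg K W \<chi> E d (b d) ?w"
        using c eq[OF x] x chi_form_in_degree_right[OF b w] chi_form_in_degree_right[OF _ w, of c]
        by simp
      then show "chi_form_deg K W \<chi> E d (c d \<ominus>\<^bsub>chi_power K W \<chi> E d\<^esub> b d) ?w = \<zero>\<^bsub>K\<^esub>"
        using lin_minus[OF P.module_axioms R bilinear_mapD(1)[OF chi_form_deg_spec(1)[OF E] w] cd bd]
          chi_form_deg_closed[OF bd w]
        by (simp add: ring_module_minus K.cring_axioms)
    qed
    then show "c d = b d" using cd bd by (rule P.minus_eq_zeroD)
  qed
qed

text \<open>Both sides are linear in \<open>w\<close>, so decomposable forms suffice; for these the
  equation is \<open>pairing_juxt\<close>, with the second pairing pulled out of the sum by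
  linearity in the vector argument.\<close>

lemma chi_form_deg_mult:
  assumes a: "a \<in> {1..p + h} \<rightarrow> carrier E" and a': "a' \<in> {1..p} \<rightarrow> carrier (dual K E)"
    and w: "w \<in> carrier (chi_power K W \<chi> (dual K E) h)"
  shows "chi_form_deg K W \<chi> E (p + h) (chi_vec K W \<chi> E (p + h) a)
      (chi_mult K W \<chi> (dual K E) p h (chi_vec K W \<chi> (dual K E) p a') w) =
    chi_form_deg K W \<chi> E h
      (\<Oplus>\<^bsub>chi_power K W \<chi> E h\<^esub>\<rho>\<in>min_reps W (p + h) p h.
        (\<chi> (p + h) \<rho> \<otimes>\<^bsub>K\<^esub> pairing p (\<lambda>t. a (\<rho> t)) a') \<odot>\<^bsub>chi_power K W \<chi> E h\<^esub>
        chi_vec K W \<chi> E h (\<lambda>t. a (\<rho> (p + t)))) w"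
    and "(\<Oplus>\<^bsub>chi_power K W \<chi> E h\<^esub>\<rho>\<in>min_reps W (p + h) p h.
        (\<chi> (p + h) \<rho> \<otimes>\<^bsub>K\<^esub> pairing p (\<lambda>t. a (\<rho> t)) a') \<odot>\<^bsub>chi_power K W \<chi> E h\<^esub>
        chi_vec K W \<chi> E h (\<lambda>t. a (\<rho> (p + t)))) \<in> carrier (chi_power K W \<chi> E h)"
    (is "?b \<in> _")
proof -
  let ?P = "chi_power K W \<chi> E h" and ?M = "min_reps W (p + h) p h"
  note D = dual_module[OF E] and R = ring_module_module[OF K.cring_axioms]
  interpret P: module K ?P by (rule chi_power_module[OF E])
  have finM: "finite ?M" by (rule finite_subset[OF min_reps_subset finite_W])
  define c where "c \<rho> = \<chi> (p + h) \<rho> \<otimes>\<^bsub>K\<^esub> pairing p (\<lambda>t. a (\<rho> t)) a'" for \<rho>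
  have a\<rho>: "(\<lambda>t. a (\<rho> t)) \<in> {1..p} \<rightarrow> carrier E" "(\<lambda>t. a (\<rho> (p + t))) \<in> {1..h} \<rightarrow> carrier E"
    and \<rho>W: "\<rho> \<in> W (p + h)" if "\<rho> \<in> ?M" for \<rho>
  proof -
    show \<rho>: "\<rho> \<in> W (p + h)" using that min_reps_subset by auto
    have "(\<lambda>t. a (\<rho> t)) \<in> {1..p + h} \<rightarrow> carrier E"
      by (intro Pi_I funcset_mem[OF a] W_in[OF \<rho>])
    then show "(\<lambda>t. a (\<rho> t)) \<in> {1..p} \<rightarrow> carrier E" "(\<lambda>t. a (\<rho> (p + t))) \<in> {1..h} \<rightarrow> carrier E"
      by (auto simp: Pi_iff)
  qed
  have c: "c \<rho> \<in> carrier K" if "\<rho> \<in> ?M" for \<rho>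
    unfolding c_def using \<rho>W[OF that] pairing_closed[OF a\<rho>(1)[OF that] a'] by simp
  have v: "chi_vec K W \<chi> E h (\<lambda>t. a (\<rho> (p + t))) \<in> carrier ?P" if "\<rho> \<in> ?M" for \<rho>
    by (rule chi_vec_closed[OF E a\<rho>(2)[OF that]])
  show b: "?b \<in> carrier ?P"
    unfolding c_def[symmetric] by (intro P.finsum_closed Pi_I P.smult_closed c v)
  note va = chi_vec_closed[OF E a] and va' = chi_vec_closed[OF D a']
  show "chi_form_deg K W \<chi> E (p + h) (chi_vec K W \<chi> E (p + h) a)
      (chi_mult K W \<chi> (dual K E) p h (chi_vec K W \<chi> (dual K E) p a') w) =
    chi_form_deg K W \<chi> E h ?b w"
  proof (rule chi_lin_eqI[OF D R lin_maps_comp[OF bilinear_mapD(2)[OF chi_mult_spec(1)[OF D] va']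
          bilinear_mapD(2)[OF chi_form_deg_spec(1)[OF E] va]]
        bilinear_mapD(2)[OF chi_form_deg_spec(1)[OF E] b] _ w])
    fix y assume y: "y \<in> {1..h} \<rightarrow> carrier (dual K E)"
    let ?w = "chi_vec K W \<chi> (dual K E) h y"
    have w: "?w \<in> carrier (chi_power K W \<chi> (dual K E) h)" by (rule chi_vec_closed[OF D y])
    note L = bilinear_mapD(1)[OF chi_form_deg_spec(1)[OF E] w]
    have "chi_form_deg K W \<chi> E h ?b ?w =
        (\<Oplus>\<^bsub>ring_module K\<^esub>\<rho>\<in>?M. chi_form_deg K W \<chi> E h
          (c \<rho> \<odot>\<^bsub>?P\<^esub> chi_vec K W \<chi> E h (\<lambda>t. a (\<rho> (p + t)))) ?w)"
      unfolding c_def[symmetric]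
      by (intro lin_finsum[OF P.module_axioms R L finM] Pi_I P.smult_closed c v)
    also have "\<dots> = (\<Oplus>\<^bsub>K\<^esub>\<rho>\<in>?M. c \<rho> \<otimes>\<^bsub>K\<^esub> pairing h (\<lambda>t. a (\<rho> (p + t))) y)"
      unfolding ring_module_simps
      using c v pairing_closed[OF a\<rho>(2) y]
      by (intro K.finsum_cong')
        (auto simp: lin_mapsD(3)[OF L] chi_form_deg_spec(2)[OF E a\<rho>(2) y])
    also have "\<dots> = pairing (p + h) a (juxt p a' y)"
      unfolding c_def by (rule pairing_juxt[OF a a' y, symmetric])
    also have "\<dots> = chi_form_deg K W \<chi> E (p + h) (chi_vec K W \<chi> E (p + h) a)
      (chi_mult K W \<chi> (dual K E) p h (chi_vec K W \<chi> (dual K E) p a') ?w)"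
      unfolding chi_mult_spec(2)[OF D a' y]
      by (rule chi_form_deg_spec(2)[OF E a juxt_in[OF a' y], symmetric])
    finally show "chi_form_deg K W \<chi> E (p + h) (chi_vec K W \<chi> E (p + h) a)
      (chi_mult K W \<chi> (dual K E) p h (chi_vec K W \<chi> (dual K E) p a') ?w) =
      chi_form_deg K W \<chi> E h ?b ?w" ..
  qed
qed

text \<open>The coefficients in the final formula are pairings in the whole algebra; this identifies
  them with the sums over tuples that the preceding computations use.\<close>

lemma chi_form_decomposable:
  assumes "x \<in> {1..d} \<rightarrow> carrier E" "y \<in> {1..d} \<rightarrow> carrier (dual K E)"
  shows "chi_form K W \<chi> E (decomposable K W \<chi> E d x) (decomposable K W \<chi> (dual K E) d y) =
    pairing d x y"
proof -
  note v = chi_vec_closed[OF E assms(1)] and w = chi_vec_closed[OF dual_module[OF E] assms(2)]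
  have "decomposable K W \<chi> (dual K E) d y d = chi_vec K W \<chi> (dual K E) d y"
    by (simp add: decomposable_def in_degree_def)
  then show ?thesis
    using chi_form_in_degree_left[OF v, of "decomposable K W \<chi> (dual K E) d y"] w
    by (simp add: chi_form_deg_spec(2)[OF E assms] decomposable_def)
qed

lemma right_inner_decomposable:
  assumes basis: "has_finite_basis K E" and rat: "contains_rationals K"
    and a: "a \<in> {1..p + h} \<rightarrow> carrier E" and a': "a' \<in> {1..p} \<rightarrow> carrier (dual K E)"
  shows "right_inner K W \<chi> E (decomposable K W \<chi> E (p + h) a) (decomposable K W \<chi> (dual K E) p a') =
    in_degree (chi_power K W \<chi> E) h
      (\<Oplus>\<^bsub>chi_power K W \<chi> E h\<^esub>\<rho>\<in>min_reps W (p + h) p h.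
        (\<chi> (p + h) \<rho> \<otimes>\<^bsub>K\<^esub> pairing p (\<lambda>t. a (\<rho> t)) a') \<odot>\<^bsub>chi_power K W \<chi> E h\<^esub>
        chi_vec K W \<chi> E h (\<lambda>t. a (\<rho> (p + t))))" (is "_ = in_degree _ _ ?b")
proof (rule right_inner_eqI[OF basis rat])
  note D = dual_module[OF E]
  interpret P: module K "chi_power K W \<chi> E h" by (rule chi_power_module[OF E])
  interpret Q: module K "chi_power K W \<chi> (dual K E) h" by (rule chi_power_module[OF D])
  \<comment> \<open>Zero is supplied as the form \<open>w\<close> that
    \<open>chi_form_deg_mult\<close> asks for.\<close>
  have b: "?b \<in> carrier (chi_power K W \<chi> E h)"
    by (rule chi_form_deg_mult(2)[OF a a' Q.zero_closed])
  then show "in_degree (chi_power K W \<chi> E) h ?b \<in> carrier (chi_algebra K W \<chi> E)"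
    by (rule in_degree_carrier[OF E])
  fix x assume x: "x \<in> carrier (chi_algebra K W \<chi> (dual K E))"
  note va = chi_vec_closed[OF E a] and va' = chi_vec_closed[OF D a']
  have xh: "x h \<in> carrier (chi_power K W \<chi> (dual K E) h)" using x by (simp add: chi_algebra_simps)
  let ?y = "decomposable K W \<chi> (dual K E) p a' \<otimes>\<^bsub>chi_algebra K W \<chi> (dual K E)\<^esub> x"
  have y: "?y (p + h) = chi_mult K W \<chi> (dual K E) p h (chi_vec K W \<chi> (dual K E) p a') (x h)"
    unfolding decomposable_def by (rule in_degree_mult(1)[OF D va' x])
  have yc: "?y (p + h) \<in> carrier (chi_power K W \<chi> (dual K E) (p + h))"
    unfolding y by (rule lin_mapsD(1)[OF bilinear_mapD(2)[OF chi_mult_spec(1)[OF D] va'] xh])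
  have "chi_form K W \<chi> E (decomposable K W \<chi> E (p + h) a) ?y =
      chi_form_deg K W \<chi> E (p + h) (chi_vec K W \<chi> E (p + h) a) (?y (p + h))"
    unfolding decomposable_def[of K W \<chi> E]
    by (rule chi_form_in_degree_left[OF va, of ?y, OF yc])
  also have "\<dots> = chi_form_deg K W \<chi> E h ?b (x h)"
    unfolding y by (rule chi_form_deg_mult(1)[OF a a' xh])
  also have "\<dots> = chi_form K W \<chi> E (in_degree (chi_power K W \<chi> E) h ?b) x"
    by (rule chi_form_in_degree_left[OF b, of x, OF xh, symmetric])
  finally show "chi_form K W \<chi> E (in_degree (chi_power K W \<chi> E) h ?b) x =
    chi_form K W \<chi> E (decomposable K W \<chi> E (p + h) a) ?y" ..
qed

text \<open>Every product with a form of degree \<open>p\<close> starts in degree \<open>p\<close>,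
  so its component in the smaller degree \<open>n\<close>, the only one that a vector of degree
  \<open>n\<close> sees, is zero.\<close>

lemma right_inner_decomposable_less:
  assumes basis: "has_finite_basis K E" and rat: "contains_rationals K" and "n < p"
    and a: "a \<in> {1..n} \<rightarrow> carrier E" and a': "a' \<in> {1..p} \<rightarrow> carrier (dual K E)"
  shows "right_inner K W \<chi> E (decomposable K W \<chi> E n a) (decomposable K W \<chi> (dual K E) p a') =
    \<zero>\<^bsub>chi_algebra K W \<chi> E\<^esub>"
proof (rule right_inner_eqI[OF basis rat zero_carrier[OF E]])
  note D = dual_module[OF E]
  interpret Q: module K "chi_power K W \<chi> (dual K E) n" by (rule chi_power_module[OF D])
  fix x assume x: "x \<in> carrier (chi_algebra K W \<chi> (dual K E))"
  note va = chi_vec_closed[OF E a] and va' = chi_vec_closed[OF D a']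
  let ?y = "decomposable K W \<chi> (dual K E) p a' \<otimes>\<^bsub>chi_algebra K W \<chi> (dual K E)\<^esub> x"
  have y: "?y n = \<zero>\<^bsub>chi_power K W \<chi> (dual K E) n\<^esub>"
    unfolding decomposable_def by (rule in_degree_mult(2)[OF D va' x assms(3)])
  have "chi_form K W \<chi> E (decomposable K W \<chi> E n a) ?y =
      chi_form_deg K W \<chi> E n (chi_vec K W \<chi> E n a) (?y n)"
    unfolding decomposable_def[of K W \<chi> E]
    by (rule chi_form_in_degree_left[OF va, of ?y]) (simp add: y)
  also have "\<dots> = \<zero>\<^bsub>K\<^esub>" unfolding y by (rule chi_form_deg_zero(2)[OF va])
  also have "\<dots> = chi_form K W \<chi> E \<zero>\<^bsub>chi_algebra K W \<chi> E\<^esub> x"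
    by (simp add: chi_form_def chi_algebra_simps(2))
  finally show "chi_form K W \<chi> E \<zero>\<^bsub>chi_algebra K W \<chi> E\<^esub> x =
    chi_form K W \<chi> E (decomposable K W \<chi> E n a) ?y" ..
qed

end

end

theorem proposition26:
  fixes K :: "'k ring" and E :: "('k, 'e) module"
    and W :: "nat \<Rightarrow> (nat \<Rightarrow> nat) set" and \<chi> :: "nat \<Rightarrow> (nat \<Rightarrow> nat) \<Rightarrow> 'k"
    and n p :: nat and h :: int
    and a :: "nat \<Rightarrow> 'e" and a' :: "nat \<Rightarrow> 'e \<Rightarrow> 'k"
  assumes "domain K" and "contains_rationals K"
    and "omega_invariant K W \<chi>"
    and "module K E" and "has_finite_basis K E"
    and "int n = int p + h"
    and "a \<in> {1..n} \<rightarrow> carrier E"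
    and "a' \<in> {1..p} \<rightarrow> carrier (dual K E)"
  shows "right_inner K W \<chi> E (decomposable K W \<chi> E n a) (decomposable K W \<chi> (dual K E) p a') =
    (if p \<le> n then
       in_degree (chi_power K W \<chi> E) (nat h)
         (\<Oplus>\<^bsub>chi_power K W \<chi> E (nat h)\<^esub>\<rho>\<in>min_reps W n p (nat h).
            (\<chi> n \<rho> \<otimes>\<^bsub>K\<^esub>
              chi_form K W \<chi> E (decomposable K W \<chi> E p (\<lambda>t. a (\<rho> t)))
                               (decomposable K W \<chi> (dual K E) p a'))
            \<odot>\<^bsub>chi_power K W \<chi> E (nat h)\<^esub> chi_vec K W \<chi> E (nat h) (\<lambda>t. a (\<rho> (p + t))))
     else \<zero>\<^bsub>chi_algebra K W \<chi> E\<^esub>)"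
proof -
  interpret invariant_chars K W \<chi>
    using assms(1,3) by (simp add: invariant_chars_def invariant_chars_axioms_def domain_def)
  show ?thesis
  proof (cases "p \<le> n")
    case True
    \<comment> \<open>For \<open>p \<le> n\<close> the integer \<open>h\<close> is nonnegative, so
      that \<open>n = p + m\<close> holds in the natural numbers; a negative \<open>h\<close>
      belongs to the other case, whose right-hand side is zero.\<close>
    define m where "m = nat h"
    have n: "n = p + m" using True assms(6) by (auto simp: m_def)
    interpret P: module K "chi_power K W \<chi> E m" by (rule chi_power_module[OF assms(4)])
    note a = assms(7)[unfolded n]
    have form: "chi_form K W \<chi> E (decomposable K W \<chi> E p (\<lambda>t. a (\<rho> t)))
        (decomposable K W \<chi> (dual K E) p a') = pairing p (\<lambda>t. a (\<rho> t)) a'"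
      and v: "chi_vec K W \<chi> E m (\<lambda>t. a (\<rho> (p + t))) \<in> carrier (chi_power K W \<chi> E m)"
      and c: "\<chi> (p + m) \<rho> \<otimes>\<^bsub>K\<^esub> pairing p (\<lambda>t. a (\<rho> t)) a' \<in> carrier K"
      if "\<rho> \<in> min_reps W (p + m) p m" for \<rho>
    proof -
      have \<rho>: "\<rho> \<in> W (p + m)" using that min_reps_subset by auto
      have "(\<lambda>t. a (\<rho> t)) \<in> {1..p + m} \<rightarrow> carrier E"
        by (intro Pi_I funcset_mem[OF a] W_in[OF \<rho>])
      then have 1: "(\<lambda>t. a (\<rho> t)) \<in> {1..p} \<rightarrow> carrier E"
        and 2: "(\<lambda>t. a (\<rho> (p + t))) \<in> {1..m} \<rightarrow> carrier E"
        by (auto simp: Pi_iff)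
      show "chi_form K W \<chi> E (decomposable K W \<chi> E p (\<lambda>t. a (\<rho> t)))
        (decomposable K W \<chi> (dual K E) p a') = pairing p (\<lambda>t. a (\<rho> t)) a'"
        by (rule chi_form_decomposable[OF assms(4) 1 assms(8)])
      show "chi_vec K W \<chi> E m (\<lambda>t. a (\<rho> (p + t))) \<in> carrier (chi_power K W \<chi> E m)"
        by (rule chi_vec_closed[OF assms(4) 2])
      show "\<chi> (p + m) \<rho> \<otimes>\<^bsub>K\<^esub> pairing p (\<lambda>t. a (\<rho> t)) a' \<in> carrier K"
        using \<rho> pairing_closed[OF 1 assms(8)] by simp
    qed
    have "(\<Oplus>\<^bsub>chi_power K W \<chi> E m\<^esub>\<rho>\<in>min_reps W (p + m) p m.
            (\<chi> (p + m) \<rho> \<otimes>\<^bsub>K\<^esub>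
              chi_form K W \<chi> E (decomposable K W \<chi> E p (\<lambda>t. a (\<rho> t)))
                               (decomposable K W \<chi> (dual K E) p a'))
            \<odot>\<^bsub>chi_power K W \<chi> E m\<^esub> chi_vec K W \<chi> E m (\<lambda>t. a (\<rho> (p + t)))) =
        (\<Oplus>\<^bsub>chi_power K W \<chi> E m\<^esub>\<rho>\<in>min_reps W (p + m) p m.
            (\<chi> (p + m) \<rho> \<otimes>\<^bsub>K\<^esub> pairing p (\<lambda>t. a (\<rho> t)) a')
            \<odot>\<^bsub>chi_power K W \<chi> E m\<^esub> chi_vec K W \<chi> E m (\<lambda>t. a (\<rho> (p + t))))"
      by (intro P.finsum_cong' Pi_I P.smult_closed c v) (simp_all add: form)
    with right_inner_decomposable[OF assms(4,5,2) a assms(8)] True show ?thesis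
      unfolding m_def[symmetric] n by simp
  next
    case False
    with right_inner_decomposable_less[OF assms(4,5,2) _ assms(7,8)] show ?thesis by simp
  qed
qed

end
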